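(* Let $r\ge 1$ and $s\ge 1$ be integers, let $K$ be a number field of degree $r+1$ that is Galois over $\mathbb{Q}$, and let $\alpha\in\mathcal{O}_K$ with $K=\mathbb{Q}(\alpha)$. Let $\{p_j\}_{j\ge 1}$ be the strictly increasing sequence of rational primes that are totally split in $K/\mathbb{Q}$ and do not divide the discriminant of the minimal polynomial of $\alpha$, and for $\ell\ge 0$ put $P_\ell=\prod_{i=1}^{\ell}p_i$ (so $P_0=1$). Let $0<c<1$, let $k$ be a positive real number with $k<1/\sqrt[r+1]{C_\alpha}$, and for $\ell\ge1$ let $$M_\ell=\left\lfloor\sqrt[s+1]{k\cdot P_\ell/P_{\lfloor c\ell\rfloor}}\right\rfloor ,\qquad \mathcal{C}_\ell=\mathcal{C}\left(r,s,K,M_\ell,\{p_i\}_{i\in\{1,\dots,\ell\}}\right).$$ Then the codes $\mathcal{C}_\ell$, indexed by the integers $\ell\ge1$ with $M_\ell\ge 1$ (these include all sufficiently large $\ell$), form an almost good family of good split codes.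
   Context: $\mathcal{O}_K$ is the ring of integers of $K$. A rational prime $p$ is totally split in $K$ if $p\mathcal{O}_K$ is a product of $[K:\mathbb{Q}]$ pairwise distinct prime ideals, each with residue field $\mathbb{F}_p$. Constant $C_\alpha$: if $m_\alpha(x)=b_0+b_1x+\dots+b_{\delta-1}x^{\delta-1}+x^\delta\in\mathbb{Z}[x]$ is the minimal polynomial of $\alpha$ over $\mathbb{Q}$ (here $\delta=r+1$) and $S=\max_{0\le i\le\delta-1}|b_i|$, then $C_\alpha=\delta^{\delta/2}(1+S)^{(\delta-1)\delta/2}$. The code $\mathcal{C}(r,s,K,M,\{p_i\}_{i\in\{1,\dots,\ell\}})$: for an integer $M\ge 1$ let $\mathcal{R}[M]^-=\{\sum_{i=0}^{r-1}a_i\alpha^i : a_i\in\mathbb{Z},\ 0\le a_i<M\}$ and $\mathcal{A}[M]=\{\sum_{j=0}^{s}f_jM^j : f_j\in\mathcal{R}[M]^-\}$. Let $p_1<\dots<p_\ell$ be rational primes totally split in $K$ and not dividing the discriminant of $m_\alpha$, and let $\mathfrak{p}^{(p_i)}_1,\dots,\mathfrak{p}^{(p_i)}_{r+1}$ be the primes of $\mathcal{O}_K$ above $p_i$. The code is the image $\phi(\mathcal{A}[M])$ of the map $\phi:\mathcal{A}[M]\to\prod_{i=1}^{\ell}\prod_{j=1}^{r+1}\mathcal{O}_K/\mathfrak{p}^{(p_i)}_j=\prod_{i=1}^{\ell}\mathbb{F}_{p_i}^{r+1}$, $x\mapsto(x\bmod\mathfrak{p}^{(p_i)}_j)_{i,j}$.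 It is called a good split code if $\prod_{i=1}^{\ell}\prod_{j=1}^{r+1}N(\mathfrak{p}^{(p_i)}_j)>C_\alpha\cdot(M^{s+1}-1)^{r+1}$, where $N(\mathfrak p)=\#(\mathcal{O}_K/\mathfrak p)$ is the ideal norm. Distance: a code is a subset of a finite product of finite fields; the distance of two codewords is the number of coordinates in which they differ, and $d(\mathcal{C})$ is the minimum distance between two distinct codewords of $\mathcal{C}$ (with the convention $d(\mathcal C)=+\infty$ if $\mathcal{C}$ has only one codeword). Almost good: a family of codes $\mathcal{C}_\ell\subseteq R_\ell$, where here $R_\ell=\prod_{i=1}^{\ell}\mathbb{F}_{p_i}^{r+1}$, is almost good if $\liminf_{\ell\to\infty}\frac{\log(\#\mathcal{C}_\ell)}{\log(\#R_\ell)}>0$ and $\liminf_{\ell\to\infty}d(\mathcal{C}_\ell)=+\infty$. *)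

theory Defs
  imports
    "HOL-Algebra.Algebraic_Closure_Type"
    "HOL-Algebra.Generated_Fields"
    "HOL-Algebra.Ideal_Product"
    "HOL-Algebra.IntRing"
    "HOL-Library.Extended_Nat"
    "HOL-Library.Extended_Real"
    "HOL-Library.Infinite_Set"
    "HOL-Computational_Algebra.Computational_Algebra"
    "Subresultants.Resultant_Prelim"
begin

section \<open>Number fields\<close>

text \<open>A number field is a type \<open>'k\<close> of class \<open>field_char_0\<close> that has finite dimension over the
  rationals. Its ring of integers and the ideals of that ring are those of HOL-Algebra.\<close>

text \<open>This is \<open>0\<close> if the dimension is infinite, so \<open>rat_degree TYPE('k) = r + 1\<close> includes
  finiteness.\<close>

definition rat_degree :: "'k::field_char_0 itself \<Rightarrow> nat" where
  "rat_degree _ = vector_space.dim (\<lambda>(q::rat) (x::'k). of_rat q * x) UNIV"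

text \<open>Every field automorphism fixes the rationals pointwise, so \<open>ring_iso K K\<close> is the group of
  automorphisms over the rationals. The extension is Galois if the fixed field of that group is
  the base field.\<close>

definition galois_over_rat :: "'k::field_char_0 itself \<Rightarrow> bool" where
  "galois_over_rat _ \<longleftrightarrow>
     rat_degree TYPE('k) > 0 \<and>
     {x::'k. \<forall>\<sigma>\<in>ring_iso ring_of_type_algebra ring_of_type_algebra. \<sigma> x = x} = \<rat>"

definition ring_of_integers :: "'k::field_char_0 ring" (\<open>\<O>\<close>) where
  "\<O> = ring_of_type_algebra\<lparr>carrier := {x. algebraic_int x}\<rparr>"

definition rat_adjoin :: "'k::field_char_0 \<Rightarrow> 'k set" where
  "rat_adjoin \<alpha> = generate_field ring_of_type_algebra (insert \<alpha> \<rat>)"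

definition ideal_norm :: "'k::field_char_0 set \<Rightarrow> nat" where
  "ideal_norm \<pp> = card (carrier (\<O> Quot \<pp>))"

definition primes_above :: "nat \<Rightarrow> 'k::field_char_0 set set" where
  "primes_above p = {\<pp>. primeideal \<pp> \<O> \<and> of_nat p \<in> \<pp>}"

definition totally_split :: "'k::field_char_0 itself \<Rightarrow> nat \<Rightarrow> bool" where
  "totally_split _ p \<longleftrightarrow>
     (\<exists>S :: 'k set set. finite S \<and> card S = rat_degree TYPE('k) \<and>
        (\<forall>\<pp>\<in>S. primeideal \<pp> \<O> \<and> (\<O> Quot \<pp>) \<simeq> ZFact (int p)) \<and>
        Idl\<^bsub>\<O>\<^esub> {of_nat p} = finprod (ideals_set \<O>) (\<lambda>\<pp>. \<pp>) S)"


section \<open>Minimal polynomial, discriminant and the constant of \<open>\<alpha>\<close>\<close>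

definition rat_min_poly :: "'k::field_char_0 \<Rightarrow> rat poly" where
  "rat_min_poly \<alpha> = (THE f. lead_coeff f = 1 \<and> poly (map_poly of_rat f) \<alpha> = 0 \<and>
     (\<forall>g. lead_coeff g = 1 \<and> poly (map_poly of_rat g) \<alpha> = 0 \<longrightarrow> degree f \<le> degree g))"

text \<open>For an algebraic integer \<open>\<alpha>\<close> the minimal polynomial over the rationals has integer
  coefficients; here it is viewed as an integer polynomial.\<close>

definition int_min_poly :: "'k::field_char_0 \<Rightarrow> int poly" where
  "int_min_poly \<alpha> = (THE f. map_poly of_int f = rat_min_poly \<alpha>)"

definition poly_discriminant :: "int poly \<Rightarrow> int" where
  "poly_discriminant f =
     (-1) ^ (degree f * (degree f - 1) div 2) * resultant f (pderiv f) div lead_coeff f"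

definition C_const :: "'k::field_char_0 \<Rightarrow> real" where
  "C_const \<alpha> =
     (let m = int_min_poly \<alpha>; \<delta> = degree m; S = Max ((\<lambda>i. \<bar>coeff m i\<bar>) ` {..<\<delta>})
      in real \<delta> powr (real \<delta> / 2) * (1 + real_of_int S) ^ ((\<delta> - 1) * \<delta> div 2))"

definition admissible_primes :: "'k::field_char_0 \<Rightarrow> nat set" where
  "admissible_primes \<alpha> =
     {p. prime p \<and> totally_split TYPE('k) p \<and> \<not> int p dvd poly_discriminant (int_min_poly \<alpha>)}"


section \<open>Codes\<close>

text \<open>A code with finite coordinate set \<open>I\<close> and a finite field \<open>F i\<close> at each coordinate.
  Words are functions that are \<open>undefined\<close> outside \<open>I\<close>.\<close>

definition code_space :: "'i set \<Rightarrow> ('i \<Rightarrow> 'b ring) \<Rightarrow> ('i \<Rightarrow> 'b) set" where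
  "code_space I F = (\<Pi>\<^sub>E i\<in>I. carrier (F i))"

definition is_code :: "'i set \<Rightarrow> ('i \<Rightarrow> 'b ring) \<Rightarrow> ('i \<Rightarrow> 'b) set \<Rightarrow> bool" where
  "is_code I F C \<longleftrightarrow> finite I \<and> (\<forall>i\<in>I. Ring.field (F i) \<and> finite (carrier (F i))) \<and>
     C \<subseteq> code_space I F"

definition hamming_dist :: "'i set \<Rightarrow> ('i \<Rightarrow> 'b) \<Rightarrow> ('i \<Rightarrow> 'b) \<Rightarrow> nat" where
  "hamming_dist I u v = card {i\<in>I. u i \<noteq> v i}"

text \<open>The infimum of the empty set in \<open>enat\<close> is \<open>\<infinity>\<close>.\<close>

definition min_dist :: "'i set \<Rightarrow> ('i \<Rightarrow> 'b) set \<Rightarrow> enat" where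
  "min_dist I C = Inf {enat (hamming_dist I u v) |u v. u \<in> C \<and> v \<in> C \<and> u \<noteq> v}"

text \<open>A family of codes indexed by an infinite set \<open>L\<close> of natural numbers; the limits are taken
  along \<open>L\<close>.\<close>

definition almost_good ::
  "nat set \<Rightarrow> (nat \<Rightarrow> 'i set) \<Rightarrow> (nat \<Rightarrow> 'i \<Rightarrow> 'b ring) \<Rightarrow> (nat \<Rightarrow> ('i \<Rightarrow> 'b) set) \<Rightarrow> bool" where
  "almost_good L I F C \<longleftrightarrow>
     infinite L \<and> (\<forall>l\<in>L. is_code (I l) (F l) (C l)) \<and>
     Liminf (inf sequentially (principal L))
       (\<lambda>l. ereal (ln (real (card (C l))) / ln (real (card (code_space (I l) (F l)))))) > 0 \<and>
     Liminf (inf sequentially (principal L)) (\<lambda>l. min_dist (I l) (C l)) = \<infinity>"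


section \<open>Split codes\<close>

definition message_digits :: "nat \<Rightarrow> 'k::field_char_0 \<Rightarrow> nat \<Rightarrow> 'k set" where
  "message_digits r \<alpha> M =
     {(\<Sum>i<r. of_int (a i) * \<alpha> ^ i) |a. \<forall>i<r. 0 \<le> a i \<and> a i < int M}"

definition messages :: "nat \<Rightarrow> nat \<Rightarrow> 'k::field_char_0 \<Rightarrow> nat \<Rightarrow> 'k set" where
  "messages r s \<alpha> M =
     {(\<Sum>j\<le>s. f j * of_nat M ^ j) |f. \<forall>j\<le>s. f j \<in> message_digits r \<alpha> M}"

text \<open>The coordinates are indexed by the pairs of an index \<open>i\<close> and a prime above \<open>p i\<close> rather
  than by an arbitrary numbering of these primes; the alphabet at \<open>(i, \<pp>)\<close> is the residue
  field of \<open>\<pp>\<close>.\<close>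

definition split_coords :: "(nat \<Rightarrow> nat) \<Rightarrow> nat \<Rightarrow> (nat \<times> 'k::field_char_0 set) set" where
  "split_coords p l = (SIGMA i:{1..l}. primes_above (p i))"

definition residue_alphabet :: "nat \<times> 'k::field_char_0 set \<Rightarrow> 'k set ring" where
  "residue_alphabet = (\<lambda>(i, \<pp>). \<O> Quot \<pp>)"

definition split_encode ::
  "(nat \<Rightarrow> nat) \<Rightarrow> nat \<Rightarrow> 'k::field_char_0 \<Rightarrow> nat \<times> 'k set \<Rightarrow> 'k set" where
  "split_encode p l x = restrict (\<lambda>(i, \<pp>). \<pp> +>\<^bsub>\<O>\<^esub> x) (split_coords p l)"

definition split_code ::
  "nat \<Rightarrow> nat \<Rightarrow> 'k::field_char_0 \<Rightarrow> nat \<Rightarrow> (nat \<Rightarrow> nat) \<Rightarrow> nat \<Rightarrow> (nat \<times> 'k set \<Rightarrow> 'k set) set" where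
  "split_code r s \<alpha> M p l = split_encode p l ` messages r s \<alpha> M"

text \<open>Being good is a property of the parameters of the code. The first three conjuncts are the
  conditions under which the code is defined.\<close>

definition good_split_code ::
  "nat \<Rightarrow> nat \<Rightarrow> 'k::field_char_0 \<Rightarrow> nat \<Rightarrow> (nat \<Rightarrow> nat) \<Rightarrow> nat \<Rightarrow> bool" where
  "good_split_code r s \<alpha> M p l \<longleftrightarrow>
     M \<ge> 1 \<and> strict_mono_on {1..l} p \<and> (\<forall>i\<in>{1..l}. p i \<in> admissible_primes \<alpha>) \<and>
     real (\<Prod>i=1..l. \<Prod>\<pp>\<in>(primes_above (p i) :: 'k set set). ideal_norm \<pp>)
       > C_const \<alpha> * (real M ^ (s + 1) - 1) ^ (r + 1)"

end

(*
  A nonzero message difference x has small coordinates in the power basis of alpha. Instead of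
  bounding its norm, we bound the index of x Z[alpha] in Z[alpha] by box counting: if pairwise
  incongruent elements modulo x are shifted by x times a large box, the shifted boxes are disjoint
  and lie in a common box. Chinese remaindering in Z[alpha] produces as many incongruent elements
  as the product of the primes below the coordinates where x vanishes. Hence this product is at most
  const * (M^(s+1))^(r+1), so the coordinates where x does not vanish carry a product of at least
  const * P_m^(r+1) with m = floor (c l), and the distance is at least of order ln P_m / ln p_l.

  It remains to see that ln p_l = O(l), while ln P_m / l tends to infinity trivially. If the minimal
  polynomial f has a root modulo p and p avoids finitely many primes, then p is totally split: a root
  gives a homomorphism from the integers of K to F_p, and composing it with the automorphisms gives
  r + 1 of them with different kernels. Erdos' counting argument (write each value of f as a b^E with
  a free of E-th powers) shows that the values of f at n <= N cannot all be composed of o(log N) primes.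
*)
theory Submission
  imports Defs "HOL-Number_Theory.Cong" "Jordan_Normal_Form.Char_Poly" "Subresultants.Subresultant_Gcd"
begin

section \<open>Algebraic integers\<close>

text \<open>\<open>C_const\<close> governs the inequality of a good split code. The distance
  argument tolerates any constant, because the cut factor P_m outgrows all of them; this is what
  makes box counting a substitute for norm estimates. The obstacle is that messages have coordinates
  in powers of \<alpha>, whereas residue fields belong to the full ring of integers, for which no
  basis is at hand. One nonzero integer \<open>d\<close> with \<open>d \<O>\<close> inside
  Z[\<alpha>] bridges the two: it extends a root of the minimal polynomial modulo p to a residue map
  on \<O>, and it moves Chinese remainder elements into Z[\<alpha>]. Its prime divisors cost only a
  bounded number of coordinates. The distance needs no more than an exponential bound on p_l, so no
  density theorem for split primes is invoked. Likewise the rate rests on ln P_m \<le> c ln P_l,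
  which comes from the monotonicity of the primes.\<close>

lemma algebraic_int_if_finite_module:
  fixes x :: "'k::field_char_0" and v :: "'i \<Rightarrow> 'k"
  assumes "finite I" and nz: "\<exists>i\<in>I. v i \<noteq> 0"
    and mult: "\<And>i. i \<in> I \<Longrightarrow> \<exists>c. x * v i = (\<Sum>j\<in>I. of_int (c j) * v j)"
  shows "algebraic_int x"
proof -
  define n where "n = card I"
  obtain g where g: "bij_betw g {..<n} I"
    using ex_bij_betw_nat_finite[OF \<open>finite I\<close>] by (auto simp: n_def atLeast0LessThan)
  obtain a where a: "\<And>i. i \<in> I \<Longrightarrow> x * v i = (\<Sum>j\<in>I. of_int (a i j) * v j)"
    using mult by metis
  \<comment> \<open>Determinant trick: the values \<open>v\<close> form a nonzero eigenvector of the
    integer matrix \<open>A\<close> for the eigenvalue \<open>x\<close>, so \<open>x\<close> is a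
    root of a characteristic polynomial, which is monic over the integers.\<close>
  define A where "A = mat n n (\<lambda>(i, j). a (g i) (g j))"
  define w where "w = vec n (\<lambda>i. v (g i))"
  define B where "B = map_mat (of_int :: int \<Rightarrow> 'k) A"
  have A: "A \<in> carrier_mat n n" by (simp add: A_def)
  have B: "B \<in> carrier_mat n n" by (simp add: A_def B_def)
  have gI: "g i \<in> I" if "i < n" for i using g that by (auto simp: bij_betw_def)
  have "B *\<^sub>v w = x \<cdot>\<^sub>v w"
  proof (rule eq_vecI)
    fix i assume "i < dim_vec (x \<cdot>\<^sub>v w)"
    then have i: "i < n" by (simp add: w_def)
    have "(B *\<^sub>v w) $ i = (\<Sum>j\<in>{..<n}. of_int (a (g i) (g j)) * v (g j))"
      using i by (simp add: B_def A_def w_def scalar_prod_def atLeast0LessThan)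
    also have "\<dots> = (\<Sum>j\<in>I. of_int (a (g i) j) * v j)"
      by (rule sum.reindex_bij_betw[OF g])
    also have "\<dots> = (x \<cdot>\<^sub>v w) $ i"
      using i a[OF gI[OF i]] by (simp add: w_def)
    finally show "(B *\<^sub>v w) $ i = (x \<cdot>\<^sub>v w) $ i" .
  qed (simp add: B_def A_def w_def)
  moreover have "w \<noteq> 0\<^sub>v n"
  proof -
    obtain i where "i \<in> I" "v i \<noteq> 0" using nz by blast
    then obtain k where "k < n" "v (g k) \<noteq> 0" using g by (auto simp: bij_betw_def)
    then show ?thesis by (metis index_vec index_zero_vec(1) w_def)
  qed
  ultimately have "eigenvalue B x"
    using B unfolding eigenvalue_def eigenvector_def by (intro exI[of _ w]) (auto simp: w_def)
  then have "poly (char_poly B) x = 0"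
    using eigenvalue_root_char_poly[OF B] by blast
  then have "poly (map_poly of_int (char_poly A)) x = 0"
    by (simp add: B_def of_int_hom.char_poly_hom[OF A])
  moreover have "lead_coeff (char_poly A) = 1"
    using degree_monic_char_poly[OF A] by simp
  ultimately show ?thesis
    unfolding algebraic_int_altdef_ipoly by blast
qed

text \<open>The finite module is the integer span \<open>S\<close> of the monomials x^i y^j with
  exponents below the degrees of monic equations for \<open>x\<close> and \<open>y\<close>.
  Multiplication by \<open>x\<close> or \<open>y\<close> preserves \<open>S\<close>, because a
  monomial that leaves the range is rewritten by the monic equation.\<close>

lemma algebraic_int_add_mult:
  fixes x y :: "'k::field_char_0"
  assumes x: "algebraic_int x" and y: "algebraic_int y"
  shows "algebraic_int (x + y)" and "algebraic_int (x * y)"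
proof -
  obtain p where p: "poly (map_poly of_int p) x = 0" "lead_coeff p = 1"
    using x unfolding algebraic_int_altdef_ipoly by blast
  obtain q where q: "poly (map_poly of_int q) y = 0" "lead_coeff q = 1"
    using y unfolding algebraic_int_altdef_ipoly by blast
  define I where "I = {..<degree p} \<times> {..<degree q}"
  define v where "v = (\<lambda>(i::nat, j::nat). x ^ i * y ^ j)"
  define S where "S = range (\<lambda>c. \<Sum>t\<in>I. of_int (c t) * v t)"
  have fin: "finite I" by (simp add: I_def)
  have pos: "degree p > 0" "degree q > 0"
    using p q by (auto intro!: Nat.gr0I elim!: degree_eq_zeroE)
  have S0: "0 \<in> S" unfolding S_def by (rule range_eqI[of _ _ "\<lambda>_. 0"]) simp
  have Sadd: "a + b \<in> S" if ab: "a \<in> S" "b \<in> S" for a b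
  proof -
    obtain c where c: "a = (\<Sum>t\<in>I. of_int (c t) * v t)"
      using ab(1) unfolding S_def by (rule rangeE)
    obtain d where d: "b = (\<Sum>t\<in>I. of_int (d t) * v t)"
      using ab(2) unfolding S_def by (rule rangeE)
    from c d have "a + b = (\<Sum>t\<in>I. of_int (c t + d t) * v t)"
      by (simp add: sum.distrib algebra_simps)
    then show ?thesis unfolding S_def by (rule range_eqI[where x="\<lambda>t. c t + d t"])
  qed
  have Sscale: "of_int k * a \<in> S" if a: "a \<in> S" for a k
  proof -
    obtain c where "a = (\<Sum>t\<in>I. of_int (c t) * v t)"
      using a unfolding S_def by (rule rangeE)
    then have "of_int k * a = (\<Sum>t\<in>I. of_int (k * c t) * v t)"
      by (simp add: sum_distrib_left mult.assoc)
    then show ?thesis unfolding S_def by (rule range_eqI[where x="\<lambda>t. k * c t"])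
  qed
  have Ssum: "(\<Sum>t\<in>J. f t) \<in> S" if "\<And>t. t \<in> J \<Longrightarrow> f t \<in> S" for J :: "'j set" and f
    using that by (induction J rule: infinite_finite_induct) (auto intro: S0 Sadd)
  have Sgen: "v t \<in> S" if "t \<in> I" for t
  proof -
    have "v t = (\<Sum>u\<in>I. of_int (if u = t then 1 else 0) * v u)"
      using that fin by (simp add: if_distrib if_distribR cong: if_cong)
    then show ?thesis unfolding S_def by (rule range_eqI[where x="\<lambda>u. if u = t then 1 else 0"])
  qed
  have pow: "z ^ degree f = - (\<Sum>i<degree f. of_int (coeff f i) * z ^ i)"
    if "poly (map_poly of_int f) z = 0" "lead_coeff f = 1" for z :: 'k and f
  proof -
    have "0 = (\<Sum>i\<le>degree f. of_int (coeff f i) * z ^ i)"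
      using that(1) by (simp add: poly_altdef)
    also have "\<dots> = (\<Sum>i<degree f. of_int (coeff f i) * z ^ i) + z ^ degree f"
      using that(2) by (simp add: lessThan_Suc_atMost[symmetric])
    finally show ?thesis by (simp add: eq_neg_iff_add_eq_0 add.commute)
  qed
  have xgen: "x * v t \<in> S" if t: "t \<in> I" for t
  proof -
    obtain i j where ij0: "t = (i, j)" and ij: "i < degree p" "j < degree q"
      using t by (auto simp: I_def)
    show ?thesis
    proof (cases "Suc i < degree p")
      case True
      then show ?thesis using ij Sgen[of "(Suc i, j)"] by (simp add: ij0 v_def I_def mult.assoc)
    next
      case False
      then have i: "Suc i = degree p" using ij by simp
      have "x * v t = x ^ degree p * y ^ j"
        by (simp add: ij0 v_def i[symmetric])
      also have "\<dots> = (\<Sum>k<degree p. of_int (- coeff p k) * v (k, j))"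
        unfolding pow[OF p] by (simp add: v_def sum_distrib_left sum_negf mult_ac)
      also have "\<dots> \<in> S"
        by (intro Ssum Sscale Sgen) (use ij in \<open>auto simp: I_def\<close>)
      finally show ?thesis .
    qed
  qed
  have ygen: "y * v t \<in> S" if t: "t \<in> I" for t
  proof -
    obtain i j where ij0: "t = (i, j)" and ij: "i < degree p" "j < degree q"
      using t by (auto simp: I_def)
    show ?thesis
    proof (cases "Suc j < degree q")
      case True
      then show ?thesis using ij Sgen[of "(i, Suc j)"] by (simp add: ij0 v_def I_def mult_ac)
    next
      case False
      then have j: "Suc j = degree q" using ij by simp
      have "y * v t = x ^ i * y ^ degree q"
        by (simp add: ij0 v_def j[symmetric])
      also have "\<dots> = (\<Sum>k<degree q. of_int (- coeff q k) * v (i, k))"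
        unfolding pow[OF q] by (simp add: v_def sum_distrib_left sum_negf mult_ac)
      also have "\<dots> \<in> S"
        by (intro Ssum Sscale Sgen) (use ij in \<open>auto simp: I_def\<close>)
      finally show ?thesis .
    qed
  qed
  have xS: "x * a \<in> S" if a: "a \<in> S" for a
  proof -
    obtain c where "a = (\<Sum>t\<in>I. of_int (c t) * v t)"
      using a unfolding S_def by (rule rangeE)
    then have "x * a = (\<Sum>t\<in>I. of_int (c t) * (x * v t))"
      by (simp add: sum_distrib_left mult_ac)
    also have "\<dots> \<in> S" by (intro Ssum Sscale xgen)
    finally show ?thesis .
  qed
  have ex: "\<exists>i\<in>I. v i \<noteq> 0"
    using pos by (intro bexI[of _ "(0, 0)"]) (auto simp: v_def I_def)
  have conv: "\<exists>c. a = (\<Sum>t\<in>I. of_int (c t) * v t)" if "a \<in> S" for a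
    using that by (auto simp: S_def)
  show "algebraic_int (x + y)"
    by (rule algebraic_int_if_finite_module[OF fin ex], rule conv)
       (simp add: distrib_right Sadd xgen ygen)
  show "algebraic_int (x * y)"
    by (rule algebraic_int_if_finite_module[OF fin ex], rule conv)
       (simp add: mult.assoc xS ygen)
qed

lemma algebraic_int_diff:
  "algebraic_int x \<Longrightarrow> algebraic_int y \<Longrightarrow> algebraic_int (x - y :: 'k::field_char_0)"
  using algebraic_int_add_mult(1)[of x "- y"] by simp

lemma algebraic_int_sum:
  "(\<And>i. i \<in> I \<Longrightarrow> algebraic_int (f i :: 'k::field_char_0)) \<Longrightarrow> algebraic_int (sum f I)"
  by (induction I rule: infinite_finite_induct) (auto intro: algebraic_int_add_mult)

lemma algebraic_int_prod:
  "(\<And>i. i \<in> I \<Longrightarrow> algebraic_int (f i :: 'k::field_char_0)) \<Longrightarrow> algebraic_int (prod f I)"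
  by (induction I rule: infinite_finite_induct) (auto intro: algebraic_int_add_mult)

lemma algebraic_int_power:
  "algebraic_int x \<Longrightarrow> algebraic_int (x ^ n :: 'k::field_char_0)"
  by (induction n) (auto intro: algebraic_int_add_mult)

lemma algebraic_int_poly:
  "algebraic_int x \<Longrightarrow> algebraic_int (poly (map_poly of_int h) x :: 'k::field_char_0)"
  unfolding poly_altdef
  by (auto intro!: algebraic_int_sum algebraic_int_add_mult(2) algebraic_int_power)

section \<open>Conjugates and the minimal polynomial\<close>

abbreviation autos :: "('k::field_char_0 \<Rightarrow> 'k) set" where
  "autos \<equiv> ring_iso ring_of_type_algebra ring_of_type_algebra"

abbreviation ipoly :: "int poly \<Rightarrow> 'k::field_char_0 \<Rightarrow> 'k" where
  "ipoly h x \<equiv> poly (map_poly of_int h) x"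

abbreviation rpoly :: "rat poly \<Rightarrow> 'k::field_char_0 \<Rightarrow> 'k" where
  "rpoly h x \<equiv> poly (map_poly of_rat h) x"

lemma rpoly_ring:
  "rpoly (f + g) x = rpoly f x + rpoly g x"
  "rpoly (f * g) x = rpoly f x * rpoly g x"
  "rpoly (- f) x = - rpoly f x"
  "rpoly (\<Sum>i\<in>I. u i) x = (\<Sum>i\<in>I. rpoly (u i) x)"
proof -
  interpret map_poly_comm_ring_hom "of_rat :: rat \<Rightarrow> 'a" ..
  show "rpoly (f + g) x = rpoly f x + rpoly g x"
    "rpoly (f * g) x = rpoly f x * rpoly g x"
    "rpoly (- f) x = - rpoly f x"
    "rpoly (\<Sum>i\<in>I. u i) x = (\<Sum>i\<in>I. rpoly (u i) x)"
    by (simp_all add: hom_distribs poly_sum)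
qed

lemma autos_iff:
  "\<sigma> \<in> autos \<longleftrightarrow> bij \<sigma> \<and> \<sigma> 1 = 1 \<and> (\<forall>x y. \<sigma> (x + y) = \<sigma> x + \<sigma> y \<and> \<sigma> (x * y) = \<sigma> x * \<sigma> y)"
  unfolding ring_iso_def Ring.ring_hom_def ring_of_type_algebra_def by auto

lemma autos_field_hom: "\<sigma> \<in> autos \<Longrightarrow> field_hom \<sigma>"
proof unfold_locales
  assume \<sigma>: "\<sigma> \<in> autos"
  then show "\<sigma> (x + y) = \<sigma> x + \<sigma> y" "\<sigma> (x * y) = \<sigma> x * \<sigma> y" "\<sigma> 1 = 1" for x y
    by (auto simp: autos_iff)
  have "\<sigma> (0 + 0) = \<sigma> 0 + \<sigma> 0" using \<sigma> unfolding autos_iff by blast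
  then show "\<sigma> 0 = 0" by simp
qed

lemma autos_0: "\<sigma> \<in> autos \<Longrightarrow> \<sigma> 0 = 0"
  by (metis autos_iff add_cancel_left_right)

lemma autos_id: "id \<in> autos"
  by (simp add: autos_iff)

lemma autos_comp: "\<sigma> \<in> autos \<Longrightarrow> \<tau> \<in> autos \<Longrightarrow> \<sigma> \<circ> \<tau> \<in> autos"
  by (auto simp: autos_iff bij_comp)

lemma autos_inj: "\<sigma> \<in> autos \<Longrightarrow> inj \<sigma>"
  by (auto simp: autos_iff bij_def)

lemma autos_of_rat: "\<sigma> \<in> autos \<Longrightarrow> \<sigma> (of_rat q) = of_rat q"
proof -
  assume "\<sigma> \<in> autos"
  then interpret field_hom \<sigma> by (rule autos_field_hom)
  obtain a b where "q = Rat.Fract a b" "b > 0" by (cases q) auto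
  then have "of_rat q = (of_int a / of_int b :: 'a)" by (simp add: of_rat_rat)
  then show ?thesis by (simp add: hom_distribs)
qed

lemma autos_rpoly: "\<sigma> \<in> autos \<Longrightarrow> \<sigma> (rpoly g x) = rpoly g (\<sigma> x)"
proof -
  assume \<sigma>: "\<sigma> \<in> autos"
  then interpret field_hom \<sigma> by (rule autos_field_hom)
  show ?thesis by (simp add: poly_altdef hom_distribs autos_of_rat[OF \<sigma>])
qed

lemma ipoly_eq_rpoly: "ipoly h x = rpoly (map_poly of_int h) x"
  by (simp add: map_poly_map_poly o_def)

lemma autos_ipoly: "\<sigma> \<in> autos \<Longrightarrow> \<sigma> (ipoly h x) = ipoly h (\<sigma> x)"
  by (simp add: ipoly_eq_rpoly autos_rpoly)

lemma autos_algebraic_int: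
  assumes "\<sigma> \<in> autos" "algebraic_int x"
  shows "algebraic_int (\<sigma> x)"
proof -
  interpret field_hom \<sigma> using assms(1) by (rule autos_field_hom)
  obtain p where "ipoly p x = 0" "lead_coeff p = 1"
    using assms(2) unfolding algebraic_int_altdef_ipoly by blast
  then have "ipoly p (\<sigma> x) = 0"
    by (simp flip: autos_ipoly[OF assms(1)])
  then show ?thesis
    using \<open>lead_coeff p = 1\<close> unfolding algebraic_int_altdef_ipoly by blast
qed

lemma int_poly_lift:
  fixes q :: "'k::field_char_0 poly"
  assumes "\<And>i. coeff q i \<in> \<int>"
  obtains h where "map_poly of_int h = q"
proof
  \<comment> \<open>A general \<open>'k\<close> has no floor function, so an integer value is
    recovered through its unique rational preimage.\<close>
  define g where "g = (\<lambda>x::'k. \<lfloor>SOME r::rat. of_rat r = x\<rfloor>)"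
  have g: "of_int (g x) = x" if "x \<in> \<int>" for x
  proof -
    obtain k where k: "x = of_int k" using \<open>x \<in> \<int>\<close> by (auto elim: Ints_cases)
    have "(SOME r::rat. of_rat r = x) = of_int k"
      by (rule some_equality) (simp add: k, metis k of_rat_eq_iff of_rat_of_int_eq)
    then show ?thesis by (simp add: g_def k)
  qed
  have "g 0 = 0" using g[of 0] by simp
  then show "map_poly of_int (map_poly g q) = q"
    by (intro poly_eqI) (simp add: coeff_map_poly g assms)
qed

lemma coeff_prod_algebraic_int:
  fixes f :: "'i \<Rightarrow> 'k::field_char_0 poly"
  assumes "\<And>i n. i \<in> I \<Longrightarrow> algebraic_int (coeff (f i) n)"
  shows "algebraic_int (coeff (\<Prod>i\<in>I. f i) n)"
  using assms
proof (induction I arbitrary: n rule: infinite_finite_induct)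
  case (insert x F)
  then show ?case
    by (auto simp: coeff_mult intro!: algebraic_int_sum algebraic_int_add_mult(2))
qed (auto simp: coeff_1)

lemma coeff_linear_algebraic_int:
  "algebraic_int x \<Longrightarrow> algebraic_int (coeff [:- x, 1 :: 'k::field_char_0:] n)"
  by (auto simp: coeff_pCons split: nat.split)

lemma poly_dvd_if_roots:
  fixes q :: "'k::field poly"
  assumes "finite Z" "\<And>z. z \<in> Z \<Longrightarrow> poly q z = 0"
  shows "(\<Prod>z\<in>Z. [:- z, 1:]) dvd q"
  using assms
proof (induction Z arbitrary: q rule: finite_induct)
  case (insert x F)
  obtain u where u: "q = [:- x, 1:] * u"
    using insert.prems[of x] by (auto simp: poly_eq_0_iff_dvd)
  have "poly u z = 0" if "z \<in> F" for z
    using insert.prems[of z] insert.hyps that by (auto simp: u)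
  then have "(\<Prod>z\<in>F. [:- z, 1:]) dvd u" by (rule insert.IH)
  then show ?case using insert.hyps by (simp add: u mult_dvd_mono del: mult_pCons_left)
qed auto

section \<open>Conjugates of a generator of a Galois number field\<close>

locale galois_generator =
  fixes \<alpha> :: "'k::field_char_0"
  assumes alg: "algebraic_int \<alpha>"
    and gal: "galois_over_rat TYPE('k)"
    and gen: "rat_adjoin \<alpha> = UNIV"
begin

definition conjs :: "'k set" where
  "conjs = (\<lambda>\<sigma>. \<sigma> \<alpha>) ` autos"

text \<open>The minimal polynomial of \<alpha>, built from the conjugates so that its splitting over
  \<open>'k\<close> is built in. That the choice has a witness is \<open>m_eq\<close>; that it is
  the minimal polynomial is \<open>int_min_poly_eq\<close>.\<close>

definition m :: "int poly" where
  "m = (SOME f. map_poly of_int f = (\<Prod>\<beta>\<in>conjs. [:- \<beta>, 1:]))"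

lemma fixed_imp_rat: "(\<And>\<sigma>. \<sigma> \<in> autos \<Longrightarrow> \<sigma> x = x) \<Longrightarrow> x \<in> \<rat>" for x :: 'k
  using gal unfolding galois_over_rat_def by blast

lemma fixed_imp_int: "(\<And>\<sigma>. \<sigma> \<in> autos \<Longrightarrow> \<sigma> x = x) \<Longrightarrow> algebraic_int x \<Longrightarrow> x \<in> \<int>" for x :: 'k
  by (rule rational_algebraic_int_is_int[OF _ fixed_imp_rat])

lemma gen_in_conjs: "\<alpha> \<in> conjs"
  unfolding conjs_def using autos_id by (rule rev_image_eqI) simp

lemma conjs_alg: "\<beta> \<in> conjs \<Longrightarrow> algebraic_int \<beta>"
  unfolding conjs_def using autos_algebraic_int alg by auto

lemma finite_conjs: "finite conjs"
proof -
  obtain p where p: "ipoly p \<alpha> = 0" "lead_coeff p = 1"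
    using alg unfolding algebraic_int_altdef_ipoly by blast
  have "conjs \<subseteq> {x. ipoly p x = 0}"
    unfolding conjs_def using p(1) autos_ipoly[of _ p \<alpha>]
    by (auto simp: autos_0)
  moreover have "map_poly (of_int :: int \<Rightarrow> 'k) p \<noteq> 0"
    using p(2) by (metis leading_coeff_0_iff of_int_hom.hom_lead_coeff of_int_1 zero_neq_one)
  ultimately show ?thesis
    using poly_roots_finite finite_subset by blast
qed

lemma autos_conjs: "\<sigma> \<in> autos \<Longrightarrow> \<sigma> ` conjs = conjs"
proof -
  assume \<sigma>: "\<sigma> \<in> autos"
  have "\<sigma> ` conjs \<subseteq> conjs"
    unfolding conjs_def using autos_comp[OF \<sigma>] by (auto simp: image_iff) (metis comp_apply)
  then show ?thesis
    using finite_conjs autos_inj[OF \<sigma>] by (meson endo_inj_surj inj_on_subset subset_UNIV)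
qed

lemma autos_reindex:
  assumes "\<sigma> \<in> autos"
  shows "(\<Prod>\<beta>\<in>conjs. f (\<sigma> \<beta>)) = (\<Prod>\<beta>\<in>conjs. f \<beta>)"
    and "(\<Sum>\<beta>\<in>conjs. g (\<sigma> \<beta>)) = (\<Sum>\<beta>\<in>conjs. g \<beta>)"
proof -
  have "bij_betw \<sigma> conjs conjs"
    using autos_conjs[OF assms] inj_on_subset[OF autos_inj[OF assms] subset_UNIV]
    by (simp add: bij_betw_def)
  then show "(\<Prod>\<beta>\<in>conjs. f (\<sigma> \<beta>)) = (\<Prod>\<beta>\<in>conjs. f \<beta>)"
    and "(\<Sum>\<beta>\<in>conjs. g (\<sigma> \<beta>)) = (\<Sum>\<beta>\<in>conjs. g \<beta>)"
    by (rule prod.reindex_bij_betw, rule sum.reindex_bij_betw)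
qed

text \<open>Automorphisms permute the conjugates, so they fix the coefficients of the product. These
  are therefore rational, and being algebraic integers they are integers.\<close>

lemma m_eq: "map_poly of_int m = (\<Prod>\<beta>\<in>conjs. [:- \<beta>, 1:])"
proof -
  define q where "q = (\<Prod>\<beta>\<in>conjs. [:- \<beta>, 1:])"
  have "coeff q i \<in> \<int>" for i
  proof (rule fixed_imp_int)
    fix \<sigma> :: "'k \<Rightarrow> 'k" assume \<sigma>: "\<sigma> \<in> autos"
    interpret field_hom \<sigma> using \<sigma> by (rule autos_field_hom)
    interpret mp: map_poly_comm_ring_hom \<sigma> ..
    have "map_poly \<sigma> q = (\<Prod>\<beta>\<in>conjs. [:- \<sigma> \<beta>, 1:])"
      unfolding q_def by (simp add: hom_distribs)
    also have "\<dots> = q"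
      unfolding q_def by (rule autos_reindex(1)[OF \<sigma>, of "\<lambda>\<beta>. [:- \<beta>, 1:]"])
    finally have "coeff (map_poly \<sigma> q) i = coeff q i" by simp
    then show "\<sigma> (coeff q i) = coeff q i" by simp
  next
    show "algebraic_int (coeff q i)"
      unfolding q_def by (intro coeff_prod_algebraic_int coeff_linear_algebraic_int conjs_alg)
  qed
  then obtain f where "map_poly of_int f = q" by (rule int_poly_lift)
  then show ?thesis unfolding m_def q_def by (rule someI)
qed

lemma m_monic: "lead_coeff m = 1"
proof -
  have "of_int (lead_coeff m) = (lead_coeff (map_poly of_int m) :: 'k)" by simp
  also have "\<dots> = 1" unfolding m_eq by (simp add: lead_coeff_prod)
  finally show ?thesis by simp
qed

lemma degree_m: "degree m = card conjs"
proof -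
  have "degree m = degree (map_poly of_int m :: 'k poly)" by simp
  also have "\<dots> = card conjs" unfolding m_eq by (subst degree_prod_eq_sum_degree) auto
  finally show ?thesis .
qed

lemma degree_m_pos: "degree m > 0"
  using gen_in_conjs finite_conjs by (auto simp: degree_m card_gt_0_iff)

lemma m_root: "\<beta> \<in> conjs \<Longrightarrow> ipoly m \<beta> = 0"
  unfolding m_eq poly_prod using finite_conjs by (simp add: prod_zero_iff)

text \<open>Automorphisms carry the root \<alpha> of \<open>g\<close> to all conjugates, which are
  distinct linear factors over \<open>'k\<close>; divisibility then descends from \<open>'k\<close>
  to the rationals.\<close>

lemma m_dvd:
  assumes "rpoly g \<alpha> = 0"
  shows "map_poly of_int m dvd g"
proof -
  have "rpoly g \<beta> = 0" if "\<beta> \<in> conjs" for \<beta>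
  proof -
    obtain \<sigma> where \<sigma>: "\<sigma> \<in> autos" "\<beta> = \<sigma> \<alpha>" using \<open>\<beta> \<in> conjs\<close> by (auto simp: conjs_def)
    interpret field_hom \<sigma> using \<sigma>(1) by (rule autos_field_hom)
    show ?thesis using autos_rpoly[OF \<sigma>(1), of g \<alpha>] assms by (simp add: \<sigma>(2))
  qed
  then have "(map_poly of_int m :: 'k poly) dvd map_poly of_rat g"
    unfolding m_eq by (rule poly_dvd_if_roots[OF finite_conjs])
  then have "map_poly of_rat (map_poly of_int m) dvd (map_poly of_rat g :: 'k poly)"
    by (simp add: map_poly_map_poly o_def)
  then show ?thesis by (rule of_rat_hom.dvd_map_poly_hom_imp_dvd)
qed

text \<open>Since \<open>m\<close> is monic, pseudo-division is honest division over the integers;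
  the remainder vanishes at \<alpha> and has too small a degree.\<close>

lemma m_dvd_int:
  assumes "ipoly g \<alpha> = 0"
  shows "m dvd g"
proof -
  have lc: "m \<noteq> 0" using m_monic by auto
  obtain q r where qr: "pseudo_divmod g m = (q, r)" by force
  have e: "smult (lead_coeff m ^ (Suc (degree g) - degree m)) g = m * q + r" 
    and r: "r = 0 \<or> degree r < degree m"
    using pseudo_divmod[OF lc qr] by auto
  have e: "g = m * q + r" using e by (simp add: m_monic)
  have "ipoly r \<alpha> = 0"
    using assms m_root[OF gen_in_conjs] by (simp add: e hom_distribs)
  then have "map_poly of_int m dvd (map_poly of_int r :: rat poly)"
    by (intro m_dvd) (simp add: ipoly_eq_rpoly)
  then have "r = 0" using r by (auto dest!: dvd_imp_degree_le)
  then show ?thesis by (simp add: e)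
qed

lemma rat_min_poly_eq: "rat_min_poly \<alpha> = map_poly of_int m"
  unfolding rat_min_poly_def
proof (rule the_equality, intro conjI allI impI)
  show "rpoly (map_poly of_int m) \<alpha> = 0"
    using m_root[OF gen_in_conjs] by (simp add: ipoly_eq_rpoly)
  show "degree (map_poly of_int m :: rat poly) \<le> degree g"
    if "lead_coeff g = 1 \<and> rpoly g \<alpha> = 0" for g
    using that by (intro dvd_imp_degree_le m_dvd) auto
  fix f assume f: "lead_coeff f = 1 \<and> rpoly f \<alpha> = 0 \<and>
    (\<forall>g. lead_coeff g = 1 \<and> rpoly g \<alpha> = 0 \<longrightarrow> degree f \<le> degree g)"
  have dvd: "map_poly of_int m dvd f" using f by (intro m_dvd) auto
  have "degree f \<le> degree (map_poly of_int m :: rat poly)"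
    using f[THEN conjunct2, THEN conjunct2, rule_format, of "map_poly of_int m"]
      m_monic m_root[OF gen_in_conjs] by (simp add: ipoly_eq_rpoly)
  moreover obtain u where u: "f = map_poly of_int m * u" using dvd by blast
  moreover have "u \<noteq> 0" "m \<noteq> 0" using f u by auto
  ultimately have "degree u = 0" by (simp add: degree_mult_eq)
  then obtain a where "u = [:a:]" by (rule degree_eq_zeroE)
  moreover have "lead_coeff u = 1" using f u m_monic by (simp add: lead_coeff_mult)
  ultimately show "f = map_poly of_int m" by (simp add: u)
qed (simp add: m_monic)

lemma int_min_poly_eq: "int_min_poly \<alpha> = m"
  unfolding int_min_poly_def rat_min_poly_eq
  by (rule the_equality) (auto simp: of_int_hom.injectivity)

lemma rat_poly_small:
  assumes "rpoly g \<alpha> = 0" "degree g < degree m"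
  shows "g = 0"
  using m_dvd[OF assms(1)] assms(2) by (auto dest: dvd_imp_degree_le)

text \<open>Polynomial expressions in \<alpha> are visibly closed under the ring operations. For
  inverses, minimality of \<open>m\<close> makes its gcd with a polynomial not vanishing at \<alpha>
  a unit, and Bezout supplies the inverse. Reduction modulo \<open>m\<close> bounds the degree at
  the end.\<close>

lemma rpoly_representation:
  obtains g where "x = rpoly g \<alpha>" "degree g < degree m"
proof -
  let ?m = "map_poly of_int m :: rat poly"
  have m0: "?m \<noteq> 0" using m_monic by auto
  have root: "rpoly ?m \<alpha> = 0" using m_root[OF gen_in_conjs] by (simp add: ipoly_eq_rpoly)
  let ?V = "range (\<lambda>g. rpoly g \<alpha>)"
  have inv: "inverse y \<in> ?V" if y: "y \<in> ?V" for y
  proof (cases "y = 0")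
    case True
    then show ?thesis by (auto intro!: range_eqI[of _ _ 0])
  next
    case False
    obtain g where g: "y = rpoly g \<alpha>" using y by (rule rangeE)
    define D where "D = gcd g ?m"
    obtain E where E: "?m = D * E" unfolding D_def by (meson dvdE gcd_dvd2)
    have D0: "D \<noteq> 0" "E \<noteq> 0" using m0 E by auto
    have "rpoly D \<alpha> \<noteq> 0"
    proof
      assume "rpoly D \<alpha> = 0"
      then have "?m dvd g" using m_dvd[of D] by (auto simp: D_def)
      then show False using root False by (auto simp: g rpoly_ring elim!: dvdE)
    qed
    then have "rpoly E \<alpha> = 0" using root by (simp add: E rpoly_ring)
    then have "degree ?m \<le> degree E" using m_dvd D0 by (blast intro: dvd_imp_degree_le)
    then have "degree D = 0" using D0 by (simp add: E degree_mult_eq)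
    then have "is_unit D" using D0 is_unit_iff_degree by blast
    then have D1: "D = 1" using is_unit_normalize[of D] by (simp add: D_def)
    obtain a b where "a * g + b * ?m = 1"
      using bezout_coefficients_fst_snd[of g ?m] D1 by (auto simp: D_def)
    then have "rpoly (a * g + b * ?m) \<alpha> = 1" by simp
    then have "rpoly a \<alpha> * y = 1" using root by (simp add: g rpoly_ring)
    then have "inverse y = rpoly a \<alpha>" by (metis inverse_unique mult.commute)
    then show ?thesis by (rule range_eqI)
  qed
  have "y \<in> ?V" if "y \<in> generate_field ring_of_type_algebra (insert \<alpha> \<rat>)" for y
    using that
  proof induction
    case one
    show ?case by (auto simp: ring_of_type_algebra_def intro!: range_eqI[of _ _ 1])
  next
    case (incl h)
    then consider "h = \<alpha>" | q where "h = of_rat q" by (auto elim: Rats_cases)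
    then show ?case
    proof cases
      case 1
      show ?thesis by (rule range_eqI[of _ _ "[:0, 1:]"]) (simp add: 1 map_poly_pCons)
    next
      case 2
      show ?thesis by (rule range_eqI[of _ _ "[:q:]"]) (simp add: 2 poly_altdef)
    qed
  next
    case (a_inv h)
    interpret K: cring "ring_of_type_algebra :: 'k ring" by (rule cring_from_type_algebra)
    have "\<ominus>\<^bsub>ring_of_type_algebra\<^esub> h = - h"
      by (rule K.minus_equality) (auto simp: ring_of_type_algebra_def)
    moreover obtain g where "h = rpoly g \<alpha>" using a_inv.IH by (rule rangeE)
    ultimately show ?case by (intro range_eqI[of _ _ "- g"]) (simp add: rpoly_ring)
  next
    case (m_inv h)
    interpret K: cring "ring_of_type_algebra :: 'k ring" by (rule cring_from_type_algebra)
    have "inv\<^bsub>ring_of_type_algebra\<^esub> h = inverse h"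
      by (rule K.comm_inv_char)
         (use m_inv.hyps in \<open>auto simp: ring_of_type_algebra_def\<close>)
    then show ?case using inv m_inv.IH by simp
  next
    case (eng_add a b)
    obtain g where "a = rpoly g \<alpha>" using eng_add.IH(1) by (rule rangeE)
    moreover obtain g' where "b = rpoly g' \<alpha>" using eng_add.IH(2) by (rule rangeE)
    ultimately show ?case
      by (intro range_eqI[of _ _ "g + g'"]) (simp add: rpoly_ring ring_of_type_algebra_def)
  next
    case (eng_mult a b)
    obtain g where "a = rpoly g \<alpha>" using eng_mult.IH(1) by (rule rangeE)
    moreover obtain g' where "b = rpoly g' \<alpha>" using eng_mult.IH(2) by (rule rangeE)
    ultimately show ?case
      by (intro range_eqI[of _ _ "g * g'"]) (simp add: rpoly_ring ring_of_type_algebra_def)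
  qed
  then have "x \<in> ?V" using gen by (auto simp: rat_adjoin_def)
  then obtain g where g: "x = rpoly g \<alpha>" by (rule rangeE)
  have "rpoly g \<alpha> = rpoly (?m * (g div ?m) + g mod ?m) \<alpha>"
    by (simp only: mult_div_mod_eq)
  also have "\<dots> = rpoly (g mod ?m) \<alpha>"
    unfolding rpoly_ring root by simp
  finally have "x = rpoly (g mod ?m) \<alpha>"
    by (simp only: g)
  moreover have "degree (g mod ?m) < degree ?m"
    using degree_mod_less[OF m0, of g] degree_m_pos by auto
  ultimately show ?thesis by (intro that) auto
qed

lemma power_basis_independent:
  assumes "(\<Sum>i<degree m. of_rat (c i) * \<alpha> ^ i) = 0" "i < degree m"
  shows "c i = 0"
proof -
  define g where "g = (\<Sum>i<degree m. monom (c i) i)"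
  have co: "coeff g j = (if j < degree m then c j else 0)" for j
    by (simp add: g_def coeff_sum)
  have "degree g < degree m"
    using degree_m_pos by (intro le_less_trans[OF degree_le[of "degree m - 1"]]) (auto simp: co)
  moreover have "rpoly g \<alpha> = 0"
    using assms(1) by (simp add: g_def rpoly_ring poly_monom)
  ultimately have "g = 0" by (intro rat_poly_small)
  then show ?thesis using co[of i] assms(2) by simp
qed

lemma degree_m_eq: "degree m = rat_degree TYPE('k)"
proof -
  interpret Q: vector_space "\<lambda>(q::rat) (x::'k). of_rat q * x"
    by unfold_locales (auto simp: algebra_simps of_rat_add of_rat_mult)
  define B where "B = (\<lambda>i. \<alpha> ^ i) ` {..<degree m}"
  have inj: "inj_on (\<lambda>i. \<alpha> ^ i) {..<degree m}"
  proof (rule inj_onI, rule ccontr)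
    fix i j assume ij: "i \<in> {..<degree m}" "j \<in> {..<degree m}" "\<alpha> ^ i = \<alpha> ^ j" "i \<noteq> j"
    have "(\<Sum>k<degree m. of_rat (if k = i then 1 else if k = j then -1 else 0) * \<alpha> ^ k) = 
      (\<Sum>k<degree m. (if k = i then \<alpha> ^ k else 0) - (if k = j then \<alpha> ^ k else 0))"
      using \<open>i \<noteq> j\<close> by (intro sum.cong) auto
    also have "\<dots> = 0" using ij by (simp add: sum_subtractf)
    finally have "(if i = i then 1 else if i = j then -1 else 0) = (0::rat)"
      by (rule power_basis_independent) (use ij in auto)
    then show False by simp
  qed
  have "Q.independent B"
  proof (rule Q.independent_if_scalars_zero)
    fix f :: "'k \<Rightarrow> rat" and x
    assume 0: "(\<Sum>x\<in>B. of_rat (f x) * x) = 0" and "x \<in> B"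
    then obtain i where i: "x = \<alpha> ^ i" "i < degree m" by (auto simp: B_def)
    have "(\<Sum>i<degree m. of_rat (f (\<alpha> ^ i)) * \<alpha> ^ i) = 0"
      using 0 unfolding B_def by (subst (asm) sum.reindex[OF inj]) (simp add: o_def)
    from power_basis_independent[OF this i(2)] show "f x = 0" by (simp add: i)
  qed (simp add: B_def)
  moreover have "x \<in> Q.span B" for x
  proof -
    obtain g where g: "x = rpoly g \<alpha>" "degree g < degree m" by (rule rpoly_representation)
    have "x = (\<Sum>i\<le>degree g. of_rat (coeff g i) * \<alpha> ^ i)"
      by (simp add: g poly_altdef)
    also have "\<dots> \<in> Q.span B"
      using g(2) by (intro Q.span_sum Q.span_scale Q.span_base) (auto simp: B_def)
    finally show ?thesis .
  qed
  ultimately have "Q.dim UNIV = card B"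
    by (intro Q.dim_eq_card) auto
  then show ?thesis
    by (simp add: rat_degree_def B_def card_image[OF inj])
qed

text \<open>Lagrange interpolation of the conjugates of \<open>x\<close> at the conjugates of \<open>\<alpha>\<close>; the denominator
  is the product of all differences of conjugates of \<open>\<alpha>\<close>.\<close>

lemma common_denominator:
  obtains d :: int where "d \<noteq> 0"
    and "\<And>x. algebraic_int x \<Longrightarrow> \<exists>h. degree h < degree m \<and> of_int d * x = ipoly h \<alpha>"
    and "\<And>\<beta> \<gamma>. \<beta> \<in> conjs \<Longrightarrow> \<gamma> \<in> conjs \<Longrightarrow> \<beta> \<noteq> \<gamma> \<Longrightarrow>
      \<exists>y. algebraic_int y \<and> of_int d = (\<beta> - \<gamma>) * y"
proof -
  define E where "E = (\<lambda>\<beta>. \<Prod>\<gamma>\<in>conjs - {\<beta>}. \<beta> - \<gamma>)"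
  define D where "D = (\<Prod>\<beta>\<in>conjs. E \<beta>)"
  \<comment> \<open>The cofactor of \<open>E \<beta>\<close> in \<open>D\<close>: multiplied by
    \<open>D\<close>, the Lagrange basis polynomial at \<beta> becomes \<open>F \<beta>\<close>
    times \<open>N \<beta>\<close>, with integral coefficients and no division.\<close>
  define F where "F = (\<lambda>\<beta>. \<Prod>\<gamma>\<in>conjs - {\<beta>}. E \<gamma>)"
  define N where "N = (\<lambda>\<beta>. \<Prod>\<gamma>\<in>conjs - {\<beta>}. [:- \<gamma>, 1:])"
  have DF: "D = F \<beta> * E \<beta>" if "\<beta> \<in> conjs" for \<beta>
    unfolding D_def F_def using prod.remove[OF finite_conjs that, of E] by (simp add: mult.commute)
  have E0: "E \<beta> \<noteq> 0" for \<beta>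
    unfolding E_def using finite_conjs by (auto simp: prod_zero_iff)
  have Ealg: "algebraic_int (E \<beta>)" if "\<beta> \<in> conjs" for \<beta>
    unfolding E_def using that by (intro algebraic_int_prod algebraic_int_diff conjs_alg) auto
  have Falg: "algebraic_int (F \<beta>)" for \<beta>
    unfolding F_def by (intro algebraic_int_prod Ealg) auto
  have "D \<noteq> 0" unfolding D_def using finite_conjs E0 by (simp add: prod_zero_iff)
  \<comment> \<open>An automorphism permutes the factors \<open>E \<beta>\<close> and so fixes
    \<open>D\<close>.\<close>
  have "D \<in> \<int>"
  proof (rule fixed_imp_int)
    fix \<sigma> :: "'k \<Rightarrow> 'k" assume \<sigma>: "\<sigma> \<in> autos"
    interpret field_hom \<sigma> using \<sigma> by (rule autos_field_hom)
    have "\<sigma> (E \<beta>) = E (\<sigma> \<beta>)" if "\<beta> \<in> conjs" for \<beta>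
    proof -
      have "bij_betw \<sigma> (conjs - {\<beta>}) (conjs - {\<sigma> \<beta>})"
        using autos_conjs[OF \<sigma>] autos_inj[OF \<sigma>]
        by (auto simp: bij_betw_def inj_on_def inj_def image_set_diff)
      then show ?thesis
        unfolding E_def by (simp add: hom_distribs prod.reindex_bij_betw[of _ _ _ "\<lambda>\<gamma>. \<sigma> \<beta> - \<gamma>"])
    qed
    then show "\<sigma> D = D"
      unfolding D_def using autos_reindex(1)[OF \<sigma>, of E] by (simp add: hom_distribs)
  qed (auto simp: D_def intro: algebraic_int_prod Ealg)
  then obtain d where d: "D = of_int d" by (rule Ints_cases)
  show ?thesis
  proof (rule that[of d])
    show "d \<noteq> 0" using \<open>D \<noteq> 0\<close> d by auto
  next
    \<comment> \<open>That every difference of conjugates divides \<open>d\<close> later keeps their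
      images distinct modulo primes not dividing \<open>d\<close>.\<close>
    fix \<beta> \<gamma> assume bc: "\<beta> \<in> conjs" "\<gamma> \<in> conjs" "\<beta> \<noteq> \<gamma>"
    define y where "y = F \<beta> * (\<Prod>\<delta>\<in>conjs - {\<beta>} - {\<gamma>}. \<beta> - \<delta>)"
    have "E \<beta> = (\<beta> - \<gamma>) * (\<Prod>\<delta>\<in>conjs - {\<beta>} - {\<gamma>}. \<beta> - \<delta>)"
      unfolding E_def using bc finite_conjs by (intro prod.remove) auto
    then have "of_int d = (\<beta> - \<gamma>) * y"
      using DF[OF bc(1)] by (simp add: d y_def mult_ac)
    moreover have "algebraic_int y"
      unfolding y_def using bc
      by (intro algebraic_int_add_mult(2) Falg algebraic_int_prod algebraic_int_diff conjs_alg) auto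
    ultimately show "\<exists>y. algebraic_int y \<and> of_int d = (\<beta> - \<gamma>) * y" by blast
  next
    fix x :: 'k assume x: "algebraic_int x"
    obtain g where g: "x = rpoly g \<alpha>" "degree g < degree m" by (rule rpoly_representation)
    let ?g = "map_poly of_rat g :: 'k poly"
    define L where "L = (\<Sum>\<beta>\<in>conjs. smult (F \<beta> * poly ?g \<beta>) (N \<beta>))"
    have Nroot: "poly (N \<beta>) \<gamma> = (if \<beta> = \<gamma> then E \<beta> else 0)" if "\<gamma> \<in> conjs" for \<beta> \<gamma>
    proof (cases "\<beta> = \<gamma>")
      case True
      then show ?thesis by (simp add: N_def E_def poly_prod)
    next
      case False
      then have "(\<Prod>\<delta>\<in>conjs - {\<beta>}. \<gamma> - \<delta>) = 0"
        using that finite_conjs by (auto simp: prod_zero_iff)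
      then show ?thesis using False by (simp add: N_def poly_prod)
    qed
    have Lval: "poly L \<gamma> = poly (smult D ?g) \<gamma>" if "\<gamma> \<in> conjs" for \<gamma>
      using that finite_conjs DF[OF that] unfolding L_def
      by (simp add: poly_sum Nroot if_distrib sum.delta cong: if_cong)
    have Ndeg: "degree (N \<beta>) \<le> card conjs - 1" if "\<beta> \<in> conjs" for \<beta>
      unfolding N_def using that finite_conjs by (subst degree_prod_eq_sum_degree) auto
    have "degree L \<le> card conjs - 1"
      unfolding L_def by (intro degree_sum_le finite_conjs order.trans[OF degree_smult_le] Ndeg)
    moreover have "degree (smult D ?g) \<le> card conjs - 1"
      using g(2) by (auto simp: degree_m)
    ultimately have "degree (L - smult D ?g) \<le> card conjs - 1"
      by (rule degree_diff_le)
    then have deg: "degree (L - smult D ?g) < card conjs"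
      using degree_m_pos by (simp add: degree_m)
    \<comment> \<open>Both polynomials have degree below \<open>card conjs\<close> and agree at all
      conjugates.\<close>
    have "L - smult D ?g = 0"
    proof (rule ccontr)
      assume ne: "L - smult D ?g \<noteq> 0"
      have "card conjs \<le> card {z. poly (L - smult D ?g) z = 0}"
        using Lval by (intro card_mono poly_roots_finite ne) auto
      also have "\<dots> \<le> degree (L - smult D ?g)" by (rule card_poly_roots_bound[OF ne])
      finally show False using deg by simp
    qed
    then have L: "L = smult D ?g" by simp
    have conj_val: "algebraic_int (poly ?g \<beta>)" if b: "\<beta> \<in> conjs" for \<beta>
    proof -
      obtain \<sigma> where \<sigma>: "\<sigma> \<in> autos" "\<beta> = \<sigma> \<alpha>" using b by (auto simp: conjs_def)
      have "poly ?g \<beta> = \<sigma> x" using autos_rpoly[OF \<sigma>(1), of g \<alpha>] by (simp add: \<sigma>(2) g(1))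
      then show ?thesis using autos_algebraic_int[OF \<sigma>(1) x] by simp
    qed
    \<comment> \<open>Rational because \<open>L\<close> is \<open>D\<close> times a rational
      polynomial, integral because the values of \<open>g\<close> at the conjugates of \<alpha> are
      the conjugates of \<open>x\<close>.\<close>
    have "coeff L i \<in> \<int>" for i
    proof (rule rational_algebraic_int_is_int)
      show "coeff L i \<in> \<rat>" by (simp add: L d Rats_mult)
      show "algebraic_int (coeff L i)"
        unfolding L_def coeff_sum coeff_smult N_def
        by (intro algebraic_int_sum algebraic_int_add_mult(2) Falg conj_val
            coeff_prod_algebraic_int coeff_linear_algebraic_int conjs_alg) auto
    qed
    then obtain h where h: "map_poly of_int h = L" using int_poly_lift by blast
    have "degree h = degree L" by (simp flip: h)
    moreover have "degree L < degree m" using g(2) \<open>D \<noteq> 0\<close> by (simp add: L)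
    moreover have "of_int d * x = ipoly h \<alpha>" by (simp add: h L g(1) d)
    ultimately have "degree h < degree m \<and> of_int d * x = ipoly h \<alpha>" by simp
    then show "\<exists>h. degree h < degree m \<and> of_int d * x = ipoly h \<alpha>" by blast
  qed
qed

end

section \<open>Residue maps and totally split primes\<close>

lemma ring_of_integers_simps:
  "carrier \<O> = {x. algebraic_int x}" "x \<otimes>\<^bsub>\<O>\<^esub> y = x * y" "x \<oplus>\<^bsub>\<O>\<^esub> y = x + y"
  "\<one>\<^bsub>\<O>\<^esub> = 1" "\<zero>\<^bsub>\<O>\<^esub> = 0"
  by (simp_all add: ring_of_integers_def ring_of_type_algebra_def)

lemma cring_ring_of_integers: "cring (\<O> :: 'k::field_char_0 ring)"
proof (rule cringI)
  show "abelian_group (\<O> :: 'k ring)"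
    by (rule abelian_groupI)
       (auto simp: ring_of_integers_simps intro: algebraic_int_add_mult
         intro!: bexI[of _ "- x" for x])
  show "Group.comm_monoid (\<O> :: 'k ring)"
    by (rule comm_monoidI) (auto simp: ring_of_integers_simps intro: algebraic_int_add_mult)
qed (auto simp: ring_of_integers_simps algebra_simps)

interpretation OK: cring "\<O> :: 'k::field_char_0 ring"
  by (rule cring_ring_of_integers)

lemma a_inv_ring_of_integers: "algebraic_int x \<Longrightarrow> \<ominus>\<^bsub>\<O>\<^esub> x = - (x :: 'k::field_char_0)"
  by (rule OK.minus_equality) (auto simp: ring_of_integers_simps)

lemma ideal_memD:
  fixes I :: "'k::field_char_0 set"
  assumes "ideal I \<O>"
  shows "x \<in> I \<Longrightarrow> algebraic_int x" "0 \<in> I" 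
    "x \<in> I \<Longrightarrow> y \<in> I \<Longrightarrow> x + y \<in> I" "x \<in> I \<Longrightarrow> y \<in> I \<Longrightarrow> x - y \<in> I"
    "x \<in> I \<Longrightarrow> algebraic_int y \<Longrightarrow> x * y \<in> I" "x \<in> I \<Longrightarrow> algebraic_int y \<Longrightarrow> y * x \<in> I"
    "x \<in> I \<Longrightarrow> - x \<in> I"
proof -
  interpret ideal I \<O> by fact
  show alg: "algebraic_int x" if "x \<in> I" for x
    using Icarr[OF that] by (simp add: ring_of_integers_simps)
  show "0 \<in> I" using zero_closed by (simp add: ring_of_integers_simps)
  show add: "x + y \<in> I" if "x \<in> I" "y \<in> I" for x y
    using a_closed[OF that] by (simp add: ring_of_integers_simps)
  show neg: "- x \<in> I" if "x \<in> I" for x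
    using a_inv_closed[OF that] a_inv_ring_of_integers[OF alg[OF that]] by simp
  show "x - y \<in> I" if "x \<in> I" "y \<in> I" for x y
    using add[OF that(1) neg[OF that(2)]] by simp
  show "x * y \<in> I" "y * x \<in> I" if "x \<in> I" "algebraic_int y" for x y
    using I_r_closed[OF that(1), of y] I_l_closed[OF that(1), of y] that(2)
    by (simp_all add: ring_of_integers_simps)
qed

lemma primeideal_memD:
  fixes I :: "'k::field_char_0 set"
  assumes "primeideal I \<O>"
  shows "1 \<notin> I"
    "algebraic_int x \<Longrightarrow> algebraic_int y \<Longrightarrow> x * y \<in> I \<Longrightarrow> x \<in> I \<or> y \<in> I"
proof -
  interpret primeideal I \<O> by fact
  show "1 \<notin> I"
    using I_notcarr one_imp_carrier by (auto simp: ring_of_integers_simps)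
  show "algebraic_int x \<Longrightarrow> algebraic_int y \<Longrightarrow> x * y \<in> I \<Longrightarrow> x \<in> I \<or> y \<in> I"
    using I_prime[of x y] by (simp add: ring_of_integers_simps)
qed

text \<open>By Bezout, an integer prime to \<open>p\<close> inside \<open>I\<close> would put 1 into
  \<open>I\<close>.\<close>

lemma prime_ideal_of_int_iff:
  fixes I :: "'k::field_char_0 set"
  assumes I: "primeideal I \<O>" and p: "prime p" and "of_nat p \<in> I"
  shows "of_int n \<in> I \<longleftrightarrow> int p dvd n"
proof
  note ideal = ideal_memD[OF primeideal.axioms(1)[OF I]]
  assume n: "of_int n \<in> I"
  show "int p dvd n"
  proof (rule ccontr)
    assume "\<not> int p dvd n"
    then have "coprime (int p) n" using p by (simp add: prime_imp_coprime)
    then obtain u v where uv: "u * int p + v * n = 1"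
      using bezout_int[of "int p" n] by (auto simp: coprime_iff_gcd_eq_1)
    have "of_int (u * int p + v * n) = (1 :: 'k)"
      unfolding uv by simp
    then have "of_int u * of_nat p + of_int v * of_int n = (1 :: 'k)"
      by simp
    moreover have "of_int u * of_nat p + of_int v * of_int n \<in> I"
      by (intro ideal(3) ideal(6) n assms) auto
    ultimately show False using primeideal_memD(1)[OF I] by simp
  qed
next
  note ideal = ideal_memD[OF primeideal.axioms(1)[OF I]]
  assume "int p dvd n"
  then obtain k where "n = int p * k" by blast
  then show "of_int n \<in> I" using ideal(5)[OF assms(3), of "of_int k"] by simp
qed

text \<open>A ring homomorphism from \<O> to F_p, kept as a choice of integer representatives, so
  that later computations are plain integer congruences. Values outside \<O> are arbitrary; the law
  on integers yields both unitality and surjectivity.\<close>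

definition residue_map :: "nat \<Rightarrow> ('k::field_char_0 \<Rightarrow> int) \<Rightarrow> bool" where
  "residue_map p \<psi> \<longleftrightarrow>
     (\<forall>x y. algebraic_int x \<longrightarrow> algebraic_int y \<longrightarrow>
        [\<psi> (x + y) = \<psi> x + \<psi> y] (mod int p) \<and> [\<psi> (x * y) = \<psi> x * \<psi> y] (mod int p)) \<and>
     (\<forall>a. [\<psi> (of_int a) = a] (mod int p))"

definition residue_kernel :: "nat \<Rightarrow> ('k::field_char_0 \<Rightarrow> int) \<Rightarrow> 'k set" where
  "residue_kernel p \<psi> = {x. algebraic_int x \<and> int p dvd \<psi> x}"

lemma ZFact_ring_hom: "ZMod k \<in> Ring.ring_hom \<Z> (ZFact k)"
proof -
  interpret ideal "Idl\<^bsub>\<Z>\<^esub> {k}" \<Z>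
    by (rule int.genideal_ideal) simp
  show ?thesis
    using rcos_ring_hom unfolding ZFact_def by (simp add: ZMod_def[abs_def] fun_eq_iff)
qed

text \<open>Following \<psi> by reduction modulo \<open>p\<close> gives a ring homomorphism onto
  Z/p, so the isomorphism theorem applies; primality of the kernel is Euclid's lemma for
  \<open>p\<close>.\<close>

lemma residue_kernel:
  fixes \<psi> :: "'k::field_char_0 \<Rightarrow> int"
  assumes \<psi>: "residue_map p \<psi>" and p: "prime p"
  shows "primeideal (residue_kernel p \<psi>) \<O>"
    and "(\<O> Quot residue_kernel p \<psi>) \<simeq> ZFact (int p)"
proof -
  let ?h = "\<lambda>x. ZMod (int p) (\<psi> x)"
  note Z = ring_hom_memE[OF ZFact_ring_hom[of "int p"]]
  have cg: "ZMod (int p) a = ZMod (int p) b" if "[a = b] (mod int p)" for a b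
    using that by (simp add: ZMod_eq_mod cong_def)
  have "?h \<in> Ring.ring_hom \<O> (ZFact (int p))"
  proof (rule ring_hom_memI)
    show "?h x \<in> carrier (ZFact (int p))" for x using Z(1) by simp
    show "?h \<one>\<^bsub>\<O>\<^esub> = \<one>\<^bsub>ZFact (int p)\<^esub>"
    proof -
      have "[\<psi> (of_int 1) = 1] (mod int p)" using \<psi> unfolding residue_map_def by blast
      then show ?thesis using cg[of "\<psi> 1" 1] Z(4) by (simp add: ring_of_integers_simps)
    qed
    fix x y :: 'k assume xy: "x \<in> carrier \<O>" "y \<in> carrier \<O>"
    then have "[\<psi> (x * y) = \<psi> x * \<psi> y] (mod int p)" "[\<psi> (x + y) = \<psi> x + \<psi> y] (mod int p)"
      using \<psi> by (auto simp: residue_map_def ring_of_integers_simps)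
    from this[THEN cg] Z(2,3)[of "\<psi> x" "\<psi> y"]
    show "?h (x \<otimes>\<^bsub>\<O>\<^esub> y) = ?h x \<otimes>\<^bsub>ZFact (int p)\<^esub> ?h y"
      "?h (x \<oplus>\<^bsub>\<O>\<^esub> y) = ?h x \<oplus>\<^bsub>ZFact (int p)\<^esub> ?h y"
      by (simp_all add: ring_of_integers_simps)
  qed
  then interpret h: ring_hom_ring \<O> "ZFact (int p)" ?h
    by (intro ring_hom_ringI2 OK.ring_axioms cring.axioms(1)[OF ZFact_is_cring])
  have zero: "\<zero>\<^bsub>ZFact (int p)\<^esub> = ZMod (int p) 0"
    using ring_hom_zero[OF ZFact_ring_hom[of "int p"] int.ring_axioms cring.axioms(1)[OF ZFact_is_cring]]
    by (metis int_zero_eq)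
  have iff: "?h x = \<zero>\<^bsub>ZFact (int p)\<^esub> \<longleftrightarrow> int p dvd \<psi> x" for x
    unfolding zero ZMod_eq_mod by (metis dvd_eq_mod_eq_0 mod_0)
  have ker: "a_kernel \<O> (ZFact (int p)) ?h = residue_kernel p \<psi>"
    unfolding a_kernel_def' iff residue_kernel_def ring_of_integers_simps by blast
  have "\<exists>x\<in>carrier \<O>. C = ?h x" if C: "C \<in> carrier (ZFact (int p))" for C
  proof -
    obtain a where "C = ZMod (int p) a"
      using C by (auto simp: ZFact_def FactRing_def A_RCOSETS_def' ZMod_def)
    then have "C = ?h (of_int a)"
      using \<psi> cg[OF cong_sym, of "\<psi> (of_int a)" a] by (simp add: residue_map_def)
    then show ?thesis by (auto simp: ring_of_integers_simps)
  qed
  then have "?h ` carrier \<O> = carrier (ZFact (int p))"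
    using h.hom_closed by blast
  from h.FactRing_iso[OF this] show "(\<O> Quot residue_kernel p \<psi>) \<simeq> ZFact (int p)"
    by (simp add: ker)
  show "primeideal (residue_kernel p \<psi>) \<O>"
  proof (rule primeidealI)
    show "ideal (residue_kernel p \<psi>) \<O>" using h.kernel_is_ideal by (simp add: ker)
    show "cring (\<O> :: 'k ring)" by (rule cring_ring_of_integers)
    have "[\<psi> (of_int 1) = 1] (mod int p)" using \<psi> unfolding residue_map_def by blast
    then have "int p dvd \<psi> 1 \<longleftrightarrow> int p dvd 1" by (intro cong_dvd_iff) auto
    then have "\<not> int p dvd \<psi> 1"
      using prime_gt_1_nat[OF p] by simp
    then have "1 \<notin> residue_kernel p \<psi>" by (simp add: residue_kernel_def)
    then show "carrier \<O> \<noteq> residue_kernel p \<psi>"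
      by (auto simp: ring_of_integers_simps)
    fix x y assume xy: "x \<in> carrier \<O>" "y \<in> carrier \<O>" "x \<otimes>\<^bsub>\<O>\<^esub> y \<in> residue_kernel p \<psi>"
    then have "[\<psi> (x * y) = \<psi> x * \<psi> y] (mod int p)" "int p dvd \<psi> (x * y)"
      using \<psi> by (auto simp: residue_map_def residue_kernel_def ring_of_integers_simps)
    then have "int p dvd \<psi> x * \<psi> y" using cong_dvd_iff by blast
    then show "x \<in> residue_kernel p \<psi> \<or> y \<in> residue_kernel p \<psi>"
      using xy p by (auto simp: residue_kernel_def ring_of_integers_simps prime_dvd_mult_iff)
  qed
qed

text \<open>Lagrange's bound on the number of roots over F_p, for integer representatives. Synthetic
  division at one root lowers the degree, and incongruence lets the factor \<open>n' - n\<close> be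
  cancelled modulo \<open>p\<close>.\<close>

lemma small_degree_many_roots_mod:
  fixes h :: "int poly" and p :: nat
  assumes "prime p" "finite N" "degree h < card N"
    and "\<And>n. n \<in> N \<Longrightarrow> int p dvd poly h n"
    and "\<And>n n'. n \<in> N \<Longrightarrow> n' \<in> N \<Longrightarrow> int p dvd n - n' \<Longrightarrow> n = n'"
  shows "int p dvd coeff h i"
  using assms(2-)
proof (induction "card N" arbitrary: N h i)
  case (Suc k)
  then obtain n where n: "n \<in> N" by fastforce
  obtain q where q: "h = [:poly h n:] + [:- n, 1:] * q"
    by (metis synthetic_div_correct' add.commute)
  have k: "k = card (N - {n})" using Suc.hyps(2) n by (simp add: card_Diff_singleton)
  have root: "int p dvd poly q n'" if n': "n' \<in> N - {n}" for n'
  proof -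
    have "poly h n' = poly h n + (n' - n) * poly q n'"
      by (subst q) (simp add: algebra_simps)
    then have "int p dvd (n' - n) * poly q n'"
      using Suc.prems(3)[OF n] Suc.prems(3)[of n'] n' by (simp add: dvd_add_right_iff)
    moreover have "\<not> int p dvd n' - n" using Suc.prems(4)[of n' n] n n' by blast
    ultimately show ?thesis using \<open>prime p\<close> by (simp add: prime_dvd_mult_iff)
  qed
  have qdvd: "int p dvd coeff q j" for j
  proof (cases "q = 0")
    case False
    have "degree h = Suc (degree q)"
    proof -
      have "degree ([:- n, 1:] * q) = Suc (degree q)" 
        using False by (subst degree_mult_eq) auto
      then show ?thesis by (subst q, subst degree_add_eq_right) auto
    qed
    then have "degree q < card (N - {n})" using Suc.prems(2) k Suc.hyps(2) by simp
    then show ?thesis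
      by (intro Suc.hyps(1)[OF k]) (use Suc.prems(1,4) root in auto)
  qed auto
  have "coeff h i = coeff ([:poly h n:] + [:- n, 1:] * q) i"
    by (rule arg_cong[OF q, of "\<lambda>u. coeff u i"])
  also have "\<dots> = coeff [:poly h n:] i + (- n * coeff q i + coeff (pCons 0 q) i)"
    by simp
  also have "int p dvd \<dots>"
    using Suc.prems(3)[OF n] qdvd
    by (intro dvd_add dvd_mult qdvd) (auto simp: coeff_pCons split: nat.split)
  finally show ?case .
next
  case 0
  then show ?case by simp
qed

lemma residue_mapD:
  assumes "residue_map p \<psi>"
  shows "algebraic_int x \<Longrightarrow> algebraic_int y \<Longrightarrow> [\<psi> (x + y) = \<psi> x + \<psi> y] (mod int p)"
    and "algebraic_int x \<Longrightarrow> algebraic_int y \<Longrightarrow> [\<psi> (x * y) = \<psi> x * \<psi> y] (mod int p)"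
    and "[\<psi> (of_int a) = a] (mod int p)"
  using assms by (auto simp: residue_map_def)

lemma residue_map_diff:
  assumes "residue_map p \<psi>" "algebraic_int x" "algebraic_int y"
  shows "[\<psi> (x - y) = \<psi> x - \<psi> y] (mod int p)"
proof -
  have "[\<psi> (x - y + y) = \<psi> (x - y) + \<psi> y] (mod int p)"
    using assms by (intro residue_mapD algebraic_int_diff)
  then have "[\<psi> x - \<psi> y = \<psi> (x - y) + \<psi> y - \<psi> y] (mod int p)"
    by (intro cong_diff) auto
  then show ?thesis by (simp add: cong_sym)
qed

lemma residue_map_ipoly:
  assumes "residue_map p \<psi>" "algebraic_int x"
  shows "[\<psi> (ipoly h x) = poly h (\<psi> x)] (mod int p)"
proof (induction h)
  case 0
  show ?case using residue_mapD(3)[OF assms(1), of 0] by simp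
next
  case (pCons a h)
  have alg: "algebraic_int (ipoly h x)" by (rule algebraic_int_poly[OF assms(2)])
  have "[\<psi> (of_int a + x * ipoly h x) = \<psi> (of_int a) + \<psi> (x * ipoly h x)] (mod int p)"
    using alg assms by (intro residue_mapD algebraic_int_add_mult) auto
  also have "[\<psi> (of_int a) + \<psi> (x * ipoly h x) = a + \<psi> x * \<psi> (ipoly h x)] (mod int p)"
    using alg assms by (intro cong_add residue_mapD)
  also have "[a + \<psi> x * \<psi> (ipoly h x) = a + \<psi> x * poly h (\<psi> x)] (mod int p)"
    by (intro cong_add cong_mult cong_refl pCons.IH)
  finally show ?case by (simp add: of_int_hom.map_poly_pCons_hom)
qed

lemma residue_map_comp:
  assumes "residue_map p \<psi>" "\<sigma> \<in> autos"
  shows "residue_map p (\<psi> \<circ> \<sigma>)"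
proof -
  interpret field_hom \<sigma> using assms(2) by (rule autos_field_hom)
  show ?thesis
    using assms(1) autos_algebraic_int[OF assms(2)] by (simp add: residue_map_def hom_distribs)
qed

lemma comaximal_ideals:
  fixes I J :: "'k::field_char_0 set"
  assumes "ideal I \<O>" "ideal J \<O>" "a \<in> I" "b \<in> J" "a + b = 1"
  shows "I <+>\<^bsub>\<O>\<^esub> J = carrier \<O>"
proof -
  interpret S: ideal "I <+>\<^bsub>\<O>\<^esub> J" \<O> by (rule OK.add_ideals[OF assms(1,2)])
  have "\<one>\<^bsub>\<O>\<^esub> \<in> I <+>\<^bsub>\<O>\<^esub> J"
    using assms(3-) unfolding set_add_def' ring_of_integers_simps by blast
  then show ?thesis by (rule S.one_imp_carrier)
qed

context galois_generator
begin

text \<open>Invertibility of \<open>d\<close> modulo \<open>p\<close> is used twice: to extend the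
  evaluation of \<alpha> at \<open>n\<close> from Z[\<alpha>] to \<O>, and to pass from d x in p
  Z[\<alpha>] to x in p \<O>. The kernels obtained are pairwise comaximal, so their product is their
  intersection, and the latter is p \<O>.\<close>

lemma totally_split_criterion:
  obtains d :: int where "d \<noteq> 0"
    and "\<And>x. algebraic_int x \<Longrightarrow> \<exists>h. degree h < degree m \<and> of_int d * x = ipoly h \<alpha>"
    and "\<And>p n. prime p \<Longrightarrow> \<not> int p dvd d \<Longrightarrow> int p dvd poly m n \<Longrightarrow> totally_split TYPE('k) p"
proof -
  obtain d :: int where d: "d \<noteq> 0"
    "\<And>x. algebraic_int x \<Longrightarrow> \<exists>h. degree h < degree m \<and> of_int d * x = ipoly h \<alpha>"
    "\<And>\<beta> \<gamma>. \<beta> \<in> conjs \<Longrightarrow> \<gamma> \<in> conjs \<Longrightarrow> \<beta> \<noteq> \<gamma> \<Longrightarrow>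
      \<exists>y. algebraic_int y \<and> of_int d = (\<beta> - \<gamma>) * y"
    using common_denominator by metis
  have "totally_split TYPE('k) p" if p: "prime p" "\<not> int p dvd d" and n: "int p dvd poly m n" for p n
  proof -
    have prp: "prime (int p)" using p(1) by simp
    have cop: "coprime d (int p)"
      using prime_imp_coprime[OF prp p(2)] by (rule coprime_commute[THEN iffD1])
    obtain e where e: "[d * e = 1] (mod int p)"
      using cong_solve_coprime_int[OF cop] by blast
    define hx where "hx = (\<lambda>x. SOME h. of_int d * x = ipoly h \<alpha>)"
    have hx: "of_int d * x = ipoly (hx x) \<alpha>" if "algebraic_int x" for x
      unfolding hx_def using d(2)[OF that] by (intro someI_ex[of "\<lambda>h. of_int d * x = ipoly h \<alpha>"]) blast
    \<comment> \<open>Write d x as a polynomial in \<alpha>, evaluate it at \<open>n\<close>, and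
      divide by \<open>d\<close> modulo \<open>p\<close>, that is, multiply by
      \<open>e\<close>.\<close>
    define \<psi> where "\<psi> = (\<lambda>x. e * poly (hx x) n)"
    \<comment> \<open>The polynomial \<open>hx x\<close> is an arbitrary choice. Two choices differ
      by a multiple of \<open>m\<close>, whose value at \<open>n\<close> is divisible by
      \<open>p\<close>, so \<psi> is well defined modulo \<open>p\<close>.\<close>
    have key: "[poly u n = poly v n] (mod int p)" if "ipoly u \<alpha> = ipoly v \<alpha>" for u v
    proof -
      have "m dvd u - v" using that by (intro m_dvd_int) (simp add: hom_distribs)
      then obtain k where "u - v = m * k" by (rule dvdE)
      then have "poly u n - poly v n = poly m n * poly k n" by (metis poly_diff poly_mult)
      then have "poly m n dvd poly u n - poly v n" by simp
      then show ?thesis using n by (meson cong_iff_dvd_diff dvd_trans)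
    qed
    have e1: "[e * (d * a) = a] (mod int p)" for a
      using cong_mult[OF e cong_refl[of a]] by (simp add: mult_ac)
    have \<psi>: "residue_map p \<psi>"
      unfolding residue_map_def
    proof (intro conjI allI impI)
      fix x y :: 'k assume xy: "algebraic_int x" "algebraic_int y"
      have "ipoly (hx (x + y)) \<alpha> = ipoly (hx x + hx y) \<alpha>"
        using xy by (simp add: hx[symmetric] hom_distribs algebraic_int_add_mult distrib_left)
      from cong_mult[OF cong_refl[of e] key[OF this]]
      show "[\<psi> (x + y) = \<psi> x + \<psi> y] (mod int p)"
        by (simp add: \<psi>_def distrib_left)
      \<comment> \<open>Both sides equal d^2 x y: the product of two representatives carries
        \<open>d\<close> twice, hence the factor \<open>e * e\<close> below.\<close>
      have "ipoly (smult d (hx (x * y))) \<alpha> = ipoly (hx x * hx y) \<alpha>"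
        using xy by (simp add: hx[symmetric] hom_distribs algebraic_int_add_mult mult_ac)
      from cong_mult[OF cong_refl[of "e * e"] key[OF this]]
      have "[e * (d * (e * poly (hx (x * y)) n)) = \<psi> x * \<psi> y] (mod int p)"
        by (simp add: \<psi>_def mult_ac)
      then show "[\<psi> (x * y) = \<psi> x * \<psi> y] (mod int p)"
        using cong_trans[OF cong_sym[OF e1[of "\<psi> (x * y)"]]] by (simp add: \<psi>_def)
    next
      fix a
      have "ipoly (hx (of_int a)) \<alpha> = ipoly [:d * a:] \<alpha>"
        using hx[of "of_int a"] by (simp add: of_int_hom.map_poly_pCons_hom)
      from cong_mult[OF cong_refl[of e] key[OF this]]
      show "[\<psi> (of_int a) = a] (mod int p)"
        using cong_trans[OF _ e1[of a]] by (simp add: \<psi>_def)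
    qed
    define s where "s = (\<lambda>\<beta>. SOME \<sigma>. \<sigma> \<in> autos \<and> \<sigma> \<alpha> = \<beta>)"
    have s: "s \<beta> \<in> autos" "s \<beta> \<alpha> = \<beta>" if "\<beta> \<in> conjs" for \<beta>
    proof -
      have "\<exists>\<sigma>. \<sigma> \<in> autos \<and> \<sigma> \<alpha> = \<beta>" using that by (auto simp: conjs_def)
      from someI_ex[OF this] show "s \<beta> \<in> autos" "s \<beta> \<alpha> = \<beta>" by (simp_all add: s_def)
    qed
    define I where "I = (\<lambda>\<beta>. residue_kernel p (\<psi> \<circ> s \<beta>))"
    have res: "residue_map p (\<psi> \<circ> s \<beta>)" if "\<beta> \<in> conjs" for \<beta>
      using residue_map_comp[OF \<psi> s(1)[OF that]] .
    have I: "residue_kernel p (\<psi> \<circ> s \<beta>) = I \<beta>" for \<beta> by (simp add: I_def)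
    note kern = residue_kernel[OF res p(1), unfolded I]
    have ideal: "ideal (I \<beta>) \<O>" if "\<beta> \<in> conjs" for \<beta>
      using kern(1)[OF that] by (rule primeideal.axioms(1))
    have p_mem: "of_nat p \<in> I \<beta>" if "\<beta> \<in> conjs" for \<beta>
      using cong_dvd_iff[OF residue_mapD(3)[OF res[OF that], of "int p"]]
      by (simp add: I_def residue_kernel_def)
    \<comment> \<open>As \<open>s \<beta>\<close> sends \<alpha> to \<beta>, the generator \<alpha>
      is congruent to the integer \<open>\<psi> \<beta>\<close> modulo
      \<open>I \<beta>\<close>.\<close>
    have gen_mem: "\<alpha> - of_int (\<psi> \<beta>) \<in> I \<beta>" if "\<beta> \<in> conjs" for \<beta>
    proof -
      have "[(\<psi> \<circ> s \<beta>) (\<alpha> - of_int (\<psi> \<beta>)) = (\<psi> \<circ> s \<beta>) \<alpha> - (\<psi> \<circ> s \<beta>) (of_int (\<psi> \<beta>))] (mod int p)"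
        using alg by (intro residue_map_diff res that) auto
      also have "[(\<psi> \<circ> s \<beta>) \<alpha> - (\<psi> \<circ> s \<beta>) (of_int (\<psi> \<beta>)) = \<psi> \<beta> - \<psi> \<beta>] (mod int p)"
        using s(2)[OF that]
          cong_diff[OF cong_refl[of "\<psi> \<beta>"] residue_mapD(3)[OF res[OF that], of "\<psi> \<beta>"]]
        by simp
      finally show ?thesis
        using alg by (simp add: I_def residue_kernel_def cong_0_iff algebraic_int_diff)
    qed
    \<comment> \<open>A collision would force \<open>p\<close> to divide \<open>d\<close>, since
      \<open>d\<close> is a multiple of \<open>\<beta> - \<gamma>\<close> in \<O>.\<close>
    have distinct: "\<beta> = \<gamma>" if bc: "\<beta> \<in> conjs" "\<gamma> \<in> conjs" "int p dvd \<psi> \<beta> - \<psi> \<gamma>" for \<beta> \<gamma>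
    proof (rule ccontr)
      assume "\<beta> \<noteq> \<gamma>"
      then obtain y where y: "algebraic_int y" "of_int d = (\<beta> - \<gamma>) * y"
        using d(3) bc by blast
      have "[d = \<psi> ((\<beta> - \<gamma>) * y)] (mod int p)"
        using residue_mapD(3)[OF \<psi>, of d] y(2) by (simp add: cong_sym)
      also have "[\<psi> ((\<beta> - \<gamma>) * y) = \<psi> (\<beta> - \<gamma>) * \<psi> y] (mod int p)"
        using y(1) bc conjs_alg by (intro residue_mapD(2)[OF \<psi>] algebraic_int_diff) auto
      also have "[\<psi> (\<beta> - \<gamma>) * \<psi> y = (\<psi> \<beta> - \<psi> \<gamma>) * \<psi> y] (mod int p)"
        using bc conjs_alg by (intro cong_mult cong_refl residue_map_diff[OF \<psi>]) auto
      also have "[(\<psi> \<beta> - \<psi> \<gamma>) * \<psi> y = 0] (mod int p)"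
        using bc(3) by (simp add: cong_0_iff)
      finally show False using p(2) by (simp add: cong_0_iff)
    qed
    have comax: "I \<beta> <+>\<^bsub>\<O>\<^esub> I \<gamma> = carrier \<O>" if bc: "\<beta> \<in> conjs" "\<gamma> \<in> conjs" "\<beta> \<noteq> \<gamma>" for \<beta> \<gamma>
    proof -
      \<comment> \<open>The elements \<open>\<alpha> - \<psi> \<beta>\<close> and
        \<open>\<alpha> - \<psi> \<gamma>\<close> of the two ideals differ by an integer prime to
        \<open>p\<close>, and \<open>p\<close> lies in \<open>I \<gamma>\<close>, so Bezout writes 1
        as a sum.\<close>
      have "\<not> int p dvd \<psi> \<gamma> - \<psi> \<beta>" using distinct[of \<gamma> \<beta>] bc by blast
      then have "coprime (int p) (\<psi> \<gamma> - \<psi> \<beta>)" using prp by (simp add: prime_imp_coprime)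
      then obtain u v where uv: "u * int p + v * (\<psi> \<gamma> - \<psi> \<beta>) = 1"
        using bezout_int[of "int p" "\<psi> \<gamma> - \<psi> \<beta>"] by (auto simp: coprime_iff_gcd_eq_1)
      show ?thesis
      proof (rule comaximal_ideals[OF ideal[OF bc(1)] ideal[OF bc(2)]])
        show "of_int v * (\<alpha> - of_int (\<psi> \<beta>)) \<in> I \<beta>"
          by (intro ideal_memD(6) ideal gen_mem bc) auto
        show "of_int u * of_nat p - of_int v * (\<alpha> - of_int (\<psi> \<gamma>)) \<in> I \<gamma>"
          by (intro ideal_memD(4) ideal_memD(6) ideal gen_mem bc p_mem) auto
        have "of_int v * (\<alpha> - of_int (\<psi> \<beta>)) + (of_int u * of_nat p - of_int v * (\<alpha> - of_int (\<psi> \<gamma>)))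
          = of_int (u * int p + v * (\<psi> \<gamma> - \<psi> \<beta>))"
          by (simp add: algebra_simps)
        then show "of_int v * (\<alpha> - of_int (\<psi> \<beta>)) + (of_int u * of_nat p - of_int v * (\<alpha> - of_int (\<psi> \<gamma>))) = 1"
          by (simp only: uv of_int_1)
      qed
    qed
    have inj: "inj_on I conjs"
    proof (rule inj_onI, rule ccontr)
      fix \<beta> \<gamma> assume bc: "\<beta> \<in> conjs" "\<gamma> \<in> conjs" "I \<beta> = I \<gamma>" "\<beta> \<noteq> \<gamma>"
      interpret J: ideal "I \<beta>" \<O> by (rule ideal[OF bc(1)])
      have "\<one>\<^bsub>\<O>\<^esub> \<in> I \<beta> <+>\<^bsub>\<O>\<^esub> I \<beta>"
        using comax[OF bc(1,2,4)] bc(3) OK.one_closed by simp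
      then obtain a b where "a \<in> I \<beta>" "b \<in> I \<beta>" "\<one>\<^bsub>\<O>\<^esub> = a \<oplus>\<^bsub>\<O>\<^esub> b"
        unfolding set_add_def' by blast
      then have "1 \<in> I \<beta>" using J.a_closed by (metis ring_of_integers_simps(4))
      then show False using primeideal_memD(1)[OF kern(1)[OF bc(1)]] by blast
    qed
    obtain k where k: "card conjs = Suc k" using degree_m_pos gr0_implies_Suc unfolding degree_m by blast
    obtain b where b: "bij_betw b {..k} conjs"
      using ex_bij_betw_nat_finite[OF finite_conjs]
      by (auto simp: k atLeast0LessThan lessThan_Suc_atMost)
    have bI: "b i \<in> conjs" if "i \<le> k" for i using b that by (auto simp: bij_betw_def)
    have Inter: "(\<Inter>i\<in>{..k}. I (b i)) = Idl\<^bsub>\<O>\<^esub> {of_nat p}"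
    proof -
      have "Idl\<^bsub>\<O>\<^esub> {of_nat p} = {x * of_nat p |x :: 'k. algebraic_int x}"
        using OK.cgenideal_eq_genideal[of "of_nat p :: 'k", symmetric]
        by (simp add: ring_of_integers_simps cgenideal_def)
      also have "\<dots> = (\<Inter>i\<in>{..k}. I (b i))"
      proof (intro equalityI subsetI)
        fix x assume "x \<in> {x * of_nat p |x :: 'k. algebraic_int x}"
        then show "x \<in> (\<Inter>i\<in>{..k}. I (b i))"
          using ideal_memD(6)[OF ideal p_mem] bI by auto
      next
        fix x assume x: "x \<in> (\<Inter>i\<in>{..k}. I (b i))"
        moreover have "conjs = b ` {..k}" using b by (simp add: bij_betw_def)
        ultimately have xI: "x \<in> I \<beta>" if "\<beta> \<in> conjs" for \<beta>
          using that by auto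
        have alg_x: "algebraic_int x" using ideal_memD(1)[OF ideal xI] gen_in_conjs by blast
        obtain h where h: "degree h < degree m" "of_int d * x = ipoly h \<alpha>" using d(2)[OF alg_x] by blast
        have inj\<psi>: "inj_on \<psi> conjs" by (rule inj_onI, rule distinct) auto
        \<comment> \<open>Each \<open>\<psi> \<beta>\<close> is a root of \<open>h\<close> modulo
          \<open>p\<close>. These are \<open>card conjs\<close> incongruent roots, more than the
          degree of \<open>h\<close>.\<close>
        have "int p dvd coeff h i" for i
        proof (rule small_degree_many_roots_mod[OF p(1), of "\<psi> ` conjs"])
          show "degree h < card (\<psi> ` conjs)" using h(1) by (simp add: card_image inj\<psi> degree_m)
          fix n assume "n \<in> \<psi> ` conjs"
          then obtain \<beta> where \<beta>: "\<beta> \<in> conjs" "n = \<psi> \<beta>" by blast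
          have "ipoly h \<alpha> \<in> I \<beta>"
            unfolding h(2)[symmetric] by (intro ideal_memD(6) ideal xI \<beta>) auto
          moreover have "[(\<psi> \<circ> s \<beta>) (ipoly h \<alpha>) = poly h ((\<psi> \<circ> s \<beta>) \<alpha>)] (mod int p)"
            by (intro residue_map_ipoly res \<beta> alg)
          ultimately show "int p dvd poly h n"
            using s(2)[OF \<beta>(1)] by (simp add: I_def residue_kernel_def \<beta>(2) cong_dvd_iff)
          fix n' assume "n' \<in> \<psi> ` conjs" "int p dvd n - n'"
          then show "n = n'" using \<beta> distinct by blast
        qed (use finite_conjs in auto)
        then have "[:int p:] dvd h" by (simp add: const_poly_dvd_iff)
        then obtain h' where h': "h = [:int p:] * h'" by blast
        have dx: "of_int d * x = of_nat p * ipoly h' \<alpha>"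
          by (simp add: h(2) h' hom_distribs)
        \<comment> \<open>So far d x lies in p \<O>; Bezout for \<open>p\<close> and
          \<open>d\<close> removes the factor \<open>d\<close>.\<close>
        obtain u v where uv: "u * int p + v * d = 1"
          using bezout_int[of "int p" d] cop by (metis coprime_iff_gcd_eq_1 coprime_commute)
        have "x = of_int (u * int p + v * d) * x" by (simp only: uv) simp
        also have "\<dots> = (of_int u * x) * of_nat p + of_int v * (of_int d * x)"
          by (simp add: algebra_simps)
        also have "\<dots> = (of_int u * x + of_int v * ipoly h' \<alpha>) * of_nat p"
          unfolding dx by (simp add: algebra_simps)
        finally show "x \<in> {x * of_nat p |x :: 'k. algebraic_int x}"
          using alg_x alg by (auto intro!: exI algebraic_int_add_mult algebraic_int_poly)
      qed
      finally show ?thesis by simp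
    qed
    interpret Id: Group.comm_monoid "ideals_set (\<O> :: 'k ring)"
      by (rule OK.ideals_set_is_comm_monoid)
    have "finprod (ideals_set \<O>) (\<lambda>\<pp>. \<pp>) ((\<lambda>i. I (b i)) ` {..k})
        = finprod (ideals_set \<O>) (\<lambda>i. I (b i)) {..k}"
    proof (rule Id.finprod_reindex)
      show "inj_on (\<lambda>i. I (b i)) {..k}"
        using comp_inj_on[of b "{..k}" I] inj b by (simp add: bij_betw_def o_def)
      show "(\<lambda>\<pp>. \<pp>) \<in> (\<lambda>i. I (b i)) ` {..k} \<rightarrow> carrier (ideals_set \<O>)"
        using ideal bI by (auto simp: ideals_set_def)
    qed
    also have "\<dots> = (\<Inter>i\<in>{..k}. I (b i))"
    proof (rule OK.ideal_prod_eq_Inter)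
      show "I (b i) <+>\<^bsub>\<O>\<^esub> I (b j) = carrier \<O>" if "i \<in> {..k}" "j \<in> {..k}" "i \<noteq> j" for i j
        using that b bI by (intro comax) (auto simp: bij_betw_def inj_on_def)
    qed (use ideal bI in auto)
    also note Inter
    also have "(\<lambda>i. I (b i)) ` {..k} = I ` conjs"
      using b by (metis bij_betw_imp_surj_on image_image)
    finally have fp: "Idl\<^bsub>\<O>\<^esub> {of_nat p} = finprod (ideals_set \<O>) (\<lambda>\<pp>. \<pp>) (I ` conjs)" ..
    show ?thesis
      unfolding totally_split_def
    proof (intro exI[of _ "I ` conjs"] conjI ballI fp)
      show "card (I ` conjs) = rat_degree TYPE('k)"
        using card_image[OF inj] degree_m degree_m_eq by simp
    qed (use kern finite_conjs in auto)
  qed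
  with d(1,2) show ?thesis by (rule that)
qed

end

section \<open>Growth of the primes dividing values of a polynomial\<close>

text \<open>Dividing every exponent by \<open>E\<close> with remainder determines \<open>v\<close>
  from a pattern of remainders on \<open>T\<close> and the root of an E-th power; that root is at
  most \<open>Y\<close> because its E-th power divides \<open>v\<close>.\<close>

lemma card_smooth_numbers_le:
  fixes T :: "nat set"
  assumes T: "finite T" "\<And>q. q \<in> T \<Longrightarrow> prime q" and E: "E > 0"
  shows "finite {v. 0 < v \<and> v \<le> Y ^ E \<and> prime_factors v \<subseteq> T}" (is "finite ?S")
    and "card {v. 0 < v \<and> v \<le> Y ^ E \<and> prime_factors v \<subseteq> T} \<le> E ^ card T * Y"
proof -
  define f where "f = (\<lambda>v. (\<lambda>q\<in>T. multiplicity q v mod E, \<Prod>q\<in>T. q ^ (multiplicity q v div E)))"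
  have decomp: "v = (\<Prod>q\<in>T. q ^ fst (f v) q) * snd (f v) ^ E" if "v \<in> ?S" for v
  proof -
    have "v = (\<Prod>q\<in>prime_factors v. q ^ multiplicity q v)"
      using that by (intro prime_factorization_nat) auto
    also have "\<dots> = (\<Prod>q\<in>T. q ^ multiplicity q v)"
    proof (rule prod.mono_neutral_left)
      show "\<forall>q\<in>T - prime_factors v. q ^ multiplicity q v = 1"
        using that T(2) by (auto simp: prime_factors_multiplicity)
    qed (use that T in auto)
    also have "\<dots> = (\<Prod>q\<in>T. q ^ (multiplicity q v mod E) * (q ^ (multiplicity q v div E)) ^ E)"
      by (simp flip: power_mult power_add)
    also have "\<dots> = (\<Prod>q\<in>T. q ^ fst (f v) q) * snd (f v) ^ E"
      by (simp add: f_def prod.distrib prod_power_distrib)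
    finally show ?thesis .
  qed
  have inj: "inj_on f ?S"
  proof (rule inj_onI)
    fix v w assume vw: "v \<in> ?S" "w \<in> ?S" "f v = f w"
    have "v = (\<Prod>q\<in>T. q ^ fst (f v) q) * snd (f v) ^ E" by (rule decomp[OF vw(1)])
    also have "\<dots> = w" unfolding vw(3) by (rule decomp[OF vw(2), symmetric])
    finally show "v = w" .
  qed
  have sub: "f ` ?S \<subseteq> (T \<rightarrow>\<^sub>E {..<E}) \<times> {1..Y}"
  proof
    fix z assume "z \<in> f ` ?S"
    then obtain v where v: "v \<in> ?S" "z = f v" by blast
    have "snd (f v) ^ E dvd (\<Prod>q\<in>T. q ^ fst (f v) q) * snd (f v) ^ E" by simp
    then have "snd (f v) ^ E dvd v" by (simp only: decomp[OF v(1), symmetric])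
    then have "snd (f v) ^ E \<le> Y ^ E" using v(1) by (auto dest!: dvd_imp_le)
    then have "snd (f v) \<le> Y" using E by (simp add: power_mono_iff)
    moreover have "snd (f v) > 0"
      using T(2) by (auto simp: f_def prime_gt_0_nat intro!: prod_pos)
    ultimately show "z \<in> (T \<rightarrow>\<^sub>E {..<E}) \<times> {1..Y}"
      using E by (auto simp: v(2) f_def)
  qed
  have fin: "finite ((T \<rightarrow>\<^sub>E {..<E}) \<times> {1..Y})"
    using T(1) by (intro finite_cartesian_product finite_PiE) auto
  show "finite ?S" using inj sub fin by (meson inj_on_finite)
  have "card ?S \<le> card ((T \<rightarrow>\<^sub>E {..<E}) \<times> {1..Y})"
    by (rule card_inj_on_le[OF inj sub fin])
  also have "\<dots> = E ^ card T * Y"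
    using T(1) by (simp add: card_cartesian_product card_PiE)
  finally show "card ?S \<le> E ^ card T * Y" .
qed

lemma card_int_roots_le:
  fixes f :: "int poly"
  assumes "f \<noteq> 0"
  shows "card {n :: nat. poly f (int n) = 0} \<le> degree f"
    and "finite {n :: nat. poly f (int n) = 0}"
proof -
  have sub: "int ` {n :: nat. poly f (int n) = 0} \<subseteq> {x. poly f x = 0}" by auto
  have "finite (int ` {n :: nat. poly f (int n) = 0})"
    using finite_subset[OF sub poly_roots_finite[OF assms]] .
  then show "finite {n :: nat. poly f (int n) = 0}"
    by (rule finite_imageD) simp
  have "card {n :: nat. poly f (int n) = 0} = card (int ` {n :: nat. poly f (int n) = 0})"
    by (simp add: card_image)
  also have "\<dots> \<le> card {x. poly f x = 0}" by (intro card_mono poly_roots_finite assms sub)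
  also have "\<dots> \<le> degree f" by (rule card_poly_roots_bound[OF assms])
  finally show "card {n :: nat. poly f (int n) = 0} \<le> degree f" .
qed

text \<open>Consider the arguments n up to R^2. Their values are at most (A R)^E, so the roots of
  the E-th power parts number at most A R, about the square root of the range. With fewer than
  \<open>l\<close> primes of \<A> available, the remainder patterns contribute a power of
  \<open>E\<close> with exponent linear in \<open>l\<close>, and \<open>R = C * E ^ l\<close>
  outweighs it.\<close>

lemma many_primes_divide_values:
  fixes f :: "int poly" and \<A> Bad :: "nat set"
  assumes deg: "degree f > 0" and "finite Bad"
    and div: "\<And>p n. prime p \<Longrightarrow> int p dvd poly f n \<Longrightarrow> p \<in> \<A> \<union> Bad"
  obtains D :: nat where "D > 0" "\<And>l. l \<ge> 1 \<Longrightarrow> l \<le> card {p \<in> \<A>. p \<le> D ^ l}"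
proof -
  define \<delta> where "\<delta> = degree f"
  \<comment> \<open>Twice the degree, so that n \<le> R^2 gives values at most A R^E. The same
    number bounds the fibres of the absolute value of \<open>f\<close>.\<close>
  define E where "E = 2 * \<delta>"
  define A where "A = nat (\<Sum>i\<le>\<delta>. \<bar>coeff f i\<bar>)"
  define b where "b = card Bad"
  \<comment> \<open>With this \<open>C\<close>, the number R^2 exceeds the count of arguments with
    nonzero value by at least \<delta> + 1, more than the zeros of \<open>f\<close> can fill. The
    next constant \<open>D\<close> ensures (A R)^E \<le> D^l, so that all primes dividing the values
    lie in the range where \<A> is counted.\<close>
  define C where "C = E ^ b * A + \<delta> + 1"
  define D where "D = (A * C * E) ^ E"
  have f0: "f \<noteq> 0" using deg by auto
  have E0: "E > 0" "\<delta> > 0" using deg by (auto simp: E_def \<delta>_def)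
  have "\<bar>coeff f \<delta>\<bar> \<le> (\<Sum>i\<le>\<delta>. \<bar>coeff f i\<bar>)" by (rule member_le_sum) auto
  moreover have "coeff f \<delta> \<noteq> 0" using f0 by (simp add: \<delta>_def)
  ultimately have A0: "A > 0" by (simp add: A_def)
  have bound: "nat \<bar>poly f (int n)\<bar> \<le> A * n ^ \<delta>" if "n \<ge> 1" for n
  proof -
    have "\<bar>poly f (int n)\<bar> \<le> (\<Sum>i\<le>\<delta>. \<bar>coeff f i * int n ^ i\<bar>)"
      unfolding poly_altdef \<delta>_def by (rule sum_abs)
    also have "\<dots> \<le> (\<Sum>i\<le>\<delta>. \<bar>coeff f i\<bar> * int n ^ \<delta>)"
      using that by (intro sum_mono) (auto simp: abs_mult power_abs intro!: mult_left_mono power_increasing)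
    also have "\<dots> = int (A * n ^ \<delta>)"
      by (simp add: A_def sum_distrib_right[symmetric] sum_nonneg)
    finally have "\<bar>poly f (int n)\<bar> \<le> int (A * n ^ \<delta>)" by simp
    then show ?thesis by linarith
  qed
  have "l \<le> card {p \<in> \<A>. p \<le> D ^ l}" if l: "l \<ge> 1" for l
  proof (rule ccontr)
    assume "\<not> l \<le> card {p \<in> \<A>. p \<le> D ^ l}"
    then have a: "card {p \<in> \<A>. p \<le> D ^ l} \<le> l - 1" by simp
    define R where "R = C * E ^ l"
    define T where "T = {p \<in> \<A>. prime p \<and> p \<le> D ^ l} \<union> {p \<in> Bad. prime p}"
    define v where "v = (\<lambda>n. nat \<bar>poly f (int n)\<bar>)"
    define Ns where "Ns = {n \<in> {1..R ^ 2}. poly f (int n) \<noteq> 0}"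
    let ?S = "{v. 0 < v \<and> v \<le> (A * R) ^ E \<and> prime_factors v \<subseteq> T}"
    have finT: "finite T" using \<open>finite Bad\<close> by (simp add: T_def)
    have "card T \<le> card {p \<in> \<A>. prime p \<and> p \<le> D ^ l} + card {p \<in> Bad. prime p}"
      unfolding T_def by (rule card_Un_le)
    also have "\<dots> \<le> (l - 1) + b"
      unfolding b_def using \<open>finite Bad\<close>
      by (intro add_mono order.trans[OF _ a] card_mono) auto
    finally have cT: "card T \<le> (l - 1) + b" .
    have XD: "(A * R) ^ E \<le> D ^ l"
    proof -
      have "1 \<le> A * C" using A0 by (simp add: C_def)
      then have "A * C \<le> (A * C) ^ l" using l by (intro self_le_power) auto
      then have "A * R \<le> (A * C) ^ l * E ^ l"
        unfolding R_def mult.assoc[symmetric] by (rule mult_right_mono) simp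
      also have "\<dots> = (A * C * E) ^ l" by (simp add: power_mult_distrib)
      finally have "(A * R) ^ E \<le> ((A * C * E) ^ l) ^ E" by (rule power_mono) simp
      also have "\<dots> = D ^ l" by (simp add: D_def power_mult[symmetric] mult.commute)
      finally show ?thesis .
    qed
    have vS: "v ` Ns \<subseteq> ?S"
    proof
      fix w assume "w \<in> v ` Ns"
      then obtain n where n: "n \<in> Ns" "w = v n" by blast
      have "w \<le> A * n ^ \<delta>" using n bound by (auto simp: v_def Ns_def)
      also have "\<dots> \<le> A * (R ^ 2) ^ \<delta>"
        using n by (intro mult_left_mono power_mono) (auto simp: Ns_def)
      also have "\<dots> = A * R ^ E" by (simp add: E_def power_mult)
      also have "\<dots> \<le> A ^ E * R ^ E"
        using A0 E0 by (intro mult_right_mono self_le_power) auto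
      finally have w: "w \<le> (A * R) ^ E" by (simp add: power_mult_distrib)
      have w0: "w > 0" using n by (auto simp: v_def Ns_def)
      have "q \<in> T" if q: "q \<in> prime_factors w" for q
      proof -
        have pq: "prime q" "q dvd w" using q by auto
        have "int q dvd int w" using pq(2) by simp
        then have "int q dvd poly f (int n)" by (simp add: n(2) v_def)
        then have "q \<in> \<A> \<union> Bad" by (rule div[OF pq(1)])
        moreover have "q \<le> D ^ l" using dvd_imp_le[OF pq(2) w0] w XD by simp
        ultimately show ?thesis using pq(1) by (auto simp: T_def)
      qed
      then show "w \<in> ?S" using w w0 by blast
    qed
    have smooth: "finite ?S" "card ?S \<le> E ^ card T * (A * R)"
      using card_smooth_numbers_le[OF finT _ E0(1), of "A * R"] by (auto simp: T_def)
    \<comment> \<open>The value of \<open>f\<close> is \<open>w\<close> or \<open>-w\<close>, with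
      at most \<delta> solutions for each sign.\<close>
    have fibre: "card {n \<in> Ns. v n = w} \<le> E" for w
    proof -
      let ?f1 = "f - [:int w:]" and ?f2 = "f + [:int w:]"
      have d: "degree ?f1 = \<delta>" "degree ?f2 = \<delta>"
        using deg by (simp_all add: \<delta>_def degree_add_eq_left diff_conv_add_uminus del: add_uminus_conv_diff)
      then have ne: "?f1 \<noteq> 0" "?f2 \<noteq> 0" using E0 by auto
      have "{n \<in> Ns. v n = w} \<subseteq> {n. poly ?f1 (int n) = 0} \<union> {n. poly ?f2 (int n) = 0}"
        by (auto simp: v_def Ns_def)
      then have "card {n \<in> Ns. v n = w} \<le> card ({n. poly ?f1 (int n) = 0} \<union> {n. poly ?f2 (int n) = 0})"
        using card_int_roots_le(2)[OF ne(1)] card_int_roots_le(2)[OF ne(2)] by (intro card_mono) auto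
      also have "\<dots> \<le> \<delta> + \<delta>"
        using card_int_roots_le(1)[OF ne(1)] card_int_roots_le(1)[OF ne(2)] d
        by (intro order.trans[OF card_Un_le] add_mono) auto
      finally show ?thesis by (simp add: E_def)
    qed
    have finN: "finite Ns" by (simp add: Ns_def)
    have "card Ns = card (\<Union>w\<in>v ` Ns. {n \<in> Ns. v n = w})"
      by (rule arg_cong[of _ _ card]) auto
    also have "\<dots> \<le> (\<Sum>w\<in>v ` Ns. card {n \<in> Ns. v n = w})"
      using finN by (intro card_UN_le) auto
    also have "\<dots> \<le> (\<Sum>w\<in>v ` Ns. E)" by (intro sum_mono fibre)
    also have "\<dots> \<le> card ?S * E" using card_mono[OF smooth(1) vS] by simp
    also have "\<dots> \<le> E ^ card T * (A * R) * E" by (intro mult_right_mono smooth(2)) simp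
    \<comment> \<open>At most l - 1 primes come from \<A>; the remaining factor \<open>E\<close> is
      the fibre bound and completes the power to \<open>E ^ l\<close>.\<close>
    also have "\<dots> \<le> E ^ ((l - 1) + b) * (A * R) * E"
      using E0 cT by (intro mult_right_mono power_increasing) auto
    also have "\<dots> = E ^ b * A * E ^ l * R"
      using l by (cases l) (simp_all add: power_add mult_ac)
    finally have cN: "card Ns \<le> E ^ b * A * E ^ l * R" .
    have "{1..R ^ 2} \<subseteq> Ns \<union> {n. poly f (int n) = 0}" by (auto simp: Ns_def)
    then have "card {1..R ^ 2} \<le> card (Ns \<union> {n. poly f (int n) = 0})"
      using finN card_int_roots_le(2)[OF f0] by (intro card_mono) auto
    also have "\<dots> \<le> card Ns + \<delta>"
      using card_int_roots_le(1)[OF f0] by (intro order.trans[OF card_Un_le]) (simp add: \<delta>_def)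
    finally have "R ^ 2 \<le> E ^ b * A * E ^ l * R + \<delta>" using cN by simp
    moreover have "R ^ 2 = E ^ b * A * E ^ l * R + (\<delta> + 1) * (E ^ l * R)"
      by (simp add: power2_eq_square R_def C_def algebra_simps)
    moreover have "E ^ l * R \<ge> 1" using E0 by (simp add: R_def C_def Suc_le_eq)
    then have "(\<delta> + 1) * 1 \<le> (\<delta> + 1) * (E ^ l * R)" by (intro mult_left_mono) auto
    ultimately show False by simp
  qed
  moreover have "D > 0" using A0 E0 by (simp add: D_def C_def)
  ultimately show ?thesis using that by blast
qed

lemma enumerate_le_if_card_ge:
  fixes S :: "nat set"
  assumes "infinite S" "l \<ge> 1" "l \<le> card {p \<in> S. p \<le> n}"
  shows "enumerate S (l - 1) \<le> n"
proof (rule ccontr)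
  assume n: "\<not> enumerate S (l - 1) \<le> n"
  have "{p \<in> S. p \<le> n} \<subseteq> enumerate S ` {..<l - 1}"
  proof
    fix p assume p: "p \<in> {p \<in> S. p \<le> n}"
    then obtain j where j: "p = enumerate S j" using enumerate_Ex[OF assms(1)] by auto
    then have "enumerate S j < enumerate S (l - 1)" using p n by simp
    then have "j < l - 1" using enumerate_mono_iff[OF assms(1)] by blast
    then show "p \<in> enumerate S ` {..<l - 1}" using j by blast
  qed
  then have "card {p \<in> S. p \<le> n} \<le> card (enumerate S ` {..<l - 1})" by (intro card_mono) auto
  also have "\<dots> \<le> l - 1" using card_image_le[of "{..<l - 1}" "enumerate S"] by simp
  finally show False using assms by simp
qed

section \<open>The index bound\<close>

context galois_generator
begin

text \<open>Hence the discriminant condition excludes only finitely many primes. If \<open>m\<close>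
  had a nonconstant common factor \<open>G\<close> with its derivative, \<alpha> would be a root of
  \<open>G\<close> or of its cofactor; minimality of \<open>m\<close> contradicts either case by
  degree.\<close>

lemma discriminant_nonzero: "poly_discriminant m \<noteq> 0"
proof -
  have m0: "m \<noteq> 0" using m_monic by auto
  have "resultant m (pderiv m) \<noteq> 0"
  proof
    assume "resultant m (pderiv m) = 0"
    then have deg: "degree (gcd m (pderiv m)) \<noteq> 0" by (simp add: resultant_0_gcd)
    define G where "G = gcd m (pderiv m)"
    obtain E where E: "m = G * E" unfolding G_def by (meson dvdE gcd_dvd1)
    have ne: "G \<noteq> 0" "E \<noteq> 0" using m0 E by auto
    have "ipoly G \<alpha> * ipoly E \<alpha> = 0"
      using m_root[OF gen_in_conjs] by (subst (asm) E) (simp add: hom_distribs)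
    then consider "ipoly G \<alpha> = 0" | "ipoly E \<alpha> = 0" by auto
    then show False
    proof cases
      case 1
      then have "m dvd pderiv m" using m_dvd_int[of G] by (auto simp: G_def)
      moreover have "pderiv m \<noteq> 0" using degree_m_pos by (simp add: pderiv_eq_0_iff)
      ultimately have "degree m \<le> degree (pderiv m)" by (rule dvd_imp_degree_le)
      then show False using degree_m_pos by (simp add: degree_pderiv)
    next
      case 2
      then have "degree m \<le> degree E" using m_dvd_int ne by (blast intro: dvd_imp_degree_le)
      moreover have "degree m = degree G + degree E" by (subst E) (simp add: degree_mult_eq ne)
      ultimately show False using deg by (simp add: G_def)
    qed
  qed
  then show ?thesis by (simp add: poly_discriminant_def m_monic)
qed

text \<open>Outside the divisors of \<open>d\<close> times the discriminant, every prime dividing a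
  value of \<open>m\<close> is admissible, so the counting bound applies; it also gives infinitude.
  The exponent is \<open>Suc l\<close> because \<open>enumerate\<close> starts at 0.\<close>

lemma admissible_primes_growth:
  obtains d :: int and D :: nat where "d \<noteq> 0"
    and "\<And>x. algebraic_int x \<Longrightarrow> \<exists>h. degree h < degree m \<and> of_int d * x = ipoly h \<alpha>"
    and "infinite (admissible_primes \<alpha>)"
    and "D > 0" "\<And>l. enumerate (admissible_primes \<alpha>) l \<le> D ^ Suc l"
proof -
  obtain d :: int where d: "d \<noteq> 0"
    "\<And>x. algebraic_int x \<Longrightarrow> \<exists>h. degree h < degree m \<and> of_int d * x = ipoly h \<alpha>"
    "\<And>p n. prime p \<Longrightarrow> \<not> int p dvd d \<Longrightarrow> int p dvd poly m n \<Longrightarrow> totally_split TYPE('k) p"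
    using totally_split_criterion by blast
  define b where "b = nat \<bar>d * poly_discriminant m\<bar>"
  have b0: "b > 0" using d(1) discriminant_nonzero by (simp add: b_def)
  have bdvd: "p dvd b" if "int p dvd d \<or> int p dvd poly_discriminant m" for p
  proof -
    have "int p dvd d * poly_discriminant m" using that by auto
    then show ?thesis by (simp add: b_def dvd_nat_abs_iff)
  qed
  obtain D where D: "D > 0" "\<And>l. l \<ge> 1 \<Longrightarrow> l \<le> card {p \<in> admissible_primes \<alpha>. p \<le> D ^ l}"
  proof (rule many_primes_divide_values[OF degree_m_pos, of "{p. p dvd b}" "admissible_primes \<alpha>"])
    show "finite {p. p dvd b}" using b0 by simp
    fix p n assume "prime p" "int p dvd poly m n"
    then show "p \<in> admissible_primes \<alpha> \<union> {p. p dvd b}"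
      using d(3)[of p n] bdvd[of p] by (auto simp: admissible_primes_def int_min_poly_eq)
  qed blast
  have inf: "infinite (admissible_primes \<alpha>)"
  proof
    assume fin: "finite (admissible_primes \<alpha>)"
    let ?l = "Suc (card (admissible_primes \<alpha>))"
    have "?l \<le> card {p \<in> admissible_primes \<alpha>. p \<le> D ^ ?l}" by (rule D(2)) simp
    also have "\<dots> \<le> card (admissible_primes \<alpha>)" by (intro card_mono fin) auto
    finally show False by simp
  qed
  have "enumerate (admissible_primes \<alpha>) l \<le> D ^ Suc l" for l
    using enumerate_le_if_card_ge[OF inf, of "Suc l"] D(2)[of "Suc l"] by simp
  with d(1,2) inf D(1) show ?thesis by (rule that)
qed

section \<open>Integer coordinates in the power basis and box counting\<close>

definition val :: "(nat \<Rightarrow> int) \<Rightarrow> 'k" where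
  "val c = (\<Sum>i<degree m. of_int (c i) * \<alpha> ^ i)"

lemma val_inj:
  assumes "val c = val c'" "i < degree m"
  shows "c i = c' i"
proof -
  have "(\<Sum>i<degree m. of_rat (of_int (c i - c' i)) * \<alpha> ^ i) = val c - val c'"
    by (simp add: val_def sum_subtractf left_diff_distrib of_rat_diff)
  then have "rat_of_int (c i - c' i) = 0"
    using assms by (intro power_basis_independent[of "\<lambda>i. of_int (c i - c' i)"]) auto
  then show ?thesis by simp
qed

lemma val_add: "val (\<lambda>i. a i + b i) = val a + val b"
  by (simp add: val_def sum.distrib distrib_right)

lemma val_diff: "val (\<lambda>i. a i - b i) = val a - val b"
  by (simp add: val_def sum_subtractf left_diff_distrib)

lemma val_alg: "algebraic_int (val c)"
  unfolding val_def by (intro algebraic_int_sum algebraic_int_add_mult(2) algebraic_int_power alg) auto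

lemma ipoly_eq_val: "degree h < degree m \<Longrightarrow> ipoly h \<alpha> = val (coeff h)"
  unfolding val_def poly_altdef
  by (rule sum.mono_neutral_cong_left) (auto simp: coeff_eq_0)

lemma ipoly_reduce: "\<exists>c. ipoly g \<alpha> = val c"
proof -
  have lc: "m \<noteq> 0" using m_monic by auto
  obtain q r where qr: "pseudo_divmod g m = (q, r)" by force
  have e: "smult (lead_coeff m ^ (Suc (degree g) - degree m)) g = m * q + r" 
    and r: "r = 0 \<or> degree r < degree m"
    using pseudo_divmod[OF lc qr] by auto
  have e: "g = m * q + r" using e by (simp add: m_monic)
  have "ipoly g \<alpha> = ipoly r \<alpha>"
    using m_root[OF gen_in_conjs] by (simp add: e hom_distribs)
  also have "\<dots> = val (coeff r)" using r degree_m_pos by (intro ipoly_eq_val) auto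
  finally show ?thesis by blast
qed

lemma val_mult_bound:
  obtains K :: nat where "K > 0"
    and "\<And>c z B H. (\<And>i. i < degree m \<Longrightarrow> \<bar>c i\<bar> \<le> int B) \<Longrightarrow> (\<And>i. i < degree m \<Longrightarrow> \<bar>z i\<bar> \<le> int H) \<Longrightarrow>
      \<exists>w. (\<forall>i<degree m. \<bar>w i\<bar> \<le> int (K * B * H)) \<and> val c * val z = val w"
proof -
  define \<delta> where "\<delta> = degree m"
  have "\<exists>c. \<alpha> ^ n = val c" for n
    using ipoly_reduce[of "monom 1 n"] by (simp add: poly_monom)
  then obtain t where t: "\<alpha> ^ n = val (t n)" for n by metis
  \<comment> \<open>The coordinates of a product are bilinear in those of the factors.
    \<open>K\<close> dominates all structure constants \<open>t (i + j) k\<close>, and the added 1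
    keeps it positive.\<close>
  define K where "K = nat (\<Sum>i<\<delta>. \<Sum>j<\<delta>. \<Sum>k<\<delta>. \<bar>t (i + j) k\<bar>) + 1"
  show ?thesis
  proof (rule that[of K])
    show "K > 0" by (simp add: K_def)
    fix c z :: "nat \<Rightarrow> int" and B H :: nat
    assume c: "\<And>i. i < degree m \<Longrightarrow> \<bar>c i\<bar> \<le> int B" and z: "\<And>i. i < degree m \<Longrightarrow> \<bar>z i\<bar> \<le> int H"
    define w where "w = (\<lambda>k. \<Sum>i<\<delta>. \<Sum>j<\<delta>. c i * z j * t (i + j) k)"
    have "val c * val z = (\<Sum>i<\<delta>. \<Sum>j<\<delta>. of_int (c i) * of_int (z j) * \<alpha> ^ (i + j))"
      by (simp add: val_def \<delta>_def sum_product power_add mult_ac)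
    also have "\<dots> = (\<Sum>i<\<delta>. \<Sum>j<\<delta>. \<Sum>k<\<delta>. of_int (c i * z j * t (i + j) k) * \<alpha> ^ k)"
      by (intro sum.cong refl) (subst t, simp add: val_def \<delta>_def sum_distrib_left mult_ac)
    also have "\<dots> = (\<Sum>i<\<delta>. \<Sum>k<\<delta>. \<Sum>j<\<delta>. of_int (c i * z j * t (i + j) k) * \<alpha> ^ k)"
      by (intro sum.cong refl sum.swap)
    also have "\<dots> = (\<Sum>k<\<delta>. \<Sum>i<\<delta>. \<Sum>j<\<delta>. of_int (c i * z j * t (i + j) k) * \<alpha> ^ k)"
      by (rule sum.swap)
    also have "\<dots> = val w"
      by (simp add: val_def w_def \<delta>_def sum_distrib_right)
    finally have "val c * val z = val w" .
    moreover have "\<bar>w k\<bar> \<le> int (K * B * H)" if k: "k < degree m" for k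
    proof -
      have "\<bar>w k\<bar> \<le> (\<Sum>i<\<delta>. \<Sum>j<\<delta>. \<bar>c i * z j * t (i + j) k\<bar>)"
        unfolding w_def by (intro order.trans[OF sum_abs] sum_mono order.refl)
      also have "\<dots> \<le> (\<Sum>i<\<delta>. \<Sum>j<\<delta>. (int B * int H) * (\<Sum>k<\<delta>. \<bar>t (i + j) k\<bar>))"
      proof (intro sum_mono)
        fix i j assume ij: "i \<in> {..<\<delta>}" "j \<in> {..<\<delta>}"
        have "\<bar>c i * z j * t (i + j) k\<bar> = (\<bar>c i\<bar> * \<bar>z j\<bar>) * \<bar>t (i + j) k\<bar>" by (simp add: abs_mult)
        also have "\<dots> \<le> (int B * int H) * (\<Sum>k<\<delta>. \<bar>t (i + j) k\<bar>)"
          using ij k by (intro mult_mono c z member_le_sum) (auto simp: \<delta>_def intro: sum_nonneg)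
        finally show "\<bar>c i * z j * t (i + j) k\<bar> \<le> (int B * int H) * (\<Sum>k<\<delta>. \<bar>t (i + j) k\<bar>)" .
      qed
      also have "\<dots> = (int B * int H) * (\<Sum>i<\<delta>. \<Sum>j<\<delta>. \<Sum>k<\<delta>. \<bar>t (i + j) k\<bar>)"
        by (simp add: sum_distrib_left)
      also have "\<dots> \<le> (int B * int H) * int K"
        by (intro mult_left_mono) (auto simp: K_def)
      finally show ?thesis by (simp add: mult_ac)
    qed
    ultimately show "\<exists>w. (\<forall>i<degree m. \<bar>w i\<bar> \<le> int (K * B * H)) \<and> val c * val z = val w" by blast
  qed
qed

text \<open>The index of \<open>x \<int>[\<alpha>]\<close> in \<open>\<int>[\<alpha>]\<close> is bounded by counting: the translates of
  \<open>x \<cdot> box\<close> by incongruent representatives are disjoint and lie in a common larger box.\<close>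

lemma card_incongruent_le:
  obtains K :: nat where "K > 0"
    and "\<And>c B (W :: 'w set) y. (\<And>i. i < degree m \<Longrightarrow> \<bar>c i\<bar> \<le> int B) \<Longrightarrow> val c \<noteq> 0 \<Longrightarrow> finite W \<Longrightarrow>
      (\<And>w w' z. w \<in> W \<Longrightarrow> w' \<in> W \<Longrightarrow> val (y w) - val (y w') = val c * val z \<Longrightarrow> w = w') \<Longrightarrow>
      card W \<le> (2 * K * B + 1) ^ degree m"
proof -
  define \<delta> where "\<delta> = degree m"
  obtain K where K: "K > 0"
    "\<And>c z B H. (\<And>i. i < degree m \<Longrightarrow> \<bar>c i\<bar> \<le> int B) \<Longrightarrow> (\<And>i. i < degree m \<Longrightarrow> \<bar>z i\<bar> \<le> int H) \<Longrightarrow>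
      \<exists>w. (\<forall>i<degree m. \<bar>w i\<bar> \<le> int (K * B * H)) \<and> val c * val z = val w"
    using val_mult_bound by blast
  show ?thesis
  proof (rule that[OF K(1)])
    fix c :: "nat \<Rightarrow> int" and B :: nat and W :: "'w set" and y
    assume c: "\<And>i. i < degree m \<Longrightarrow> \<bar>c i\<bar> \<le> int B" and c0: "val c \<noteq> 0" and W: "finite W"
      and inc: "\<And>w w' z. w \<in> W \<Longrightarrow> w' \<in> W \<Longrightarrow> val (y w) - val (y w') = val c * val z \<Longrightarrow> w = w'"
    define H where "H = nat (\<Sum>w\<in>W. \<Sum>i<\<delta>. \<bar>y w i\<bar>)"
    have H: "\<bar>y w i\<bar> \<le> int H" if "w \<in> W" "i < \<delta>" for w i
    proof -
      have "\<bar>y w i\<bar> \<le> (\<Sum>i<\<delta>. \<bar>y w i\<bar>)" using that by (intro member_le_sum) auto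
      also have "\<dots> \<le> (\<Sum>w\<in>W. \<Sum>i<\<delta>. \<bar>y w i\<bar>)"
        using that W by (intro member_le_sum[of w W "\<lambda>w. \<Sum>i<\<delta>. \<bar>y w i\<bar>"]) (auto intro: sum_nonneg)
      finally show ?thesis by (simp add: H_def)
    qed
    \<comment> \<open>With this side length the enclosing box has side 2 Q + 1 = (2 K B + 1) R
      exactly. So the power of \<open>R\<close> cancels, and the final bound is free of the size
      \<open>H\<close> of the chosen representatives.\<close>
    define R where "R = 2 * H + 1"
    define Q where "Q = H + K * B * R"
    have "\<exists>u. (\<forall>i<\<delta>. \<bar>u i\<bar> \<le> int (K * B * R)) \<and> val c * val z = val u"
      if "z \<in> {..<\<delta>} \<rightarrow>\<^sub>E {0..<int R}" for z
      unfolding \<delta>_def using that by (intro K(2) c) (auto simp: \<delta>_def PiE_def Pi_def dest!: spec)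
    then obtain u where u: "\<And>z i. z \<in> {..<\<delta>} \<rightarrow>\<^sub>E {0..<int R} \<Longrightarrow> i < \<delta> \<Longrightarrow> \<bar>u z i\<bar> \<le> int (K * B * R)"
      "\<And>z. z \<in> {..<\<delta>} \<rightarrow>\<^sub>E {0..<int R} \<Longrightarrow> val c * val z = val (u z)"
      by metis
    define F where "F = (\<lambda>(w, z). \<lambda>i\<in>{..<\<delta>}. y w i + u z i)"
    let ?X = "W \<times> ({..<\<delta>} \<rightarrow>\<^sub>E {0..<int R})"
    let ?Y = "{..<\<delta>} \<rightarrow>\<^sub>E {- int Q..int Q}"
    have valF: "val (F (w, z)) = val (y w) + val c * val z" if "(w, z) \<in> ?X" for w z
    proof -
      have "val (F (w, z)) = val (\<lambda>i. y w i + u z i)"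
        unfolding val_def by (rule sum.cong) (auto simp: F_def \<delta>_def)
      then show ?thesis using that u(2)[of z] by (simp add: val_add)
    qed
    have inj: "inj_on F ?X"
    proof (rule inj_onI)
      fix a b assume ab: "a \<in> ?X" "b \<in> ?X" "F a = F b"
      obtain w z w' z' where e: "a = (w, z)" "b = (w', z')" by (cases a, cases b)
      have eq: "val (y w) + val c * val z = val (y w') + val c * val z'"
        using ab valF[of w z] valF[of w' z'] by (simp add: e)
      \<comment> \<open>An overlap of two translates makes their representatives congruent modulo
        \<open>val c\<close>, hence equal; cancelling the nonzero \<open>val c\<close> identifies
        the box points as well.\<close>
      then have "val (y w) - val (y w') = val c * val (\<lambda>i. z' i - z i)"
        by (simp add: val_diff algebra_simps)
      then have "w = w'" using inc ab by (auto simp: e)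
      then have "val z = val z'" using eq c0 by simp
      then have "z i = z' i" if "i < \<delta>" for i using val_inj that by (simp add: \<delta>_def)
      then have "z = z'" using ab by (intro PiE_ext[of z "{..<\<delta>}" "\<lambda>_. {0..<int R}" z']) (auto simp: e)
      then show "a = b" using \<open>w = w'\<close> by (simp add: e)
    qed
    have sub: "F ` ?X \<subseteq> ?Y"
    proof
      fix g assume "g \<in> F ` ?X"
      then obtain w z where wz: "w \<in> W" "z \<in> {..<\<delta>} \<rightarrow>\<^sub>E {0..<int R}" "g = F (w, z)" by blast
      have "- int Q \<le> y w i + u z i \<and> y w i + u z i \<le> int Q" if "i < \<delta>" for i
        using H[OF wz(1) that] u(1)[OF wz(2) that] unfolding Q_def by linarith
      then show "g \<in> ?Y" by (auto simp: wz(3) F_def)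
    qed
    have "card W * R ^ \<delta> = card ?X"
      by (simp add: card_cartesian_product card_PiE)
    also have "\<dots> \<le> card ?Y"
      by (rule card_inj_on_le[OF inj sub]) (intro finite_PiE; simp)
    also have "\<dots> = (2 * Q + 1) ^ \<delta>"
    proof -
      have "nat (2 * int Q + 1) = 2 * Q + 1" by simp
      then show ?thesis by (simp add: card_PiE)
    qed
    also have "2 * Q + 1 = (2 * K * B + 1) * R"
      by (simp add: Q_def R_def algebra_simps)
    finally have "card W * R ^ \<delta> \<le> (2 * K * B + 1) ^ \<delta> * R ^ \<delta>"
      by (simp only: power_mult_distrib)
    moreover have "R ^ \<delta> > 0" by (simp add: R_def)
    ultimately show "card W \<le> (2 * K * B + 1) ^ degree m"
      unfolding \<delta>_def by (meson mult_le_cancel2)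
  qed
qed

end

section \<open>Residue fields and the prime ideals above a totally split prime\<close>

lemma ideal_coset_eq_iff:
  fixes I :: "'k::field_char_0 set"
  assumes I: "ideal I \<O>" and xy: "algebraic_int x" "algebraic_int y"
  shows "I +>\<^bsub>\<O>\<^esub> x = I +>\<^bsub>\<O>\<^esub> y \<longleftrightarrow> x - y \<in> I"
proof -
  have coset: "I +>\<^bsub>\<O>\<^esub> z = (\<lambda>h. h + z) ` I" for z
    by (auto simp: a_r_coset_def' ring_of_integers_simps)
  show ?thesis
  proof
    assume "I +>\<^bsub>\<O>\<^esub> x = I +>\<^bsub>\<O>\<^esub> y"
    moreover have "x \<in> I +>\<^bsub>\<O>\<^esub> x" unfolding coset using ideal_memD(2)[OF I] by (auto intro: rev_image_eqI)
    ultimately show "x - y \<in> I" unfolding coset by auto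
  next
    assume d: "x - y \<in> I"
    have "h + x \<in> (\<lambda>h. h + y) ` I" if "h \<in> I" for h
      using ideal_memD(3)[OF I that d] by (rule rev_image_eqI) simp
    moreover have "h + y \<in> (\<lambda>h. h + x) ` I" if "h \<in> I" for h
      using ideal_memD(4)[OF I that d] by (rule rev_image_eqI) simp
    ultimately show "I +>\<^bsub>\<O>\<^esub> x = I +>\<^bsub>\<O>\<^esub> y" unfolding coset by blast
  qed
qed

lemma carrier_quotient: "carrier (\<O> Quot I) = (\<lambda>x. I +>\<^bsub>\<O>\<^esub> x) ` {x. algebraic_int x}"
  by (auto simp: FactRing_def A_RCOSETS_def' ring_of_integers_simps)

lemma card_ZFact:
  assumes "p > 0"
  shows "card (carrier (ZFact (int p))) = p" "finite (carrier (ZFact (int p)))"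
proof -
  have "carrier (ZFact (int p)) = range (ZMod (int p))"
    by (auto simp: ZFact_def FactRing_def A_RCOSETS_def' ZMod_def)
  also have "\<dots> = ZMod (int p) ` {0..<int p}"
  proof (intro equalityI subsetI)
    fix z assume "z \<in> range (ZMod (int p))"
    then obtain a where "z = ZMod (int p) a" by blast
    then have "z = ZMod (int p) (a mod int p)" using ZMod_mod by simp
    then show "z \<in> ZMod (int p) ` {0..<int p}" using assms by auto
  qed auto
  finally have eq: "carrier (ZFact (int p)) = ZMod (int p) ` {0..<int p}" .
  have "inj_on (ZMod (int p)) {0..<int p}"
    by (rule inj_onI) (simp add: ZMod_eq_mod)
  then show "card (carrier (ZFact (int p))) = p" unfolding eq by (simp add: card_image)
  show "finite (carrier (ZFact (int p)))" unfolding eq by simp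
qed

lemma quotient_iso_ZFact:
  fixes I :: "'k::field_char_0 set"
  assumes p: "prime p" and iso: "(\<O> Quot I) \<simeq> ZFact (int p)"
  shows "ideal_norm I = p" "finite (carrier (\<O> Quot I))"
proof -
  obtain h where "bij_betw h (carrier (\<O> Quot I)) (carrier (ZFact (int p)))"
    using iso by (auto simp: is_ring_iso_def ring_iso_def)
  then show "ideal_norm I = p" "finite (carrier (\<O> Quot I))"
    using card_ZFact[OF prime_gt_0_nat[OF p]] bij_betw_same_card bij_betw_finite
    unfolding ideal_norm_def by metis+
qed

text \<open>The classes of 0, ..., p - 1 are distinct and the quotient has \<open>p\<close>
  elements, so they exhaust it.\<close>

lemma residue_integer:
  fixes I :: "'k::field_char_0 set"
  assumes I: "primeideal I \<O>" and p: "prime p" "of_nat p \<in> I"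
    and norm: "ideal_norm I = p" and x: "algebraic_int x"
  obtains n :: int where "x - of_int n \<in> I"
proof -
  note id = primeideal.axioms(1)[OF I]
  let ?f = "\<lambda>n. I +>\<^bsub>\<O>\<^esub> of_int n"
  have inj: "inj_on ?f {0..<int p}"
  proof (rule inj_onI)
    fix a b assume ab: "a \<in> {0..<int p}" "b \<in> {0..<int p}" "?f a = ?f b"
    then have "of_int (a - b) \<in> I" using ideal_coset_eq_iff[OF id, of "of_int a" "of_int b"] by simp
    then have "int p dvd a - b" using prime_ideal_of_int_iff[OF I p] by blast
    then show "a = b" using ab by (metis atLeastLessThan_iff mod_eq_dvd_iff mod_pos_pos_trivial)
  qed
  have fin: "finite (carrier (\<O> Quot I))"
    using norm p(1) unfolding ideal_norm_def by (metis card.infinite not_prime_0)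
  have "?f ` {0..<int p} = carrier (\<O> Quot I)"
    using norm by (intro card_subset_eq fin) (auto simp: card_image[OF inj] ideal_norm_def carrier_quotient)
  then have "I +>\<^bsub>\<O>\<^esub> x \<in> ?f ` {0..<int p}" using x by (auto simp: carrier_quotient)
  then obtain n where "I +>\<^bsub>\<O>\<^esub> x = ?f n" by blast
  then have "x - of_int n \<in> I" using ideal_coset_eq_iff[OF id x] by simp
  then show ?thesis by (rule that)
qed

text \<open>An element of \<open>J\<close> outside \<open>I\<close> is congruent modulo
  \<open>I\<close> to an integer not divisible by \<open>p\<close>. That integer and
  \<open>p\<close> both lie in \<open>J\<close>, so 1 does.\<close>

lemma maximalideal_if_prime_norm:
  fixes I :: "'k::field_char_0 set"
  assumes I: "primeideal I \<O>" and p: "prime p" "of_nat p \<in> I" and norm: "ideal_norm I = p"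
  shows "maximalideal I \<O>"
proof (rule maximalidealI)
  show id: "ideal I \<O>" using primeideal.axioms(1)[OF I] .
  show "carrier \<O> \<noteq> I" using primeideal.I_notcarr[OF I] .
  fix J assume J: "ideal J \<O>" "I \<subseteq> J" "J \<subseteq> carrier \<O>"
  show "J = I \<or> J = carrier \<O>"
  proof (cases "J = I")
    case False
    then obtain x where x: "x \<in> J" "x \<notin> I" using J by blast
    obtain n where n: "x - of_int n \<in> I"
      using residue_integer[OF I p norm ideal_memD(1)[OF J(1) x(1)]] .
    have "\<not> int p dvd n"
      using x(2) n ideal_memD(3)[OF id n, of "of_int n"] prime_ideal_of_int_iff[OF I p] by auto
    then have "coprime (int p) n" using p(1) by (simp add: prime_imp_coprime)
    then obtain u v where uv: "u * int p + v * n = 1"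
      using bezout_int[of "int p" n] by (auto simp: coprime_iff_gcd_eq_1)
    have "x - (x - of_int n) \<in> J" using ideal_memD(4)[OF J(1) x(1)] n J(2) by blast
    then have "of_int u * of_nat p + of_int v * of_int n \<in> J"
      using p(2) J(2) by (intro ideal_memD(3)[OF J(1)] ideal_memD(6)[OF J(1)]) auto
    moreover have "of_int u * of_nat p + of_int v * of_int n = (of_int (u * int p + v * n) :: 'k)"
      by simp
    ultimately have "1 \<in> J" by (simp only: uv of_int_1)
    then show ?thesis using ideal.one_imp_carrier[OF J(1)] by (simp add: ring_of_integers_simps)
  qed simp
qed

lemma maximalideal_subset_primeideal:
  fixes I J :: "'k::field_char_0 set"
  assumes "maximalideal I \<O>" "primeideal J \<O>" "I \<subseteq> J"
  shows "I = J"
proof -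
  have "J \<subseteq> carrier \<O>"
    using ideal_memD(1)[OF primeideal.axioms(1)[OF assms(2)]] by (auto simp: ring_of_integers_simps)
  then have "J = I \<or> J = carrier \<O>"
    using maximalideal.I_maximal[OF assms(1) primeideal.axioms(1)[OF assms(2)] assms(3)] by blast
  then show ?thesis using primeideal.I_notcarr[OF assms(2)] by blast
qed

lemma finprod_ideals_subset:
  fixes S :: "'k::field_char_0 set set"
  assumes "finite S" "\<And>I. I \<in> S \<Longrightarrow> ideal I \<O>" "J \<in> S"
  shows "finprod (ideals_set \<O>) (\<lambda>I. I) S \<subseteq> J"
proof -
  interpret Id: Group.comm_monoid "ideals_set (\<O> :: 'k ring)"
    by (rule OK.ideals_set_is_comm_monoid)
  have S: "S = insert J (S - {J})" using assms(3) by blast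
  have "finprod (ideals_set \<O>) (\<lambda>I. I) (insert J (S - {J}))
      = ideal_prod \<O> J (finprod (ideals_set \<O>) (\<lambda>I. I) (S - {J}))"
    using assms by (subst Id.finprod_insert) (auto simp: ideals_set_def)
  moreover have "finprod (ideals_set \<O>) (\<lambda>I. I) (S - {J}) \<in> carrier (ideals_set \<O>)"
    using assms by (intro Id.finprod_closed) (auto simp: ideals_set_def)
  then have "ideal (finprod (ideals_set \<O>) (\<lambda>I. I) (S - {J})) \<O>"
    by (simp add: ideals_set_def)
  ultimately show ?thesis
    using OK.ideal_prod_inter[OF assms(2)[OF assms(3)]] S by (metis le_infE)
qed

lemma primeideal_finprod_ideals:
  fixes S :: "'k::field_char_0 set set"
  assumes "finite S" "\<And>I. I \<in> S \<Longrightarrow> ideal I \<O>" and J: "primeideal J \<O>"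
    and "finprod (ideals_set \<O>) (\<lambda>I. I) S \<subseteq> J"
  shows "\<exists>I\<in>S. I \<subseteq> J"
proof -
  interpret Id: Group.comm_monoid "ideals_set (\<O> :: 'k ring)"
    by (rule OK.ideals_set_is_comm_monoid)
  show ?thesis
    using assms(1,2,4)
  proof (induction S rule: finite_induct)
    case empty
    then have "carrier \<O> \<subseteq> J" unfolding Id.finprod_empty by (simp add: ideals_set_def)
    then show ?case using primeideal_memD(1)[OF J] by (auto simp: ring_of_integers_simps)
  next
    case (insert I S)
    have "finprod (ideals_set \<O>) (\<lambda>I. I) S \<in> carrier (ideals_set \<O>)"
      using insert.prems by (intro Id.finprod_closed) (auto simp: ideals_set_def)
    then have id: "ideal (finprod (ideals_set \<O>) (\<lambda>I. I) S) \<O>"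
      by (simp add: ideals_set_def)
    have "finprod (ideals_set \<O>) (\<lambda>I. I) (insert I S)
        = ideal_prod \<O> I (finprod (ideals_set \<O>) (\<lambda>I. I) S)"
      using insert.prems insert.hyps by (subst Id.finprod_insert) (auto simp: ideals_set_def)
    then have "I \<subseteq> J \<or> finprod (ideals_set \<O>) (\<lambda>I. I) S \<subseteq> J"
      using OK.primeideal_divides_ideal_prod[OF J insert.prems(1)[of I] id] insert.prems(2) by simp
    then show ?case using insert.IH insert.prems(1) by blast
  qed
qed

text \<open>The definition of total splitting provides some set \<open>S\<close> of primes; the
  point is that \<open>S\<close> is all of them. A prime containing \<open>p\<close> contains the
  product, hence one of the factors, and these are maximal.\<close>

lemma totally_split_primes_above:
  assumes p: "prime p" and split: "totally_split TYPE('k::field_char_0) p"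
  shows "finite (primes_above p :: 'k set set)"
    and "card (primes_above p :: 'k set set) = rat_degree TYPE('k)"
    and "(\<pp> :: 'k set) \<in> primes_above p \<Longrightarrow> ideal_norm \<pp> = p"
    and "(\<pp> :: 'k set) \<in> primes_above p \<Longrightarrow> finite (carrier (\<O> Quot \<pp>))"
proof -
  obtain S :: "'k set set" where S: "finite S" "card S = rat_degree TYPE('k)"
    "\<And>\<pp>. \<pp> \<in> S \<Longrightarrow> primeideal \<pp> \<O>" "\<And>\<pp>. \<pp> \<in> S \<Longrightarrow> (\<O> Quot \<pp>) \<simeq> ZFact (int p)"
    "Idl\<^bsub>\<O>\<^esub> {of_nat p} = finprod (ideals_set \<O>) (\<lambda>\<pp>. \<pp>) S"
    using split unfolding totally_split_def by blast
  have id: "\<And>\<pp>. \<pp> \<in> S \<Longrightarrow> ideal \<pp> \<O>" using S(3) by (rule primeideal.axioms(1))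
  have "of_nat p \<in> (Idl\<^bsub>\<O>\<^esub> {of_nat p} :: 'k set)"
    by (rule OK.genideal_self') (simp add: ring_of_integers_simps)
  then have pS: "of_nat p \<in> \<pp>" if "\<pp> \<in> S" for \<pp>
    using finprod_ideals_subset[OF S(1) id that] by (auto simp: S(5))
  have norm: "ideal_norm \<pp> = p" if "\<pp> \<in> S" for \<pp>
    using quotient_iso_ZFact(1)[OF p S(4)[OF that]] .
  have eq: "primes_above p = S"
  proof (intro equalityI subsetI)
    fix \<qq> :: "'k set" assume "\<qq> \<in> primes_above p"
    then have q: "primeideal \<qq> \<O>" "of_nat p \<in> \<qq>" by (auto simp: primes_above_def)
    have "Idl\<^bsub>\<O>\<^esub> {of_nat p} \<subseteq> \<qq>"
      using q by (intro OK.genideal_minimal primeideal.axioms(1)) auto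
    then obtain \<pp> where "\<pp> \<in> S" "\<pp> \<subseteq> \<qq>"
      using primeideal_finprod_ideals[OF S(1) id q(1)] by (auto simp: S(5))
    then show "\<qq> \<in> S"
      using maximalideal_subset_primeideal[OF maximalideal_if_prime_norm[OF S(3) p pS norm] q(1)] by blast
  qed (auto simp: primes_above_def S(3) pS)
  show "finite (primes_above p :: 'k set set)" "card (primes_above p :: 'k set set) = rat_degree TYPE('k)"
    "\<pp> \<in> primes_above p \<Longrightarrow> ideal_norm \<pp> = p"
    "\<pp> \<in> primes_above p \<Longrightarrow> finite (carrier (\<O> Quot \<pp>))" for \<pp> :: "'k set"
    using S(1,2) norm quotient_iso_ZFact(2)[OF p S(4)] by (simp_all add: eq)
qed

lemma primeideal_prod_mem:
  fixes I :: "'k::field_char_0 set"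
  assumes I: "primeideal I \<O>" and "finite A" "\<And>a. a \<in> A \<Longrightarrow> algebraic_int (f a)" "(\<Prod>a\<in>A. f a) \<in> I"
  shows "\<exists>a\<in>A. f a \<in> I"
  using assms(2-)
proof (induction A rule: finite_induct)
  case empty
  then show ?case using primeideal_memD(1)[OF I] by simp
next
  case (insert a A)
  then have "f a \<in> I \<or> (\<Prod>a\<in>A. f a) \<in> I"
    by (intro primeideal_memD(2)[OF I]) (auto intro: algebraic_int_prod)
  then show ?case using insert by auto
qed

lemma ideal_sum_mem:
  fixes I :: "'k::field_char_0 set"
  assumes "ideal I \<O>" "\<And>a. a \<in> A \<Longrightarrow> f a \<in> I"
  shows "(\<Sum>a\<in>A. f a) \<in> I"
  using assms(2) by (induction A rule: infinite_finite_induct) (auto intro: ideal_memD[OF assms(1)])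

context galois_generator
begin

text \<open>Elements of \<open>\<int>[\<alpha>]\<close> realising every system of residues modulo the given primes are
  pairwise incongruent modulo any \<open>x\<close> that lies in all of these primes.\<close>

lemma prod_primes_containing_le:
  fixes d :: int
  assumes d: "\<And>x. algebraic_int x \<Longrightarrow> \<exists>h. degree h < degree m \<and> of_int d * x = ipoly h \<alpha>"
  obtains K :: nat where "K > 0"
    and "\<And>(J :: 'j set) I q c B. finite J \<Longrightarrow>
      (\<And>j. j \<in> J \<Longrightarrow> primeideal (I j) \<O> \<and> prime (q j) \<and> of_nat (q j) \<in> I j \<and> \<not> int (q j) dvd d) \<Longrightarrow>
      (\<And>j j'. j \<in> J \<Longrightarrow> j' \<in> J \<Longrightarrow> I j' \<subseteq> I j \<Longrightarrow> j = j') \<Longrightarrow>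
      (\<And>i. i < degree m \<Longrightarrow> \<bar>c i\<bar> \<le> int B) \<Longrightarrow> val c \<noteq> 0 \<Longrightarrow> (\<And>j. j \<in> J \<Longrightarrow> val c \<in> I j) \<Longrightarrow>
      (\<Prod>j\<in>J. q j) \<le> (2 * K * B + 1) ^ degree m"
proof (rule card_incongruent_le[where ?'w = "'j \<Rightarrow> nat"])
  fix K :: nat
  assume K: "K > 0"
    "\<And>c B (W :: ('j \<Rightarrow> nat) set) y. (\<And>i. i < degree m \<Longrightarrow> \<bar>c i\<bar> \<le> int B) \<Longrightarrow> val c \<noteq> 0 \<Longrightarrow> finite W \<Longrightarrow>
      (\<And>w w' z. w \<in> W \<Longrightarrow> w' \<in> W \<Longrightarrow> val (y w) - val (y w') = val c * val z \<Longrightarrow> w = w') \<Longrightarrow>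
      card W \<le> (2 * K * B + 1) ^ degree m"
  show thesis
  proof (rule that[OF K(1)])
    fix J :: "'j set" and I :: "'j \<Rightarrow> 'k set" and q :: "'j \<Rightarrow> nat" and c :: "nat \<Rightarrow> int" and B :: nat
    assume J: "finite J"
      and I: "\<And>j. j \<in> J \<Longrightarrow> primeideal (I j) \<O> \<and> prime (q j) \<and> of_nat (q j) \<in> I j \<and> \<not> int (q j) dvd d"
      and sep: "\<And>j j'. j \<in> J \<Longrightarrow> j' \<in> J \<Longrightarrow> I j' \<subseteq> I j \<Longrightarrow> j = j'"
      and c: "\<And>i. i < degree m \<Longrightarrow> \<bar>c i\<bar> \<le> int B" "val c \<noteq> 0" "\<And>j. j \<in> J \<Longrightarrow> val c \<in> I j"
    have pI: "primeideal (I j) \<O>" and idI: "ideal (I j) \<O>" if "j \<in> J" for j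
      using I[OF that] primeideal.axioms(1) by auto
    have int_iff: "of_int n \<in> I j \<longleftrightarrow> int (q j) dvd n" if "j \<in> J" for j n
      using I[OF that] by (intro prime_ideal_of_int_iff) auto
    \<comment> \<open>A witness that \<open>I j'\<close> is not contained in \<open>I j\<close>. The
      product \<open>A j\<close> over all other indices lies in every other ideal but, by primality,
      not in \<open>I j\<close>.\<close>
    define a where "a = (\<lambda>j j'. SOME a. a \<in> I j' \<and> a \<notin> I j)"
    have a: "a j j' \<in> I j' \<and> a j j' \<notin> I j" if "j \<in> J" "j' \<in> J - {j}" for j j'
    proof -
      have "\<exists>a. a \<in> I j' \<and> a \<notin> I j" using sep[of j j'] that by blast
      then show ?thesis unfolding a_def by (rule someI_ex)
    qed
    have a_alg: "algebraic_int (a j j')" if "j \<in> J" "j' \<in> J - {j}" for j j'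
      using ideal_memD(1)[OF idI[of j']] a[OF that] that by blast
    define A where "A = (\<lambda>j. \<Prod>j'\<in>J - {j}. a j j')"
    have A_alg: "algebraic_int (A j)" if "j \<in> J" for j
      unfolding A_def by (intro algebraic_int_prod a_alg that)
    \<comment> \<open>The factor \<open>d\<close> moves \<open>A j\<close> into Z[\<alpha>] and, as
      \<open>q j\<close> does not divide \<open>d\<close>, leaves it outside \<open>I j\<close>. To
      read off \<open>w j\<close> it is enough to be nonzero modulo \<open>I j\<close>, in place of
      congruent to 1.\<close>
    define \<epsilon> where "\<epsilon> = (\<lambda>j. SOME e. of_int d * A j = val e)"
    have \<epsilon>: "of_int d * A j = val (\<epsilon> j)" if j: "j \<in> J" for j
    proof -
      obtain h where "degree h < degree m" "of_int d * A j = ipoly h \<alpha>"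
        using d[OF A_alg[OF j]] by blast
      then have "\<exists>e. of_int d * A j = val e" using ipoly_eq_val[of h] by auto
      then show ?thesis unfolding \<epsilon>_def by (rule someI_ex)
    qed
    have notin: "val (\<epsilon> j) \<notin> I j" if j: "j \<in> J" for j
    proof
      assume "val (\<epsilon> j) \<in> I j"
      then have "of_int d \<in> I j \<or> A j \<in> I j"
        using A_alg[OF j] by (intro primeideal_memD(2)[OF pI[OF j]]) (auto simp: \<epsilon>[OF j])
      then have "A j \<in> I j" using int_iff[OF j] I[OF j] by auto
      then have "\<exists>j'\<in>J - {j}. a j j' \<in> I j"
        unfolding A_def using J a_alg[OF j] by (intro primeideal_prod_mem pI j) auto
      then show False using a[OF j] by blast
    qed
    have mem: "val (\<epsilon> j) \<in> I j0" if j: "j \<in> J" "j0 \<in> J" "j \<noteq> j0" for j j0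
    proof -
      have "A j = a j j0 * (\<Prod>j'\<in>J - {j} - {j0}. a j j')"
        unfolding A_def using j J by (intro prod.remove) auto
      also have "\<dots> \<in> I j0"
        using a[of j j0] j by (intro ideal_memD(5)[OF idI] algebraic_int_prod a_alg) auto
      finally show ?thesis
        using j by (auto simp flip: \<epsilon> intro!: ideal_memD(6)[OF idI])
    qed
    define W where "W = (\<Pi>\<^sub>E j\<in>J. {..<q j})"
    define y where "y = (\<lambda>w :: 'j \<Rightarrow> nat. \<lambda>i. \<Sum>j\<in>J. int (w j) * \<epsilon> j i)"
    have val_y: "val (y w) = (\<Sum>j\<in>J. of_nat (w j) * val (\<epsilon> j))" for w
      unfolding val_def y_def
      by (simp add: sum_distrib_left sum_distrib_right mult.assoc sum.swap[of _ J])
    have "card W \<le> (2 * K * B + 1) ^ degree m"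
    proof (rule K(2)[OF c(1,2), of W y])
      show "finite W" unfolding W_def using J by (intro finite_PiE) auto
      fix w w' z assume w: "w \<in> W" "w' \<in> W" and eq: "val (y w) - val (y w') = val c * val z"
      show "w = w'"
      proof (rule PiE_ext[OF w[unfolded W_def]])
        fix j assume j: "j \<in> J"
        \<comment> \<open>All terms but the one for \<open>j\<close> lie in \<open>I j\<close>, and
          so does the multiple of \<open>val c\<close>. Primality then puts the integer
          \<open>w j - w' j\<close> into \<open>I j\<close>.\<close>
        have "val (y w) - val (y w') = (\<Sum>j\<in>J. of_int (int (w j) - int (w' j)) * val (\<epsilon> j))"
          by (simp add: val_y sum_subtractf left_diff_distrib)
        also have "\<dots> = of_int (int (w j) - int (w' j)) * val (\<epsilon> j) +
            (\<Sum>j\<in>J - {j}. of_int (int (w j) - int (w' j)) * val (\<epsilon> j))"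
          using j J by (intro sum.remove) auto
        finally have "of_int (int (w j) - int (w' j)) * val (\<epsilon> j) = val c * val z
            - (\<Sum>j\<in>J - {j}. of_int (int (w j) - int (w' j)) * val (\<epsilon> j))"
          by (simp add: eq algebra_simps)
        also have "\<dots> \<in> I j"
        proof (rule ideal_memD(4)[OF idI[OF j]])
          show "val c * val z \<in> I j"
            by (rule ideal_memD(5)[OF idI[OF j] c(3)[OF j] val_alg])
          show "(\<Sum>j'\<in>J - {j}. of_int (int (w j') - int (w' j')) * val (\<epsilon> j')) \<in> I j"
            using mem[OF _ j]
            by (intro ideal_sum_mem[OF idI[OF j]] ideal_memD(6)[OF idI[OF j]] algebraic_int_of_int) auto
        qed
        finally have "of_int (int (w j) - int (w' j)) \<in> I j \<or> val (\<epsilon> j) \<in> I j"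
          by (rule primeideal_memD(2)[OF pI[OF j] algebraic_int_of_int val_alg])
        then have "int (q j) dvd int (w j) - int (w' j)"
          using notin[OF j] int_iff[OF j] by blast
        moreover have "w j < q j" "w' j < q j" using w j by (auto simp: W_def)
        ultimately show "w j = w' j"
          by (metis mod_eq_dvd_iff mod_less of_nat_eq_iff zmod_int)
      qed
    qed
    then show "(\<Prod>j\<in>J. q j) \<le> (2 * K * B + 1) ^ degree m"
      using J by (simp add: W_def card_PiE)
  qed
qed

end

section \<open>Split codes\<close>

lemma base_digits_sum: "(\<Sum>j\<le>s. ((a div n ^ j) mod n) * n ^ j) = (a :: nat) mod n ^ Suc s"
proof (induction s)
  case (Suc s)
  have "a mod n ^ Suc (Suc s) = n ^ Suc s * (a div n ^ Suc s mod n) + a mod n ^ Suc s"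
    unfolding power_Suc2[of n "Suc s"] by (rule mod_mult2_eq)
  then show ?case unfolding sum.atMost_Suc Suc.IH by (simp only: mult.commute[of _ "n ^ Suc s"] add.commute)
qed simp

lemma base_digits_less:
  fixes a :: "nat \<Rightarrow> int"
  assumes "\<And>j. j \<le> s \<Longrightarrow> 0 \<le> a j \<and> a j < int n"
  shows "0 \<le> (\<Sum>j\<le>s. a j * int n ^ j) \<and> (\<Sum>j\<le>s. a j * int n ^ j) < int n ^ Suc s"
  using assms
proof (induction s)
  case (Suc s)
  have "a (Suc s) + 1 \<le> int n" using Suc.prems[of "Suc s"] by simp
  then have "(a (Suc s) + 1) * int n ^ Suc s \<le> int n * int n ^ Suc s"
    by (rule mult_right_mono) simp
  then show ?case using Suc by (simp add: algebra_simps)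
qed simp

context galois_generator
begin

text \<open>Exchanging the two sums turns the digits of a message into a base \<open>n\<close>
  expansion with s + 1 places in each coordinate. The top power of \<alpha> and all beyond have
  coordinate 0.\<close>

lemma messages_val:
  assumes r: "r < degree m" and x: "x \<in> messages r s \<alpha> n"
  obtains c where "x = val c" "\<And>i. 0 \<le> c i \<and> c i \<le> int (n ^ Suc s)"
proof -
  obtain f where f: "x = (\<Sum>j\<le>s. f j * of_nat n ^ j)" "\<And>j. j \<le> s \<Longrightarrow> f j \<in> message_digits r \<alpha> n"
    using x by (auto simp: messages_def)
  have "\<exists>a. f j = (\<Sum>i<r. of_int (a i) * \<alpha> ^ i) \<and> (\<forall>i<r. 0 \<le> a i \<and> a i < int n)" if "j \<le> s" for j
    using f(2)[OF that] by (auto simp: message_digits_def)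
  then obtain a where a: "\<And>j. j \<le> s \<Longrightarrow> f j = (\<Sum>i<r. of_int (a j i) * \<alpha> ^ i)"
    "\<And>j i. j \<le> s \<Longrightarrow> i < r \<Longrightarrow> 0 \<le> a j i \<and> a j i < int n"
    by metis
  define c where "c = (\<lambda>i. if i < r then \<Sum>j\<le>s. a j i * int n ^ j else 0)"
  have "x = (\<Sum>j\<le>s. \<Sum>i<r. of_int (a j i * int n ^ j) * \<alpha> ^ i)"
    unfolding f(1) using a(1) by (intro sum.cong refl) (simp add: sum_distrib_left mult_ac)
  also have "\<dots> = (\<Sum>i<r. \<Sum>j\<le>s. of_int (a j i * int n ^ j) * \<alpha> ^ i)" by (rule sum.swap)
  also have "\<dots> = (\<Sum>i<r. of_int (c i) * \<alpha> ^ i)"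
    by (simp add: c_def sum_distrib_right)
  also have "\<dots> = val c"
    unfolding val_def using r by (intro sum.mono_neutral_left) (auto simp: c_def)
  finally have "x = val c" .
  moreover have "0 \<le> c i \<and> c i \<le> int (n ^ Suc s)" for i
    using base_digits_less[of s "\<lambda>j. a j i" n] a(2) by (auto simp: c_def less_imp_le)
  ultimately show ?thesis by (rule that)
qed

text \<open>Taking base \<open>n\<close> digits in every coordinate inverts the expansion. This
  direction bounds the number of messages from below.\<close>

lemma val_in_messages:
  assumes r: "r < degree m" and n: "n > 0"
    and c: "\<And>i. i < r \<Longrightarrow> c i < n ^ Suc s" "\<And>i. i \<ge> r \<Longrightarrow> c i = 0"
  shows "val (\<lambda>i. int (c i)) \<in> messages r s \<alpha> n"
proof -
  define a where "a = (\<lambda>j i. (c i div n ^ j) mod n)"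
  define f where "f = (\<lambda>j. \<Sum>i<r. of_int (int (a j i)) * \<alpha> ^ i)"
  have "val (\<lambda>i. int (c i)) = (\<Sum>i<r. of_nat (c i) * \<alpha> ^ i)"
    unfolding val_def using r c(2) by (intro sum.mono_neutral_cong_right) auto
  also have "\<dots> = (\<Sum>i<r. of_nat (\<Sum>j\<le>s. a j i * n ^ j) * \<alpha> ^ i)"
    unfolding a_def using c(1) by (intro sum.cong) (simp_all add: base_digits_sum del: power_Suc)
  also have "\<dots> = (\<Sum>i<r. \<Sum>j\<le>s. of_nat (a j i * n ^ j) * \<alpha> ^ i)"
    by (simp add: sum_distrib_right)
  also have "\<dots> = (\<Sum>j\<le>s. \<Sum>i<r. of_nat (a j i * n ^ j) * \<alpha> ^ i)" by (rule sum.swap)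
  also have "\<dots> = (\<Sum>j\<le>s. f j * of_nat n ^ j)"
    by (simp add: f_def sum_distrib_left mult_ac)
  finally have "val (\<lambda>i. int (c i)) = (\<Sum>j\<le>s. f j * of_nat n ^ j)" .
  moreover have "f j \<in> message_digits r \<alpha> n" for j
    unfolding message_digits_def f_def using n
    by (intro CollectI exI[of _ "\<lambda>i. int (a j i)"]) (auto simp: a_def)
  ultimately show ?thesis unfolding messages_def by blast
qed

lemma messages_alg: "r < degree m \<Longrightarrow> x \<in> messages r s \<alpha> n \<Longrightarrow> algebraic_int x"
  by (erule (1) messages_val) (simp add: val_alg)

end

text \<open>By truncated subtraction \<open>p 0 = p 1\<close>, hence the side conditions \<open>1 \<le> i\<close> below.\<close>

locale split_primes = galois_generator \<alpha> for \<alpha> :: "'k::field_char_0" +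
  fixes p P :: "nat \<Rightarrow> nat" and r :: nat
  defines "p \<equiv> \<lambda>j. enumerate (admissible_primes \<alpha>) (j - 1)"
    and "P \<equiv> \<lambda>l. \<Prod>i=1..l. p i"
  assumes degree: "rat_degree TYPE('k) = r + 1"
begin

lemma degree_m_r: "degree m = r + 1"
  using degree degree_m_eq by simp

lemma inf_adm: "infinite (admissible_primes \<alpha>)"
  by (rule admissible_primes_growth)

lemma p_adm: "p i \<in> admissible_primes \<alpha>"
  unfolding p_def by (rule enumerate_in_set[OF inf_adm])

lemma p_prime: "prime (p i)" and p_split: "totally_split TYPE('k) (p i)"
  using p_adm by (auto simp: admissible_primes_def)

lemma p_less: "1 \<le> i \<Longrightarrow> i < j \<Longrightarrow> p i < p j"
  unfolding p_def using inf_adm by (intro enumerate_mono) auto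

lemma p_le: "1 \<le> i \<Longrightarrow> i \<le> j \<Longrightarrow> p i \<le> p j"
  using p_less[of i j] by (cases "i = j") auto

lemma p_ge: "i \<le> Suc (p i)"
  unfolding p_def using le_enumerate[OF inf_adm, of "i - 1"] by simp

lemma p_gt_1: "1 < p i"
  using p_prime prime_gt_1_nat by blast

lemma P_pos: "P l > 0"
  unfolding P_def using p_prime prime_gt_0_nat by (intro prod_pos) blast

lemma primes_above_p:
  "finite (primes_above (p i) :: 'k set set)"
  "card (primes_above (p i) :: 'k set set) = r + 1"
  "(\<pp> :: 'k set) \<in> primes_above (p i) \<Longrightarrow> ideal_norm \<pp> = p i"
  "(\<pp> :: 'k set) \<in> primes_above (p i) \<Longrightarrow> finite (carrier (\<O> Quot \<pp>))"
  "(\<pp> :: 'k set) \<in> primes_above (p i) \<Longrightarrow> primeideal \<pp> \<O>"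
  "(\<pp> :: 'k set) \<in> primes_above (p i) \<Longrightarrow> of_nat (p i) \<in> \<pp>"
  using totally_split_primes_above[OF p_prime p_split] degree by (simp_all add: primes_above_def)

lemma finite_split_coords: "finite (split_coords p l :: (nat \<times> 'k set) set)"
  unfolding split_coords_def using primes_above_p(1) by (intro finite_SigmaI) auto

lemma prod_split_coords: "(\<Prod>t\<in>(split_coords p l :: (nat \<times> 'k set) set). p (fst t)) = P l ^ (r + 1)"
proof -
  have "(\<Prod>t\<in>(split_coords p l :: (nat \<times> 'k set) set). p (fst t))
      = (\<Prod>i=1..l. \<Prod>\<pp>\<in>(primes_above (p i) :: 'k set set). p i)"
    unfolding split_coords_def using primes_above_p(1) by (subst prod.Sigma) (auto simp: case_prod_beta)
  also have "\<dots> = P l ^ (r + 1)"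
    by (simp only: prod_constant primes_above_p(2) P_def prod_power_distrib)
  finally show ?thesis .
qed

lemma code_space_split:
  "is_code (split_coords p l) residue_alphabet (code_space (split_coords p l :: (nat \<times> 'k set) set) residue_alphabet)"
  "card (code_space (split_coords p l :: (nat \<times> 'k set) set) residue_alphabet) = P l ^ (r + 1)"
  "finite (code_space (split_coords p l :: (nat \<times> 'k set) set) residue_alphabet)"
proof -
  have *: "Ring.field (residue_alphabet t)" "finite (carrier (residue_alphabet t))"
    "card (carrier (residue_alphabet t)) = p (fst t)"
    if "t \<in> (split_coords p l :: (nat \<times> 'k set) set)" for t
  proof -
    obtain i \<pp> where t: "t = (i, \<pp>)" "\<pp> \<in> primes_above (p i)"
      using \<open>t \<in> split_coords p l\<close> by (auto simp: split_coords_def)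
    show "Ring.field (residue_alphabet t)" "finite (carrier (residue_alphabet t))"
      "card (carrier (residue_alphabet t)) = p (fst t)"
      using primes_above_p(3-6)[OF t(2)] p_prime
        maximalideal.quotient_is_field[OF maximalideal_if_prime_norm cring_ring_of_integers]
      by (auto simp: t(1) residue_alphabet_def ideal_norm_def)
  qed
  show "is_code (split_coords p l) residue_alphabet (code_space (split_coords p l :: (nat \<times> 'k set) set) residue_alphabet)"
    using * finite_split_coords by (auto simp: is_code_def)
  show "card (code_space (split_coords p l :: (nat \<times> 'k set) set) residue_alphabet) = P l ^ (r + 1)"
    unfolding code_space_def card_PiE[OF finite_split_coords] prod_split_coords[symmetric]
    using *(3) by (intro prod.cong) auto
  show "finite (code_space (split_coords p l :: (nat \<times> 'k set) set) residue_alphabet)"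
    unfolding code_space_def using *(2) by (intro finite_PiE finite_split_coords) auto
qed

lemma split_code_subset:
  "split_code r s \<alpha> n p l \<subseteq> code_space (split_coords p l) residue_alphabet"
proof -
  have "split_encode p l x \<in> code_space (split_coords p l) residue_alphabet"
    if "algebraic_int x" for x :: 'k
    using that unfolding split_encode_def code_space_def
    by (auto simp: residue_alphabet_def carrier_quotient)
  then show ?thesis
    using messages_alg[of r] degree_m_r by (auto simp: split_code_def)
qed

lemma split_code_is_code: "is_code (split_coords p l) residue_alphabet (split_code r s \<alpha> n p l)"
  using code_space_split(1)[of l] split_code_subset by (auto simp: is_code_def)

lemma encode_eq_iff:
  assumes "t \<in> split_coords p l" "algebraic_int (x :: 'k)" "algebraic_int (y :: 'k)"
  shows "split_encode p l x t = split_encode p l y t \<longleftrightarrow> x - y \<in> snd t"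
proof -
  obtain i \<pp> where t: "t = (i, \<pp>)" "\<pp> \<in> primes_above (p i)"
    using assms(1) by (auto simp: split_coords_def)
  show ?thesis
    using assms ideal_coset_eq_iff[OF primeideal.axioms(1)[OF primes_above_p(5)[OF t(2)]]]
    by (simp add: split_encode_def t(1))
qed

text \<open>Excluding inclusions, and not merely equalities, is what the Chinese remainder witnesses
  require. A prime ideal contains only one rational prime, and primes above the same one are
  maximal.\<close>

lemma split_coords_distinct:
  assumes "t \<in> split_coords p l" "t' \<in> split_coords p l" "snd t' \<subseteq> snd t"
  shows "t = (t' :: nat \<times> 'k set)"
proof -
  obtain i \<pp> where t: "t = (i, \<pp>)" "\<pp> \<in> primes_above (p i)" "i \<ge> 1"
    using assms(1) by (auto simp: split_coords_def)
  obtain i' \<pp>' where t': "t' = (i', \<pp>')" "\<pp>' \<in> primes_above (p i')" "i' \<ge> 1"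
    using assms(2) by (auto simp: split_coords_def)
  have sub: "\<pp>' \<subseteq> \<pp>" using assms(3) by (simp add: t t')
  have "of_int (int (p i')) \<in> \<pp>" using primes_above_p(6)[OF t'(2)] sub by auto
  then have "p i dvd p i'"
    using prime_ideal_of_int_iff[OF primes_above_p(5)[OF t(2)] p_prime primes_above_p(6)[OF t(2)]]
    by (metis int_dvd_int_iff)
  then have "p i = p i'" using primes_dvd_imp_eq[OF p_prime p_prime] by blast
  then have "i = i'" using p_less[of i i'] p_less[of i' i] t(3) t'(3)
    by (cases i i' rule: linorder_cases) auto
  moreover have "maximalideal \<pp>' \<O>"
    using primes_above_p(3,5,6)[OF t'(2)] p_prime by (intro maximalideal_if_prime_norm[of _ "p i'"]) auto
  then have "\<pp> = \<pp>'"
    using maximalideal_subset_primeideal[OF _ primes_above_p(5)[OF t(2)] sub] by simp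
  ultimately show ?thesis by (simp add: t t')
qed

text \<open>The coordinates of agreement outside \<open>bad\<close> are distinct prime ideals
  containing x - y, so the product of their primes is bounded by counting. Every other coordinate
  contributes at most \<open>p l\<close>. Neither constant depends on \<open>l\<close>,
  \<open>n\<close> or \<open>s\<close>.\<close>

lemma distance_bound:
  obtains K b :: nat where "K > 0"
    and "\<And>l n s x y. l \<ge> 1 \<Longrightarrow> n \<ge> 1 \<Longrightarrow> x \<in> messages r s \<alpha> n \<Longrightarrow> y \<in> messages r s \<alpha> n \<Longrightarrow> x \<noteq> y \<Longrightarrow>
      P l ^ (r + 1) \<le> (K * n ^ Suc s) ^ (r + 1) *
        p l ^ (hamming_dist (split_coords p l) (split_encode p l x) (split_encode p l y) + b)"
proof (rule admissible_primes_growth)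
  fix d :: int
  assume d: "d \<noteq> 0"
    "\<And>x. algebraic_int x \<Longrightarrow> \<exists>h. degree h < degree m \<and> of_int d * x = ipoly h \<alpha>"
  show thesis
  proof (rule prod_primes_containing_le[OF d(2), where ?'j = "nat \<times> 'k set"])
    fix K :: nat
    assume K: "K > 0"
      "\<And>(J :: (nat \<times> 'k set) set) I q c B. finite J \<Longrightarrow>
        (\<And>j. j \<in> J \<Longrightarrow> primeideal (I j) \<O> \<and> prime (q j) \<and> of_nat (q j) \<in> I j \<and> \<not> int (q j) dvd d) \<Longrightarrow>
        (\<And>j j'. j \<in> J \<Longrightarrow> j' \<in> J \<Longrightarrow> I j' \<subseteq> I j \<Longrightarrow> j = j') \<Longrightarrow>
        (\<And>i. i < degree m \<Longrightarrow> \<bar>c i\<bar> \<le> int B) \<Longrightarrow> val c \<noteq> 0 \<Longrightarrow> (\<And>j. j \<in> J \<Longrightarrow> val c \<in> I j) \<Longrightarrow>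
        (\<Prod>j\<in>J. q j) \<le> (2 * K * B + 1) ^ degree m"
    \<comment> \<open>The coordinates over primes dividing \<open>d\<close>, where the index bound
      does not apply. The set is taken over all i \<ge> 1, so that its size is independent of
      \<open>l\<close>.\<close>
    define bad :: "(nat \<times> 'k set) set"
      where "bad = (SIGMA i:{i. 1 \<le> i \<and> int (p i) dvd d}. primes_above (p i))"
    have "finite {i. 1 \<le> i \<and> int (p i) dvd d}"
    proof (rule inj_on_finite)
      show "inj_on p {i. 1 \<le> i \<and> int (p i) dvd d}"
        using p_less by (intro linorder_inj_onI) (auto simp: less_le)
      show "p ` {i. 1 \<le> i \<and> int (p i) dvd d} \<subseteq> {..nat \<bar>d\<bar>}"
        using d(1) by (auto dest!: dvd_imp_le_int)
    qed simp
    then have fin_bad: "finite bad"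
      unfolding bad_def using primes_above_p(1) by (intro finite_SigmaI) auto
    show thesis
    proof (rule that[of "2 * K + 1" "card bad"])
      fix l n s :: nat and x y :: 'k
      assume l: "l \<ge> 1" and n: "n \<ge> 1" and xy: "x \<in> messages r s \<alpha> n" "y \<in> messages r s \<alpha> n" "x \<noteq> y"
      have r: "r < degree m" using degree_m_r by simp
      have alg: "algebraic_int x" "algebraic_int y" using xy messages_alg[OF r] by auto
      let ?T = "split_coords p l :: (nat \<times> 'k set) set"
      let ?u = "split_encode p l x" and ?v = "split_encode p l y"
      define agr where "agr = {t \<in> ?T. ?u t = ?v t} - bad"
      define dis where "dis = {t \<in> ?T. ?u t \<noteq> ?v t}"
      have finT: "finite ?T" by (rule finite_split_coords)
      obtain a where a: "x = val a" "\<And>i. 0 \<le> a i \<and> a i \<le> int (n ^ Suc s)" using messages_val[OF r xy(1)] by blast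
      obtain a' where a': "y = val a'" "\<And>i. 0 \<le> a' i \<and> a' i \<le> int (n ^ Suc s)" using messages_val[OF r xy(2)] by blast
      have diff: "x - y = val (\<lambda>i. a i - a' i)" by (simp add: a a' val_diff)
      have agr_le: "(\<Prod>t\<in>agr. p (fst t)) \<le> (2 * K * n ^ Suc s + 1) ^ degree m"
      proof (rule K(2)[where I = snd and c = "\<lambda>i. a i - a' i"])
        show "finite agr" using finT by (simp add: agr_def)
        show "primeideal (snd t) \<O> \<and> prime (p (fst t)) \<and> of_nat (p (fst t)) \<in> snd t \<and> \<not> int (p (fst t)) dvd d"
          if "t \<in> agr" for t
          using that primes_above_p(5,6) p_prime by (auto simp: agr_def bad_def split_coords_def)
        show "t = t'" if "t \<in> agr" "t' \<in> agr" "snd t' \<subseteq> snd t" for t t'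
          using that by (intro split_coords_distinct[of t l t']) (simp_all add: agr_def)
        show "\<bar>a i - a' i\<bar> \<le> int (n ^ Suc s)" for i using a(2)[of i] a'(2)[of i] by linarith
        show "val (\<lambda>i. a i - a' i) \<noteq> 0" using xy(3) by (simp flip: diff)
        show "val (\<lambda>i. a i - a' i) \<in> snd t" if "t \<in> agr" for t
          using that encode_eq_iff[of t l x y] alg by (simp add: agr_def flip: diff)
      qed
      \<comment> \<open>As n \<ge> 1, the additive 1 is absorbed into the factor.\<close>
      have "2 * K * n ^ Suc s + 1 \<le> (2 * K + 1) * n ^ Suc s"
        using n by (simp add: algebra_simps Suc_le_eq)
      then have agr_le: "(\<Prod>t\<in>agr. p (fst t)) \<le> ((2 * K + 1) * n ^ Suc s) ^ (r + 1)"
        unfolding degree_m_r[symmetric] by (intro order.trans[OF agr_le] power_mono) auto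
      have "P l ^ (r + 1) = (\<Prod>t\<in>?T. p (fst t))" by (rule prod_split_coords[symmetric])
      also have "\<dots> = (\<Prod>t\<in>agr. p (fst t)) * (\<Prod>t\<in>?T - agr. p (fst t))"
        using finT by (subst prod.subset_diff[of agr]) (auto simp: agr_def mult.commute)
      also have "(\<Prod>t\<in>?T - agr. p (fst t)) \<le> (\<Prod>t\<in>?T - agr. p l)"
        using p_le by (intro prod_mono) (auto simp: split_coords_def)
      also have "\<dots> = p l ^ card (?T - agr)" by simp
      also have "\<dots> \<le> p l ^ (card dis + card bad)"
      proof (rule power_increasing)
        have "card (?T - agr) \<le> card (dis \<union> bad)"
          using finT fin_bad by (intro card_mono) (auto simp: dis_def agr_def)
        also have "\<dots> \<le> card dis + card bad" by (rule card_Un_le)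
        finally show "card (?T - agr) \<le> card dis + card bad" .
      qed (use p_gt_1[of l] in simp)
      finally have "P l ^ (r + 1) \<le> (\<Prod>t\<in>agr. p (fst t)) * p l ^ (card dis + card bad)"
        by simp
      also have "\<dots> \<le> ((2 * K + 1) * n ^ Suc s) ^ (r + 1) * p l ^ (card dis + card bad)"
        by (intro mult_right_mono agr_le) simp
      finally show "P l ^ (r + 1) \<le> ((2 * K + 1) * n ^ Suc s) ^ (r + 1) *
          p l ^ (hamming_dist ?T ?u ?v + card bad)"
        by (simp add: hamming_dist_def dis_def)
    qed simp
  qed
qed

end

section \<open>Asymptotics\<close>

text \<open>In positive degree the maximum dominates an absolute value. In degree 0 it is a maximum
  over the empty set, hence unspecified, but its exponent is 0.\<close>

lemma C_const_nonneg: "C_const \<alpha> \<ge> 0"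
proof -
  let ?S = "\<lambda>m. Max ((\<lambda>i. \<bar>coeff m i\<bar>) ` {..<degree m})"
  have "0 \<le> (1 + real_of_int (?S m)) ^ ((degree m - 1) * degree m div 2)" for m :: "int poly"
  proof (cases "degree m = 0")
    case False
    then have "\<bar>coeff m 0\<bar> \<le> ?S m" by (intro Max_ge) auto
    then have "0 \<le> real_of_int (?S m)" using order.trans[OF abs_ge_zero] by (simp only: of_int_0_le_iff)
    then show ?thesis by (intro zero_le_power) simp
  qed simp
  then show ?thesis unfolding C_const_def Let_def by (intro mult_nonneg_nonneg powr_ge_zero) blast
qed

lemma floor_root_bounds:
  fixes q :: real and s :: nat
  assumes "q \<ge> 0" and n: "n = nat \<lfloor>root (Suc s) q\<rfloor>"
  shows "real n ^ Suc s \<le> q" and "q < (real n + 1) ^ Suc s"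
proof -
  have r0: "root (Suc s) q \<ge> 0" using assms(1) by simp
  have pow: "root (Suc s) q ^ Suc s = q" using assms(1) by (intro real_root_pow_pos2) auto
  have "real n \<le> root (Suc s) q" using r0 by (simp add: n)
  then have "real n ^ Suc s \<le> root (Suc s) q ^ Suc s" by (intro power_mono) auto
  then show "real n ^ Suc s \<le> q" by (simp only: pow)
  have "root (Suc s) q < real n + 1" unfolding n using r0 by linarith
  then have "root (Suc s) q ^ Suc s < (real n + 1) ^ Suc s" using r0 by (intro power_strict_mono) auto
  then show "q < (real n + 1) ^ Suc s" by (simp only: pow)
qed

context split_primes
begin

lemma ln_p_pos: "ln (real (p i)) > 0"
  using p_gt_1[of i] by simp

lemma ln_P: "ln (real (P l)) = (\<Sum>i=1..l. ln (real (p i)))"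
proof -
  have "ln (\<Prod>i=1..l. real (p i)) = (\<Sum>i=1..l. ln (real (p i)))"
    using p_gt_1 by (intro ln_prod) (auto simp: prime_gt_0_nat p_prime)
  then show ?thesis by (simp add: P_def)
qed

lemma ln_P_split: "k \<le> l \<Longrightarrow> ln (real (P l)) = ln (real (P k)) + (\<Sum>i=k+1..l. ln (real (p i)))"
  unfolding ln_P using sum.ub_add_nat[of 1 k "\<lambda>i. ln (real (p i))" "l - k"] by simp

lemma ln_P_nonneg: "ln (real (P l)) \<ge> 0"
  unfolding ln_P by (intro sum_nonneg less_imp_le ln_p_pos)

lemma ln_P_mono: "k \<le> l \<Longrightarrow> ln (real (P k)) \<le> ln (real (P l))"
  using ln_P_split[of k l] sum_nonneg[of "{k+1..l}" "\<lambda>i. ln (real (p i))"] ln_p_pos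
  by (simp add: less_imp_le)

text \<open>The average of an increasing sequence is increasing: the first \<open>k\<close>
  logarithms are at most ln p_k and the later ones at least that. With \<open>k\<close> the cut at c
  l, this bounds the share of ln P_l given up by the cut.\<close>

lemma ln_P_average:
  assumes "k \<le> l"
  shows "real l * ln (real (P k)) \<le> real k * ln (real (P l))"
proof (cases "k = 0")
  case False
  have "ln (real (P k)) \<le> (\<Sum>i=1..k. ln (real (p k)))"
    unfolding ln_P using p_le p_gt_1 by (intro sum_mono) (auto simp: prime_gt_0_nat p_prime)
  then have 1: "ln (real (P k)) \<le> real k * ln (real (p k))" by simp
  have "(\<Sum>i=k+1..l. ln (real (p k))) \<le> (\<Sum>i=k+1..l. ln (real (p i)))"
    using p_le[of k] False by (intro sum_mono) (auto simp: prime_gt_0_nat p_prime)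
  then have "real (l - k) * ln (real (p k)) \<le> ln (real (P l)) - ln (real (P k))"
    using ln_P_split[OF assms] by simp
  then have "real k * (real (l - k) * ln (real (p k))) \<le> real k * (ln (real (P l)) - ln (real (P k)))"
    by (rule mult_left_mono) simp
  moreover have "real (l - k) * ln (real (P k)) \<le> real (l - k) * (real k * ln (real (p k)))"
    using 1 by (rule mult_left_mono) simp
  ultimately have "real (l - k) * ln (real (P k)) \<le> real k * (ln (real (P l)) - ln (real (P k)))"
    by (simp add: mult_ac)
  then show ?thesis using assms by (simp add: of_nat_diff algebra_simps)
qed (simp add: P_def)

text \<open>The primes are unbounded, so the average of their logarithms exceeds any
  constant.\<close>

lemma ln_P_superlinear:
  assumes "0 < c"
  shows "\<forall>\<^sub>F l in sequentially. C * real l \<le> ln (real (P (nat \<lfloor>c * real l\<rfloor>)))"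
proof -
  \<comment> \<open>The factor 2 pays for the floor and for discarding the first \<open>i0\<close>
    terms: c l - 1 - i0 is at least c l / 2 for large \<open>l\<close>. The threshold
    \<open>i0\<close> is chosen through p i \<ge> i - 1.\<close>
  define C' where "C' = 2 * \<bar>C\<bar> / c"
  define i0 where "i0 = nat \<lceil>exp C'\<rceil> + 1"
  have big: "C' \<le> ln (real (p i))" if "i \<ge> i0" for i
  proof -
    have "exp C' \<le> real (p i)" using that p_ge[of i] unfolding i0_def by linarith
    then show ?thesis using p_gt_1[of i] by (subst ln_ge_iff) auto
  qed
  have C'0: "C' \<ge> 0" using assms by (simp add: C'_def)
  have lower: "(real n - real i0) * C' \<le> ln (real (P n))" for n
  proof (cases "i0 \<le> n")
    case True
    have "(real n - real i0) * C' = (\<Sum>i=i0+1..n. C')" using True by (simp add: of_nat_diff)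
    also have "\<dots> \<le> (\<Sum>i=i0+1..n. ln (real (p i)))" by (intro sum_mono big) auto
    also have "\<dots> \<le> ln (real (P n))" using ln_P_split[OF True] ln_P_nonneg[of i0] by simp
    finally show ?thesis .
  next
    case False
    then have "(real n - real i0) * C' \<le> 0" using C'0 by (intro mult_nonpos_nonneg) auto
    then show ?thesis using ln_P_nonneg[of n] by linarith
  qed
  have "\<forall>\<^sub>F l in sequentially. l \<ge> nat \<lceil>2 * (1 + real i0) / c\<rceil>"
    by (rule eventually_ge_at_top)
  then show ?thesis
  proof eventually_elim
    case (elim l)
    have "2 * (1 + real i0) / c \<le> real l" using elim by linarith
    then have 1: "2 * (1 + real i0) \<le> c * real l" using assms by (simp add: field_simps)
    have "c * real l / 2 \<le> c * real l - 1 - real i0" using 1 by simp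
    also have "\<dots> \<le> real (nat \<lfloor>c * real l\<rfloor>) - real i0" by linarith
    finally have "c * real l / 2 * C' \<le> (real (nat \<lfloor>c * real l\<rfloor>) - real i0) * C'"
      using C'0 by (rule mult_right_mono)
    also have "\<dots> \<le> ln (real (P (nat \<lfloor>c * real l\<rfloor>)))" by (rule lower)
    also have "c * real l / 2 * C' = \<bar>C\<bar> * real l" using assms by (simp add: C'_def)
    finally show ?case
      using mult_right_mono[OF abs_ge_self[of C], of "real l"] by simp
  qed
qed

lemma ln_p_linear:
  obtains E :: real where "E > 0" "\<And>l. l \<ge> 1 \<Longrightarrow> ln (real (p l)) \<le> E * real l"
proof (rule admissible_primes_growth)
  fix D :: nat
  assume D: "D > 0" "\<And>l. enumerate (admissible_primes \<alpha>) l \<le> D ^ Suc l"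
  show thesis
  \<comment> \<open>The added 1 keeps the constant positive when \<open>D\<close> is 1.\<close>
  proof (rule that[of "ln (real D) + 1"])
    show "ln (real D) + 1 > 0" using D(1) ln_ge_zero[of "real D"] by linarith
    fix l :: nat assume l: "l \<ge> 1"
    have "p l \<le> D ^ l" using D(2)[of "l - 1"] l by (simp add: p_def)
    then have "ln (real (p l)) \<le> ln (real (D ^ l))"
      using p_gt_1[of l] D(1) by (subst ln_le_cancel_iff) (auto simp flip: of_nat_power)
    also have "\<dots> = real l * ln (real D)" using D(1) by (simp add: ln_realpow)
    also have "\<dots> \<le> (ln (real D) + 1) * real l" by (simp add: algebra_simps)
    finally show "ln (real (p l)) \<le> (ln (real D) + 1) * real l" .
  qed
qed

section \<open>The family of codes for fixed c, k and s\<close>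

context
  fixes c k :: real and s :: nat and M :: "nat \<Rightarrow> nat"
  assumes c: "0 < c" "c < 1" and k: "0 < k"
  assumes M: "\<And>l. M l = nat \<lfloor>root (Suc s) (k * real (P l) / real (P (nat \<lfloor>c * real l\<rfloor>)))\<rfloor>"
begin

lemma cut_le: "nat \<lfloor>c * real l\<rfloor> \<le> l" "real (nat \<lfloor>c * real l\<rfloor>) \<le> c * real l"
proof -
  show 1: "real (nat \<lfloor>c * real l\<rfloor>) \<le> c * real l" using c by simp
  also have "\<dots> \<le> 1 * real l" using c by (intro mult_right_mono) auto
  finally show "nat \<lfloor>c * real l\<rfloor> \<le> l" by simp
qed

lemma M_bounds:
  "real (M l) ^ Suc s * real (P (nat \<lfloor>c * real l\<rfloor>)) \<le> k * real (P l)"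
  "k * real (P l) < (real (M l) + 1) ^ Suc s * real (P (nat \<lfloor>c * real l\<rfloor>))"
proof -
  let ?q = "k * real (P l) / real (P (nat \<lfloor>c * real l\<rfloor>))"
  have "?q \<ge> 0" using k by simp
  from floor_root_bounds[OF this M]
  show "real (M l) ^ Suc s * real (P (nat \<lfloor>c * real l\<rfloor>)) \<le> k * real (P l)"
    "k * real (P l) < (real (M l) + 1) ^ Suc s * real (P (nat \<lfloor>c * real l\<rfloor>))"
    using P_pos by (simp_all add: field_simps)
qed

lemma ln_cut_le: "l \<ge> 1 \<Longrightarrow> ln (real (P (nat \<lfloor>c * real l\<rfloor>))) \<le> c * ln (real (P l))"
proof -
  assume l: "l \<ge> 1"
  have "real l * ln (real (P (nat \<lfloor>c * real l\<rfloor>))) \<le> real (nat \<lfloor>c * real l\<rfloor>) * ln (real (P l))"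
    by (rule ln_P_average[OF cut_le(1)])
  also have "\<dots> \<le> c * real l * ln (real (P l))" using cut_le(2) ln_P_nonneg by (rule mult_right_mono)
  finally have "real l * ln (real (P (nat \<lfloor>c * real l\<rfloor>))) \<le> real l * (c * ln (real (P l)))"
    by (simp add: mult_ac)
  then show ?thesis using l by simp
qed

text \<open>The floor loses less than 1, so (M + 1)^(s+1) exceeds k P_l / P_m, and the average
  inequality bounds ln P_m by c ln P_l.\<close>

lemma ln_M_lower:
  assumes "l \<ge> 1"
  shows "ln k + (1 - c) * ln (real (P l)) \<le> real (Suc s) * ln (real (M l) + 1)"
proof -
  have "ln (k * real (P l)) \<le> ln ((real (M l) + 1) ^ Suc s * real (P (nat \<lfloor>c * real l\<rfloor>)))"
    using M_bounds(2)[of l] k P_pos by (subst ln_le_cancel_iff) auto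
  also have "\<dots> = real (Suc s) * ln (real (M l) + 1) + ln (real (P (nat \<lfloor>c * real l\<rfloor>)))"
    using P_pos by (subst ln_mult_pos) (auto simp del: power_Suc simp: ln_realpow)
  finally have "ln k + ln (real (P l)) \<le> real (Suc s) * ln (real (M l) + 1) + ln (real (P (nat \<lfloor>c * real l\<rfloor>)))"
    using k P_pos by (simp add: ln_mult_pos)
  then show ?thesis using ln_cut_le[OF assms] by (simp add: algebra_simps)
qed

lemma ln_P_large: "\<forall>\<^sub>F l in sequentially. l \<ge> 1 \<and> C \<le> ln (real (P l))"
  using ln_P_superlinear[OF c(1), of "\<bar>C\<bar>"] eventually_ge_at_top[of 1]
proof eventually_elim
  case (elim l)
  have "C \<le> \<bar>C\<bar> * 1" by simp
  also have "\<dots> \<le> \<bar>C\<bar> * real l" using elim(2) by (intro mult_left_mono) auto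
  also have "\<dots> \<le> ln (real (P l))" using elim(1) ln_P_mono[OF cut_le(1)] by (rule order.trans)
  finally show ?case using elim(2) by simp
qed

lemma eventually_M_pos: "\<forall>\<^sub>F l in sequentially. l \<ge> 1 \<and> M l \<ge> 1"
  using ln_P_large[of "(1 - ln k) / (1 - c)"]
proof eventually_elim
  case (elim l)
  then have "1 \<le> ln k + (1 - c) * ln (real (P l))" using c by (simp add: field_simps)
  also have "\<dots> \<le> real (Suc s) * ln (real (M l) + 1)" using elim by (intro ln_M_lower) simp
  \<comment> \<open>For \<open>M l = 0\<close> the right-hand side is a multiple of ln 1 = 0,
    against the lower bound 1.\<close>
  finally have "M l \<noteq> 0" by (intro notI) simp
  then show ?case using elim by simp
qed

text \<open>Since P_m \<ge> 1, the definition of \<open>M l\<close> gives M^(s+1) \<le> k P_l, and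
  the bound on \<open>k\<close> says that \<open>C_const \<alpha> * k ^ (r + 1)\<close> is less than
  1.\<close>

lemma good_split_code_cut:
  assumes l: "l \<ge> 1" "M l \<ge> 1" and kC: "k < 1 / root (r + 1) (C_const \<alpha>)"
  shows "good_split_code r s \<alpha> (M l) p l"
proof -
  have "(\<Prod>i=1..l. \<Prod>\<pp>\<in>(primes_above (p i) :: 'k set set). ideal_norm \<pp>)
      = (\<Prod>i=1..l. \<Prod>\<pp>\<in>(primes_above (p i) :: 'k set set). p i)"
    using primes_above_p(3) by (intro prod.cong) auto
  also have "\<dots> = P l ^ (r + 1)"
    by (simp only: prod_constant primes_above_p(2) P_def prod_power_distrib)
  finally have norms: "real (\<Prod>i=1..l. \<Prod>\<pp>\<in>(primes_above (p i) :: 'k set set). ideal_norm \<pp>) = real (P l) ^ (r + 1)"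
    by simp
  have "C_const \<alpha> * (real (M l) ^ (s + 1) - 1) ^ (r + 1) < real (P l) ^ (r + 1)"
  proof (cases "C_const \<alpha> = 0")
    case True
    then show ?thesis using P_pos by simp
  next
    case False
    then have C: "C_const \<alpha> > 0" using C_const_nonneg[of \<alpha>] by simp
    have "1 * real (M l) ^ Suc s \<le> real (P (nat \<lfloor>c * real l\<rfloor>)) * real (M l) ^ Suc s"
      using P_pos[of "nat \<lfloor>c * real l\<rfloor>"] by (intro mult_right_mono) auto
    then have "real (M l) ^ Suc s \<le> k * real (P l)" using M_bounds(1)[of l] by (simp add: mult.commute)
    moreover have "1 \<le> real (M l) ^ Suc s" using l(2) by (intro one_le_power) simp
    ultimately have "(real (M l) ^ (s + 1) - 1) ^ (r + 1) \<le> (k * real (P l)) ^ (r + 1)"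
      by (intro power_mono) auto
    then have "C_const \<alpha> * (real (M l) ^ (s + 1) - 1) ^ (r + 1) \<le> C_const \<alpha> * (k * real (P l)) ^ (r + 1)"
      using C by (intro mult_left_mono) auto
    also have "\<dots> = (C_const \<alpha> * k ^ (r + 1)) * real (P l) ^ (r + 1)"
      by (simp only: power_mult_distrib mult.assoc)
    also have "\<dots> < 1 * real (P l) ^ (r + 1)"
    proof (rule mult_strict_right_mono)
      have "root (r + 1) (C_const \<alpha>) * k < 1" using kC C by (simp add: field_simps)
      then have "(root (r + 1) (C_const \<alpha>) * k) ^ (r + 1) < 1 ^ (r + 1)"
        using C k by (intro power_strict_mono) auto
      moreover have "root (r + 1) (C_const \<alpha>) ^ (r + 1) = C_const \<alpha>"
        using C by (intro real_root_pow_pos2) auto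
      ultimately show "C_const \<alpha> * k ^ (r + 1) < 1" unfolding power_mult_distrib by simp
    qed (use P_pos in simp)
    finally show ?thesis by simp
  qed
  moreover have "strict_mono_on {1..l} p"
    by (rule strict_mono_onI) (auto intro: p_less)
  ultimately show ?thesis
    unfolding good_split_code_def norms using l(2) p_adm by auto
qed

text \<open>Inserting M^(s+1) P_m \<le> k P_l into the distance bound cancels P_l^(r+1) and leaves
  P_m^(r+1) \<le> (K k)^(r+1) p_l^(h+b). In logarithms the left side outgrows every linear function
  of \<open>l\<close>, while for h < N the right side is at most linear.\<close>

lemma eventually_distance:
  "\<forall>\<^sub>F l in sequentially. l \<ge> 1 \<longrightarrow> M l \<ge> 1 \<longrightarrow>
    (\<forall>x\<in>messages r s \<alpha> (M l). \<forall>y\<in>messages r s \<alpha> (M l). x \<noteq> y \<longrightarrow>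
      N \<le> hamming_dist (split_coords p l) (split_encode p l x) (split_encode p l y))"
proof (rule distance_bound, rule ln_p_linear)
  fix K b :: nat and E :: real
  assume K: "K > 0" and bound: "\<And>l n s x y. l \<ge> 1 \<Longrightarrow> n \<ge> 1 \<Longrightarrow> x \<in> messages r s \<alpha> n \<Longrightarrow>
      y \<in> messages r s \<alpha> n \<Longrightarrow> x \<noteq> y \<Longrightarrow>
      P l ^ (r + 1) \<le> (K * n ^ Suc s) ^ (r + 1) *
        p l ^ (hamming_dist (split_coords p l) (split_encode p l x) (split_encode p l y) + b)"
    and E: "E > 0" "\<And>l. l \<ge> 1 \<Longrightarrow> ln (real (p l)) \<le> E * real l"
  \<comment> \<open>The three summands pay for the constant ln (K k), for strictness, and for N + b
    factors \<open>p l\<close>.\<close>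
  define B where "B = \<bar>ln (real K * k)\<bar> + 1 + real (N + b) * E"
  show ?thesis
    using ln_P_superlinear[OF c(1), of B]
  proof (eventually_elim, intro impI ballI)
    fix l x y
    assume big: "B * real l \<le> ln (real (P (nat \<lfloor>c * real l\<rfloor>)))" and l: "1 \<le> l" "1 \<le> M l"
      and xy: "x \<in> messages r s \<alpha> (M l)" "y \<in> messages r s \<alpha> (M l)" "x \<noteq> y"
    define h where "h = hamming_dist (split_coords p l) (split_encode p l x) (split_encode p l y)"
    let ?m = "nat \<lfloor>c * real l\<rfloor>"
    show "N \<le> h"
    proof (rule ccontr)
      assume "\<not> N \<le> h"
      then have hN: "real (h + b) \<le> real (N + b)" by simp
      have Pm: "real (P ?m) > 0" "real (P l) > 0" "real (p l) > 0"
        using P_pos p_gt_1[of l] by auto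
      have "real (P l) ^ (r + 1) \<le> (real K * real (M l) ^ Suc s) ^ (r + 1) * real (p l) ^ (h + b)"
        using of_nat_mono[OF bound[OF l xy]] unfolding h_def of_nat_mult of_nat_power .
      then have "real (P l) ^ (r + 1) * real (P ?m) ^ (r + 1)
          \<le> (real K * real (M l) ^ Suc s) ^ (r + 1) * real (p l) ^ (h + b) * real (P ?m) ^ (r + 1)"
        by (rule mult_right_mono) simp
      also have "\<dots> = (real K * (real (M l) ^ Suc s * real (P ?m))) ^ (r + 1) * real (p l) ^ (h + b)"
        unfolding power_mult_distrib by (simp only: mult_ac)
      also have "\<dots> \<le> (real K * (k * real (P l))) ^ (r + 1) * real (p l) ^ (h + b)"
        using M_bounds(1)[of l] by (intro mult_right_mono power_mono mult_left_mono) auto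
      also have "\<dots> = real (P l) ^ (r + 1) * ((real K * k) ^ (r + 1) * real (p l) ^ (h + b))"
        unfolding power_mult_distrib by (simp only: mult_ac)
      finally have "real (P ?m) ^ (r + 1) \<le> (real K * k) ^ (r + 1) * real (p l) ^ (h + b)"
        using Pm by (simp only: mult_le_cancel_left_pos zero_less_power)
      then have "ln (real (P ?m) ^ (r + 1)) \<le> ln ((real K * k) ^ (r + 1) * real (p l) ^ (h + b))"
        using Pm K k by (subst ln_le_cancel_iff) auto
      then have "real (r + 1) * ln (real (P ?m)) \<le> ln ((real K * k) ^ (r + 1)) + ln (real (p l) ^ (h + b))"
        using Pm K k by (subst (asm) ln_mult_pos) (auto simp del: power_Suc simp: ln_realpow)
      then have "real (r + 1) * ln (real (P ?m)) \<le> real (r + 1) * ln (real K * k) + real (h + b) * ln (real (p l))"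
        using Pm K k by (simp only: ln_realpow of_nat_0_less_iff mult_pos_pos)
      then have main: "real (r + 1) * (ln (real (P ?m)) - ln (real K * k)) \<le> real (h + b) * ln (real (p l))"
        by (simp only: right_diff_distrib)
      have less: "real (N + b) * E * real l < ln (real (P ?m)) - ln (real K * k)"
      proof -
        have "\<bar>ln (real K * k)\<bar> * 1 \<le> \<bar>ln (real K * k)\<bar> * real l" using l by (intro mult_left_mono) auto
        moreover have "B * real l = \<bar>ln (real K * k)\<bar> * real l + real l + real (N + b) * E * real l"
          by (simp add: B_def algebra_simps)
        ultimately show ?thesis using big l by linarith
      qed
      \<comment> \<open>The difference of logarithms is thus positive, so the factor r + 1 can only
        enlarge it.\<close>
      moreover have "0 \<le> real (N + b) * E * real l" using E(1) by simp
      ultimately have "1 * (ln (real (P ?m)) - ln (real K * k))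
          \<le> real (r + 1) * (ln (real (P ?m)) - ln (real K * k))"
        by (intro mult_right_mono) auto
      then have "ln (real (P ?m)) - ln (real K * k) \<le> real (r + 1) * (ln (real (P ?m)) - ln (real K * k))"
        by (simp only: mult_1)
      with less have "real (N + b) * E * real l < real (r + 1) * (ln (real (P ?m)) - ln (real K * k))"
        by (rule order.strict_trans2)
      also note main
      also have "real (h + b) * ln (real (p l)) \<le> real (N + b) * (E * real l)"
        using hN E(2)[OF l(1)] less_imp_le[OF ln_p_pos] by (intro mult_mono) auto
      finally show False by simp
    qed
  qed
qed

lemma card_code_ge:
  assumes l: "M l \<ge> 1" and inj: "inj_on (split_encode p l) (messages r s \<alpha> (M l))"
  shows "(M l ^ Suc s) ^ r \<le> card (split_code r s \<alpha> (M l) p l)"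
proof -
  have r: "r < degree m" using degree_m_r by simp
  let ?X = "{..<r} \<rightarrow>\<^sub>E {..<M l ^ Suc s}"
  define F where "F = (\<lambda>f :: nat \<Rightarrow> nat. val (\<lambda>i. int (if i < r then f i else 0)))"
  have F: "F f \<in> messages r s \<alpha> (M l)" if "f \<in> ?X" for f
    unfolding F_def using l that by (intro val_in_messages r) (auto simp: PiE_iff)
  have "inj_on F ?X"
  proof (rule inj_onI)
    fix f g assume fg: "f \<in> ?X" "g \<in> ?X" "F f = F g"
    show "f = g"
    proof (rule PiE_ext[OF fg(1,2)])
      fix i assume "i \<in> {..<r}"
      then show "f i = g i" using val_inj[OF fg(3)[unfolded F_def], of i] r by simp
    qed
  qed
  then have "inj_on (split_encode p l \<circ> F) ?X"
    using inj F by (intro comp_inj_on inj_on_subset[OF inj]) auto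
  moreover have "(split_encode p l \<circ> F) ` ?X \<subseteq> split_code r s \<alpha> (M l) p l"
    using F by (auto simp: split_code_def)
  moreover have "finite (split_code r s \<alpha> (M l) p l)"
    using finite_subset[OF split_code_subset code_space_split(3)] .
  ultimately have "card ?X \<le> card (split_code r s \<alpha> (M l) p l)" by (rule card_inj_on_le)
  then show ?thesis by (simp add: card_PiE)
qed

text \<open>Distance at least 1 makes the encoding injective, so codewords are counted by messages.
  The logarithms compare as r (1 - c) ln P_l to (r + 1) ln P_l up to a constant, and the factor 2
  absorbs that constant.\<close>

lemma eventually_rate:
  assumes r: "r \<ge> 1"
  shows "\<forall>\<^sub>F l in sequentially. l \<ge> 1 \<longrightarrow> M l \<ge> 1 \<longrightarrow>
    real r * (1 - c) / (2 * real (r + 1)) \<le> ln (real (card (split_code r s \<alpha> (M l) p l))) /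
      ln (real (card (code_space (split_coords p l :: (nat \<times> 'k set) set) residue_alphabet)))"
proof -
  \<comment> \<open>The loss from \<open>k\<close> and from replacing M + 1 by 2 M.\<close>
  define Q where "Q = real (Suc s) * ln 2 - ln k"
  show ?thesis
    using eventually_distance[of 1] ln_P_large[of "\<bar>2 * Q / (1 - c)\<bar> + 1"]
  proof (eventually_elim, intro impI)
    fix l
    assume dist: "l \<ge> 1 \<longrightarrow> M l \<ge> 1 \<longrightarrow>
      (\<forall>x\<in>messages r s \<alpha> (M l). \<forall>y\<in>messages r s \<alpha> (M l). x \<noteq> y \<longrightarrow>
        1 \<le> hamming_dist (split_coords p l) (split_encode p l x) (split_encode p l y))"
      and big: "1 \<le> l \<and> \<bar>2 * Q / (1 - c)\<bar> + 1 \<le> ln (real (P l))" and l: "l \<ge> 1" "M l \<ge> 1"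
    have "inj_on (split_encode p l) (messages r s \<alpha> (M l))"
    proof (rule inj_onI, rule ccontr)
      fix x y assume xy: "x \<in> messages r s \<alpha> (M l)" "y \<in> messages r s \<alpha> (M l)"
        "split_encode p l x = split_encode p l y" "x \<noteq> y"
      then have "1 \<le> hamming_dist (split_coords p l) (split_encode p l x) (split_encode p l y)"
        using dist l by blast
      then show False by (simp add: xy(3) hamming_dist_def)
    qed
    from card_code_ge[OF l(2) this]
    have "real ((M l ^ Suc s) ^ r) \<le> real (card (split_code r s \<alpha> (M l) p l))" by (rule of_nat_mono)
    moreover have "real ((M l ^ Suc s) ^ r) > 0" using l(2) by simp
    ultimately have "ln (real ((M l ^ Suc s) ^ r)) \<le> ln (real (card (split_code r s \<alpha> (M l) p l)))"
      by simp
    then have code: "real r * (real (Suc s) * ln (real (M l))) \<le> ln (real (card (split_code r s \<alpha> (M l) p l)))"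
      using l(2) by (simp add: ln_realpow del: power_Suc of_nat_Suc)
    have P1: "ln (real (P l)) \<ge> 1" and P2: "2 * Q / (1 - c) \<le> ln (real (P l))" using big by linarith+
    have "ln (real (M l) + 1) \<le> ln (2 * real (M l))" using l(2) by (subst ln_le_cancel_iff) auto
    also have "\<dots> = ln 2 + ln (real (M l))" using l(2) by (simp add: ln_mult_pos)
    finally have "real (Suc s) * ln (real (M l) + 1) \<le> real (Suc s) * (ln 2 + ln (real (M l)))"
      by (rule mult_left_mono) simp
    then have "(1 - c) * ln (real (P l)) - Q \<le> real (Suc s) * ln (real (M l))"
      using ln_M_lower[OF l(1)] by (simp add: Q_def distrib_left)
    moreover have "Q \<le> (1 - c) * ln (real (P l)) / 2" using P2 c by (simp add: field_simps)
    ultimately have "(1 - c) * ln (real (P l)) / 2 \<le> real (Suc s) * ln (real (M l))" by linarith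
    then have "real r * ((1 - c) * ln (real (P l)) / 2) \<le> real r * (real (Suc s) * ln (real (M l)))"
      by (rule mult_left_mono) simp
    also note code
    also have "real r * ((1 - c) * ln (real (P l)) / 2)
        = real r * (1 - c) / (2 * real (r + 1)) * (real (r + 1) * ln (real (P l)))"
      by (simp add: divide_simps del: of_nat_add)
    finally have "real r * (1 - c) / (2 * real (r + 1)) * (real (r + 1) * ln (real (P l)))
        \<le> ln (real (card (split_code r s \<alpha> (M l) p l)))" .
    moreover have "ln (real (card (code_space (split_coords p l :: (nat \<times> 'k set) set) residue_alphabet)))
        = real (r + 1) * ln (real (P l))"
      using P_pos by (simp add: code_space_split(2) ln_realpow del: power_Suc)
    moreover have "real (r + 1) * ln (real (P l)) > 0" using P1 by simp
    ultimately show "real r * (1 - c) / (2 * real (r + 1)) \<le> ln (real (card (split_code r s \<alpha> (M l) p l))) /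
      ln (real (card (code_space (split_coords p l :: (nat \<times> 'k set) set) residue_alphabet)))"
      by (simp only: pos_le_divide_eq)
  qed
qed

lemma almost_good_family:
  assumes r: "r \<ge> 1" and L: "L = {l. l \<ge> 1 \<and> M l \<ge> 1}"
  shows "almost_good L (split_coords p :: nat \<Rightarrow> (nat \<times> 'k set) set) (\<lambda>l. residue_alphabet)
    (\<lambda>l. split_code r s \<alpha> (M l) p l)"
  unfolding almost_good_def
proof (intro conjI ballI)
  \<comment> \<open>Limits along \<open>L\<close> become limits over all \<open>l\<close> with the
    conditions defining \<open>L\<close> as premises, the form in which rate and distance were
    proved.\<close>
  have ev: "\<forall>\<^sub>F l in inf sequentially (principal L). Q l"
    if "\<forall>\<^sub>F l in sequentially. l \<ge> 1 \<longrightarrow> M l \<ge> 1 \<longrightarrow> Q l" for Q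
    unfolding eventually_inf_principal using that by eventually_elim (simp add: L)
  obtain l0 where "\<And>l. l \<ge> l0 \<Longrightarrow> l \<in> L"
    using eventually_M_pos unfolding eventually_sequentially L by auto
  then have "{l0..} \<subseteq> L" by auto
  then show "infinite L" using infinite_Ici[of l0] infinite_super by blast
  show "is_code (split_coords p l) residue_alphabet (split_code r s \<alpha> (M l) p l)" for l
    by (rule split_code_is_code)
  let ?\<epsilon> = "real r * (1 - c) / (2 * real (r + 1))"
  let ?f = "\<lambda>l. ereal (ln (real (card (split_code r s \<alpha> (M l) p l))) /
    ln (real (card (code_space (split_coords p l :: (nat \<times> 'k set) set) residue_alphabet))))"
  have "0 < ereal ?\<epsilon>" using r c by simp
  also have "ereal ?\<epsilon> \<le> Liminf (inf sequentially (principal L)) ?f"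
    by (rule Liminf_bounded) (use ev[OF eventually_rate[OF r]] in simp)
  finally show "0 < Liminf (inf sequentially (principal L)) ?f" .
  let ?g = "\<lambda>l. min_dist (split_coords p l :: (nat \<times> 'k set) set) (split_code r s \<alpha> (M l) p l)"
  have "enat n \<le> Liminf (inf sequentially (principal L)) ?g" for n
  proof (rule Liminf_bounded)
    show "\<forall>\<^sub>F l in inf sequentially (principal L). enat n \<le> ?g l"
    proof (rule ev, use eventually_distance[of n] in eventually_elim, intro impI)
      fix l
      assume d: "1 \<le> l \<longrightarrow> 1 \<le> M l \<longrightarrow>
          (\<forall>x\<in>messages r s \<alpha> (M l). \<forall>y\<in>messages r s \<alpha> (M l). x \<noteq> y \<longrightarrow>
            n \<le> hamming_dist (split_coords p l) (split_encode p l x) (split_encode p l y))"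
        and l: "1 \<le> l" "1 \<le> M l"
      show "enat n \<le> ?g l"
        unfolding min_dist_def
      proof (rule Inf_greatest)
        fix z
        assume "z \<in> {enat (hamming_dist (split_coords p l :: (nat \<times> 'k set) set) u v) |u v.
          u \<in> split_code r s \<alpha> (M l) p l \<and> v \<in> split_code r s \<alpha> (M l) p l \<and> u \<noteq> v}"
        then obtain x y where xy: "x \<in> messages r s \<alpha> (M l)" "y \<in> messages r s \<alpha> (M l)"
          "split_encode p l x \<noteq> split_encode p l y"
          and z: "z = enat (hamming_dist (split_coords p l) (split_encode p l x) (split_encode p l y))"
          by (auto simp: split_code_def)
        have "x \<noteq> y" using xy(3) by blast
        then show "enat n \<le> z" using d l xy(1,2) by (simp add: z)
      qed
    qed
  qed
  then show "Liminf (inf sequentially (principal L)) ?g = \<infinity>"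
  proof (cases "Liminf (inf sequentially (principal L)) ?g")
    case (enat n)
    then show ?thesis using \<open>\<And>n. enat n \<le> Liminf (inf sequentially (principal L)) ?g\<close>[of "Suc n"] by simp
  qed
qed

end

end

theorem theorem4p12:
  fixes r s :: nat and \<alpha> :: "'k::field_char_0" and c k :: real
    and p P M :: "nat \<Rightarrow> nat" and L :: "nat set"
  assumes "r \<ge> 1" and "s \<ge> 1"
    and "rat_degree TYPE('k) = r + 1" and "galois_over_rat TYPE('k)"
    and "\<alpha> \<in> carrier \<O>" and "rat_adjoin \<alpha> = UNIV"
    and "0 < c" and "c < 1"
    and "0 < k" and "k < 1 / root (r + 1) (C_const \<alpha>)"
    and "p = (\<lambda>j. enumerate (admissible_primes \<alpha>) (j - 1))"
    and "P = (\<lambda>l. \<Prod>i=1..l. p i)"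
    and "M = (\<lambda>l. nat \<lfloor>root (s + 1) (k * real (P l) / real (P (nat \<lfloor>c * real l\<rfloor>)))\<rfloor>)"
    and "L = {l. l \<ge> 1 \<and> M l \<ge> 1}"
  shows "(\<forall>\<^sub>F l in sequentially. l \<in> L) \<and>
    (\<forall>l\<in>L. good_split_code r s \<alpha> (M l) p l) \<and>
    almost_good L (split_coords p) (\<lambda>l. residue_alphabet) (\<lambda>l. split_code r s \<alpha> (M l) p l)"
proof -
  interpret split_primes \<alpha> p P r
  proof unfold_locales
    show "algebraic_int \<alpha>" using assms(5) by (simp add: ring_of_integers_simps)
  qed (use assms in auto)
  have M: "M l = nat \<lfloor>root (Suc s) (k * real (P l) / real (P (nat \<lfloor>c * real l\<rfloor>)))\<rfloor>" for l
    unfolding assms(13) by simp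
  note facts = assms(7-9) M
  show ?thesis
  proof (intro conjI ballI)
    show "\<forall>\<^sub>F l in sequentially. l \<in> L"
      using eventually_M_pos[OF facts] by (simp add: assms(14))
    show "good_split_code r s \<alpha> (M l) p l" if "l \<in> L" for l
      using that assms(10) by (intro good_split_code_cut[OF facts]) (auto simp: assms(14))
    show "almost_good L (split_coords p) (\<lambda>l. residue_alphabet) (\<lambda>l. split_code r s \<alpha> (M l) p l)"
      by (rule almost_good_family[OF facts assms(1,14)])
  qed
qed

end
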